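(* Assume $\mathbf{E}(s^{X_0^*})<\infty$ for all $|s|<m$. Then $F_\infty\in C^\infty[0,1]$ and for every integer $k\ge 0$ and every $p\in[0,1]$, $$F_\infty^{(k)}(p)=\frac{d^k}{dp^k}\Big(\mathbf{E}(X_0)-\frac{1}{m-1}\Big)+\sum_{n=0}^{\infty}\frac{1}{m^{n+1}}\frac{d^k}{dp^k}\mathbf{P}(X_n=0)^m,$$ where, for each $k$, the series converges uniformly in $p\in[0,1]$.
   Context: Fix an integer $m\ge 2$. Let $X_0^*$ be a random variable with values in $\{1,2,3,\dots\}$ such that $\mathbf{P}(X_0^*\ge 2)>0$. For $p\in[0,1]$ let $X_0$ (depending on $p$) be the nonnegative integer-valued random variable with $\mathbf{P}(X_0=0)=1-p$ and $\mathbf{P}(X_0=k)=p\,\mathbf{P}(X_0^*=k)$ for $k\ge1$. For $n\ge0$ the law of $X_{n+1}$ is defined recursively by $X_{n+1}=(X_{n,1}+\cdots+X_{n,m}-1)^+$, where $X_{n,1},\dots,X_{n,m}$ are independent copies of $X_n$ and $a^+=\max\{a,0\}$. The free energy is $F_\infty(p):=\lim_{n\to\infty}\mathbf{E}(X_n)/m^n$ (a nonincreasing limit). $F_\infty^{(k)}$ denotes the $k$-th derivative of $F_\infty$ on $[0,1]$, with derivatives at $p=0$ meaning right derivatives and at $p=1$ meaning left derivatives. *)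

theory Defs
  imports "HOL-Probability.Probability"
begin

(* A random variable enters only through its law, so X0* is given by \<mu> :: nat pmf. *)

definition initial_law :: "nat pmf \<Rightarrow> real \<Rightarrow> nat pmf" where
  "initial_law \<mu> p = bind_pmf (bernoulli_pmf p) (\<lambda>b. if b then \<mu> else return_pmf 0)"

lemma pmf_initial_law:
  assumes "0 \<le> p" "p \<le> 1" "pmf \<mu> 0 = 0"
  shows "pmf (initial_law \<mu> p) k = (if k = 0 then 1 - p else p * pmf \<mu> k)"
  using assms by (simp add: initial_law_def pmf_bind)

(* The law of X_n.  Under Pi_pmf the coordinates x 0, ..., x (m - 1) are independent copies
   of the previous variable; subtraction on nat truncates at 0, which is the positive part. *)
primrec dr_law :: "nat \<Rightarrow> nat pmf \<Rightarrow> real \<Rightarrow> nat \<Rightarrow> nat pmf" where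
  "dr_law m \<mu> p 0 = initial_law \<mu> p"
| "dr_law m \<mu> p (Suc n) =
     map_pmf (\<lambda>x. (\<Sum>i<m. x i) - 1) (Pi_pmf {..<m} 0 (\<lambda>_. dr_law m \<mu> p n))"

definition dr_mean :: "nat \<Rightarrow> nat pmf \<Rightarrow> nat \<Rightarrow> real \<Rightarrow> real" where
  "dr_mean m \<mu> n p = measure_pmf.expectation (dr_law m \<mu> p n) real"

definition free_energy :: "nat \<Rightarrow> nat pmf \<Rightarrow> real \<Rightarrow> real" where
  "free_energy m \<mu> p = lim (\<lambda>n. dr_mean m \<mu> n p / real m ^ n)"

(* The derivative is taken within S, so it is one-sided at the endpoints of an interval. *)
primrec higher_deriv_within :: "real set \<Rightarrow> nat \<Rightarrow> (real \<Rightarrow> real) \<Rightarrow> real \<Rightarrow> real" where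
  "higher_deriv_within S 0 f = f"
| "higher_deriv_within S (Suc k) f =
     (\<lambda>x. vector_derivative (higher_deriv_within S k f) (at x within S))"

definition C_infinity_on :: "real set \<Rightarrow> (real \<Rightarrow> real) \<Rightarrow> bool" where
  "C_infinity_on S f \<longleftrightarrow>
     (\<forall>k. higher_deriv_within S k f differentiable_on S \<and>
          continuous_on S (higher_deriv_within S k f))"

end

(* Let U_n(z) be the power series of the tails P(X_n > k). The recursion is U_{n+1} = shift(V), where
   V = (G^m - 1)/(z - 1) and G = 1 + (z - 1) U_n, and it makes sense for complex p, so that
   g_n = P(X_n = 0) = 1 - U_n(0) is a polynomial in p. Since F = E X_0 - 1/(m-1) + sum_n g_n^m / m^(n+1),
   it suffices to show that every derivative of g_n^m is O(e^(eps n)) uniformly in p for every eps > 0.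

   By Cauchy's inequality this follows from a bound on g_n in a complex disc of radius e^(-eps n) around p.
   In a weighted l^1 norm with radius s < m a perturbation of U_n grows by at most (m/s) G_n(s)^(m-1) per
   step, so the point is that the product of G_i(s)^(m-1) over i < n grows subexponentially as s -> m.
   This holds unless g_n is doubly exponentially small: otherwise P(X_i > k) is at most e^(delta n) m^(-k)
   for i + k <= n, and the product is read off from two monotone quantities, D = G - s (s - 1) G' once it
   is negative, and a second-order quantity before that: the tangent to the concave function D at s,
   evaluated at m. If g_n is doubly exponentially small, a much smaller disc suffices. *)
theory Submission
  imports Defs "HOL-Complex_Analysis.Complex_Analysis" "HOL-Real_Asymp.Real_Asymp"
begin

section \<open>Criticality functionals of a generating function\<close>

text \<open>The bounds must be uniform in p, although the sign of D may change at any generation,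
  depending on p. No threshold value of p is ever identified: the sign is tested generation by
  generation. At the point m itself D would be exactly multiplicative, but the hypotheses give
  finite moments only below m. Hence three radii with small L: at m there are only crude bounds, for
  tails truncated at degree n - i; at m - L^3 the sign of D is tested; at m - L the product is
  estimated. L^3 is so small that replacing m by m - L^3 does not disturb the second-order quantity,
  whose gain has size L^2. It is still positive, so what truncation cuts off in generation i,
  beginning at degree n - i + 1, weighs exponentially little there as long as n - i is large. The
  last generations violate this; a small fraction of them is set aside and estimated crudely at
  radius 1. A disc of radius e^(-eps n) costs e^(eps k n) in the k-th derivative, which the weight
  m^(-n-1) beats once eps k < ln m.\<close>

text \<open>For a law on the naturals with tail polynomial \<open>U(x) = \<Sum>\<^sub>k P(X > k) x\<^sup>k\<close>, the probability
  generating function is \<open>1 + (x - 1) U(x)\<close>. The tail polynomial of a sum of \<open>m\<close> independent copies is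
  \<open>step_poly m U\<close>; deleting its constant coefficient and shifting the others down by one yields the
  tails of the next generation. The functionals below depend only on \<open>J'\<close> and \<open>J''\<close>, so the next
  generation is obtained by taking \<open>J = step_poly m U\<close> instead of \<open>J = x U(x)\<close>.\<close>

definition pgf_poly :: "real poly \<Rightarrow> real poly" where
  "pgf_poly U = 1 + [:-1, 1:] * U"

definition step_poly :: "nat \<Rightarrow> real poly \<Rightarrow> real poly" where
  "step_poly m U = U * (\<Sum>l<m. pgf_poly U ^ l)"

text \<open>With \<open>J = x U(x)\<close> and generating function \<open>G\<close> this is \<open>G(x) - x (x - 1) G'(x)\<close>, whose sign at
  \<open>x = m\<close> separates the subcritical from the supercritical laws; \<open>crit'\<close> is minus its derivative.\<close>

definition crit :: "real poly \<Rightarrow> real \<Rightarrow> real" where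
  "crit J x = 1 - (x - 1)\<^sup>2 * poly (pderiv J) x"

definition crit' :: "real poly \<Rightarrow> real \<Rightarrow> real" where
  "crit' J x = 2 * (x - 1) * poly (pderiv J) x + (x - 1)\<^sup>2 * poly (pderiv (pderiv J)) x"

text \<open>Up to a positive factor this is the derivative of \<open>s D(s) / ((s - 1) (M - s))\<close>, where \<open>D\<close> is
  the functional \<open>crit\<close>. To leading order it is the value at \<open>M\<close> of the tangent of \<open>D\<close> at \<open>x\<close>.\<close>

definition tangent :: "real \<Rightarrow> real poly \<Rightarrow> real \<Rightarrow> real" where
  "tangent M J x = (1 - M / x\<^sup>2) * crit J x - (x - 1) * (M - x) / x * crit' J x"

lemma poly_pgf_poly: "poly (pgf_poly U) x = 1 + (x - 1) * poly U x"
  by (simp add: pgf_poly_def algebra_simps)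

lemma step_poly_eq: "[:-1, 1:] * step_poly m U = pgf_poly U ^ m - 1"
proof -
  have "[:-1, 1:] * step_poly m U = (pgf_poly U - 1) * (\<Sum>l<m. pgf_poly U ^ l)"
    by (simp add: step_poly_def pgf_poly_def algebra_simps)
  also have "\<dots> = pgf_poly U ^ m - 1"
    by (rule power_diff_1_eq [symmetric])
  finally show ?thesis .
qed

lemma pderiv_pgf_poly: "pderiv (pgf_poly U) = U + [:-1, 1:] * pderiv U"
  unfolding pgf_poly_def pderiv_add pderiv_mult by (simp add: pderiv_pCons)

lemma poly_pderiv_pgf_poly: "poly (pderiv (pgf_poly U)) x = poly U x + (x - 1) * poly (pderiv U) x"
  by (simp add: pderiv_pgf_poly algebra_simps)

lemma poly_pderiv2_pgf_poly:
  "poly (pderiv (pderiv (pgf_poly U))) x = 2 * poly (pderiv U) x + (x - 1) * poly (pderiv (pderiv U)) x"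
  unfolding pderiv_pgf_poly pderiv_add pderiv_mult by (simp add: pderiv_pCons algebra_simps)

lemma crit_pCons:
  "crit (pCons 0 U) x = poly (pgf_poly U) x - x * (x - 1) * poly (pderiv (pgf_poly U)) x"
  by (simp add: crit_def poly_pgf_poly poly_pderiv_pgf_poly pderiv_pCons algebra_simps power2_eq_square)

lemma crit'_pCons:
  "crit' (pCons 0 U) x = (x - 1) * (2 * poly (pderiv (pgf_poly U)) x + x * poly (pderiv (pderiv (pgf_poly U))) x)"
  by (simp add: crit'_def poly_pgf_poly poly_pderiv_pgf_poly poly_pderiv2_pgf_poly pderiv_pCons pderiv_add
      algebra_simps power2_eq_square)

lemma poly_step_poly: "(x - 1) * poly (step_poly m U) x = poly (pgf_poly U) x ^ m - 1"
  using arg_cong [OF step_poly_eq [of m U], of "\<lambda>p. poly p x"] by (simp add: algebra_simps)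

text \<open>Differentiate \<open>(x - 1) V = G ^ m - 1\<close>. At \<open>x = m\<close> the bracket
  is the present value of the functional, so there one step multiplies it by
  \<open>G ^ (m - 1)\<close> and keeps its sign; this exact rule is the origin of
  \<open>crit\<close>.\<close>

lemma crit_step_poly:
  assumes "m \<ge> 1"
  shows "crit (step_poly m U) x = poly (pgf_poly U) x ^ (m - 1) *
    (poly (pgf_poly U) x - m * (x - 1) * poly (pderiv (pgf_poly U)) x)"
proof -
  let ?G = "poly (pgf_poly U) x"
  have "pderiv ([:-1, 1:] * step_poly m U) = pderiv (pgf_poly U ^ m - 1)"
    by (simp only: step_poly_eq)
  from arg_cong [OF this, of "\<lambda>p. poly p x"]
  have 1: "poly (step_poly m U) x + (x - 1) * poly (pderiv (step_poly m U)) x =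
      m * ?G ^ (m - 1) * poly (pderiv (pgf_poly U)) x"
    unfolding pderiv_mult pderiv_diff pderiv_power by (simp add: pderiv_pCons algebra_simps)
  have "(x - 1)\<^sup>2 * poly (pderiv (step_poly m U)) x =
     (x - 1) * (poly (step_poly m U) x + (x - 1) * poly (pderiv (step_poly m U)) x) - (x - 1) * poly (step_poly m U) x"
    by (simp add: algebra_simps power2_eq_square)
  also have "\<dots> = (x - 1) * (m * ?G ^ (m - 1) * poly (pderiv (pgf_poly U)) x) - (?G ^ m - 1)"
    unfolding 1 poly_step_poly ..
  finally have "crit (step_poly m U) x = ?G ^ m - (x - 1) * (m * ?G ^ (m - 1) * poly (pderiv (pgf_poly U)) x)"
    unfolding crit_def by simp
  also have "?G ^ m = ?G ^ (m - 1) * ?G"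
    using assms by (cases m) auto
  finally show ?thesis
    by (simp add: algebra_simps)
qed

lemma crit'_step_poly:
  assumes "m \<ge> 2"
  shows "crit' (step_poly m U) x = (x - 1) * real m * poly (pgf_poly U) x ^ (m - 2) *
    (poly (pgf_poly U) x * poly (pderiv (pderiv (pgf_poly U))) x + (real m - 1) * (poly (pderiv (pgf_poly U)) x)\<^sup>2)"
proof -
  obtain k where m: "m = Suc (Suc k)"
    using assms by (metis One_nat_def Suc_1 Suc_le_D Suc_le_mono)
  let ?G = "poly (pgf_poly U) x"
  have "pderiv (pderiv ([:-1, 1:] * step_poly m U)) = pderiv (pderiv (pgf_poly U ^ m - 1))"
    by (simp only: step_poly_eq)
  from arg_cong [OF this, of "\<lambda>p. poly p x"]
  have 1: "2 * poly (pderiv (step_poly m U)) x + (x - 1) * poly (pderiv (pderiv (step_poly m U))) x =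
     real m * ?G ^ k * (?G * poly (pderiv (pderiv (pgf_poly U))) x + (real m - 1) * (poly (pderiv (pgf_poly U)) x)\<^sup>2)"
    unfolding m pderiv_mult pderiv_diff pderiv_power pderiv_smult pderiv_add
    by (simp add: pderiv_pCons pderiv_add pderiv_diff algebra_simps power2_eq_square)
  show ?thesis
    unfolding crit'_def using arg_cong [OF 1, of "\<lambda>y. (x - 1) * y"]
    by (simp add: m algebra_simps power2_eq_square)
qed

text \<open>The leading factor \<open>(m / x) G\<^sup>m\<^sup>-\<^sup>1\<close> is the growth rate that has to be controlled, and the
  remainder is of third order when \<open>L = m - x\<close> and \<open>D\<close> are both small.\<close>

lemma tangent_step_poly:
  fixes U :: "real poly" assumes m: "m \<ge> 2" and x: "x > 0"
  defines "G \<equiv> poly (pgf_poly U) x" and "D \<equiv> crit (pCons 0 U) x" and "L \<equiv> real m - x"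
  shows "tangent m (step_poly m U) x = (m / x) * G ^ (m - 1) * tangent m (pCons 0 U) x
    - L / x ^ 3 * G ^ (m - 2) * (L\<^sup>2 * G\<^sup>2 - 2 * m * L * G * D + m * (real m - 1) * D\<^sup>2)"
proof -
  define G1 where "G1 = poly (pderiv (pgf_poly U)) x"
  define G2 where "G2 = poly (pderiv (pderiv (pgf_poly U))) x"
  obtain k where mk: "m = Suc (Suc k)"
    using assms by (metis One_nat_def Suc_1 Suc_le_D Suc_le_mono)
  have D: "D = G - x * (x - 1) * G1"
    unfolding D_def G_def G1_def by (rule crit_pCons)
  define M where "M = real m"
  define E where "E = G ^ (m - 2)"
  have P: "G ^ (m - 1) = E * G"
    by (simp add: E_def mk)
  have "tangent m (step_poly m U) x = (1 - M / x\<^sup>2) * (E * G * (G - M * (x - 1) * G1))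
      - (x - 1) * (M - x) / x * ((x - 1) * M * E * (G * G2 + (M - 1) * G1\<^sup>2))"
    unfolding tangent_def
    by (subst crit_step_poly, use m in simp, subst crit'_step_poly, rule m)
      (simp add: P [unfolded G_def] G_def G1_def G2_def E_def M_def del: One_nat_def)
  moreover have "tangent m (pCons 0 U) x = (1 - M / x\<^sup>2) * (G - x * (x - 1) * G1)
      - (x - 1) * (M - x) / x * ((x - 1) * (2 * G1 + x * G2))"
    unfolding tangent_def crit_pCons crit'_pCons G_def G1_def G2_def M_def by simp
  \<comment> \<open>The terms with \<open>G2\<close> agree on both sides; what is left over is a
    quadratic form in \<open>G\<close> and \<open>D\<close> with a factor \<open>M - x\<close>
    outside.\<close>
  moreover have "(1 - M / x\<^sup>2) * (E * G * (G - M * (x - 1) * G1))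
      - (x - 1) * (M - x) / x * ((x - 1) * M * E * (G * G2 + (M - 1) * G1\<^sup>2)) =
     (M / x) * (E * G) * ((1 - M / x\<^sup>2) * (G - x * (x - 1) * G1)
      - (x - 1) * (M - x) / x * ((x - 1) * (2 * G1 + x * G2)))
    - (M - x) / x ^ 3 * E * ((M - x)\<^sup>2 * G\<^sup>2 - 2 * M * (M - x) * G * (G - x * (x - 1) * G1) + M * (M - 1) * (G - x * (x - 1) * G1)\<^sup>2)"
    using x by (simp add: field_simps power2_eq_square power3_eq_cube)
  ultimately show ?thesis
    unfolding D L_def P by (simp add: M_def E_def)
qed

section \<open>Second-order lower bounds for the tangent functional\<close>

lemma binomial_second_order:
  fixes x :: real
  assumes "x \<ge> 0"
  shows "(1 + x) ^ k \<ge> 1 + k * x + k * (real k - 1) / 2 * x\<^sup>2"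
proof (induction k)
  case (Suc k)
  have "1 + Suc k * x + Suc k * (real (Suc k) - 1) / 2 * x\<^sup>2 + (k * (real k - 1) / 2) * x ^ 3 =
      (1 + x) * (1 + k * x + k * (real k - 1) / 2 * x\<^sup>2)"
    by (simp add: field_simps power2_eq_square power3_eq_cube)
  also have "\<dots> \<le> (1 + x) * (1 + x) ^ k"
    using Suc assms by (intro mult_left_mono) auto
  finally have *: "1 + Suc k * x + Suc k * (real (Suc k) - 1) / 2 * x\<^sup>2 + (k * (real k - 1) / 2) * x ^ 3 \<le> (1 + x) ^ Suc k"
    by simp
  have "(k * (real k - 1) / 2) * x ^ 3 \<ge> 0"
    using assms by (cases k) auto
  with * show ?case by linarith
qed auto

lemma pderiv_sum: "pderiv (sum f A) = (\<Sum>x\<in>A. pderiv (f x))"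
  by (induction A rule: infinite_finite_induct) (auto simp: pderiv_add)

lemma poly_pderiv_pCons_sum:
  fixes U :: "real poly"
  assumes "degree U \<le> N"
  shows "poly (pderiv (pCons 0 U)) x = (\<Sum>k\<le>N. coeff U k * (real k + 1) * x ^ k)"
    and "poly (pderiv (pderiv (pCons 0 U))) x = (\<Sum>k\<le>N. coeff U k * (real k + 1) * (k * x ^ (k - 1)))"
proof -
  have "U = (\<Sum>k\<le>N. monom (coeff U k) k)"
    using poly_as_sum_of_monoms' [OF assms] by simp
  hence "pCons 0 U = pCons 0 (\<Sum>k\<le>N. monom (coeff U k) k)"
    by simp
  also have "\<dots> = [:0, 1:] * (\<Sum>k\<le>N. monom (coeff U k) k)"
    by simp
  also have "\<dots> = (\<Sum>k\<le>N. monom (coeff U k) (Suc k))"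
    unfolding sum_distrib_left by (simp add: monom_Suc)
  finally have *: "pCons 0 U = (\<Sum>k\<le>N. monom (coeff U k) (Suc k))" .
  show "poly (pderiv (pCons 0 U)) x = (\<Sum>k\<le>N. coeff U k * (real k + 1) * x ^ k)"
    unfolding * pderiv_sum pderiv_monom poly_sum poly_monom
    by (intro sum.cong) (auto simp: algebra_simps)
  show "poly (pderiv (pderiv (pCons 0 U))) x = (\<Sum>k\<le>N. coeff U k * (real k + 1) * (k * x ^ (k - 1)))"
    unfolding * pderiv_sum pderiv_monom poly_sum poly_monom
    by (intro sum.cong) (auto simp: algebra_simps)
qed

lemma crit_sum:
  assumes "degree U \<le> N"
  shows "crit (pCons 0 U) x = 1 - (\<Sum>k\<le>N. coeff U k * (real k + 1) * ((x - 1)\<^sup>2 * x ^ k))"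
  unfolding crit_def poly_pderiv_pCons_sum [OF assms] sum_distrib_left
  by (simp add: algebra_simps)

lemma crit'_sum:
  assumes "degree U \<le> N" "x \<noteq> 0"
  shows "crit' (pCons 0 U) x =
    (\<Sum>k\<le>N. coeff U k * (real k + 1) * (x ^ k * (x - 1) * (2 + k * ((x - 1) / x))))"
proof -
  have "2 * (x - 1) * x ^ k + (x - 1)\<^sup>2 * (k * x ^ (k - 1)) = x ^ k * (x - 1) * (2 + k * ((x - 1) / x))" for k
    using assms(2) by (cases k) (auto simp: field_simps power2_eq_square)
  note this [symmetric]
  hence "coeff U k * (real k + 1) * (x ^ k * (x - 1) * (2 + k * ((x - 1) / x))) =
     2 * (x - 1) * (coeff U k * (real k + 1) * x ^ k) + (x - 1)\<^sup>2 * (coeff U k * (real k + 1) * (k * x ^ (k - 1)))" for k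
    by (simp only:) (simp add: algebra_simps)
  thus ?thesis
    unfolding crit'_def poly_pderiv_pCons_sum [OF assms(1)] sum_distrib_left
    by (simp add: sum.distrib)
qed

text \<open>The second-order Taylor term of \<open>(x - 1)\<^sup>2 x\<^sup>k\<close> wins over the first-order one, except for
  \<open>k = 0\<close> and \<open>m = 2\<close>, where both cancel to leading order.\<close>

lemma tangent_term_lower:
  fixes M s s1 L w :: real and k :: nat
  assumes M: "M \<ge> 2" and L: "0 < L" "L \<le> 1/4" and s: "s = M - L" "s1 = M - L ^ 3"
    and w_def: "w = (s - 1) / s"
  shows "(1 - M / s\<^sup>2) * ((s1 - 1)\<^sup>2 * s1 ^ k - (s - 1)\<^sup>2 * s ^ k)
      - (s - 1) * (M - s) / s * (s ^ k * (s - 1) * (2 + k * w))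
    \<ge> s ^ k * (L\<^sup>2 * (3 / 2 * k * w\<^sup>2 + k * (real k - 1) / 2 * w ^ 3) - (10 + 2 * M) * L ^ 3 * (real k + 1)\<^sup>2)"
proof -
  define e where "e = 1 - M / s\<^sup>2"
  define u where "u = L - L ^ 3"
  \<comment> \<open>With \<open>v = u / (s - 1)\<close>, \<open>P\<close> is the coefficient of
    \<open>v ^ 2\<close> in \<open>(1 + v) ^ 2 * (1 + k v w + k (k - 1) / 2 * (v w) ^ 2)\<close>,
    and \<open>2 + k w\<close> is that of \<open>v\<close>.\<close>
  define P where "P = 1 + 2 * (k * w) + k * (real k - 1) / 2 * w\<^sup>2"
  have s2: "s \<ge> 7/4" using M L s by auto
  have w: "0 < w" "w < 1" using s2 by (auto simp: w_def field_simps)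
  have sw: "s * w = s - 1" using s2 by (simp add: w_def)
  have L3: "L ^ 3 \<le> L" "L ^ 3 \<le> L\<^sup>2" "L ^ 3 > 0" "L\<^sup>2 \<le> L * (1/4)" "L ^ 4 \<le> L ^ 3"
    using L power_decreasing [of 1 3 L] power_decreasing [of 2 3 L] power_decreasing [of 3 4 L] by (auto simp: power2_eq_square)
  have u: "0 \<le> u" "u \<le> L" unfolding u_def using L L3 by linarith+
  have s1u: "s1 = s + u" by (simp add: s u_def)
  have e: "e = w - L / s\<^sup>2"
  proof -
    have "M = s + L" by (simp add: s)
    thus ?thesis using s2 unfolding e_def w_def by (simp add: field_simps power2_eq_square)
  qed
  have e1: "e \<le> 1" using M by (simp add: e_def)
  have Lw: "L / s\<^sup>2 \<le> L"
  proof -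
    have "1 \<le> s\<^sup>2" using s2 by (simp add: one_le_power)
    thus ?thesis using L s2 by (simp add: field_simps)
  qed
  have e0: "e \<ge> 0"
  proof -
    have "3 \<le> s\<^sup>2" using s2 power_mono [of "7/4" s 2] by (simp add: power2_eq_square)
    have "w \<ge> 3/7" using s2 by (simp add: w_def field_simps)
    thus ?thesis unfolding e using Lw L by linarith
  qed
  have kk: "real k * (real k - 1) \<ge> 0" by (cases k) auto
  have P: "P \<ge> 1" unfolding P_def using w kk by (simp add: zero_le_mult_iff)
  have P2: "P \<le> 2 * (real k + 1)\<^sup>2"
  proof -
    have "k * w \<le> k" using w by (simp add: mult_left_le)
    moreover have "(k * (real k - 1) / 2) * w\<^sup>2 \<le> (k * (real k - 1) / 2) * 1"
      using w kk by (intro mult_left_mono) (auto simp: power_le_one)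
    ultimately have "P \<le> 1 + 2 * k + k * (real k - 1) / 2"
      unfolding P_def by linarith
    also have "\<dots> \<le> 2 * (real k + 1)\<^sup>2"
      by (simp add: field_simps power2_eq_square)
    finally show ?thesis .
  qed
  have A: "(s1 - 1)\<^sup>2 * s1 ^ k \<ge> s ^ k * ((s - 1)\<^sup>2 + u * ((s - 1) * (2 + k * w)) + u\<^sup>2 * P)"
  proof -
    have "s1 ^ k = s ^ k * (1 + u / s) ^ k"
    proof -
      have "s1 = s * (1 + u / s)" using s2 by (simp add: s1u field_simps)
      thus ?thesis by (metis power_mult_distrib)
    qed
    also have "\<dots> \<ge> s ^ k * (1 + k * (u / s) + k * (real k - 1) / 2 * (u / s)\<^sup>2)"
      using s2 u by (intro mult_left_mono binomial_second_order) auto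
    finally have B: "s ^ k * (1 + k * (u / s) + k * (real k - 1) / 2 * (u / s)\<^sup>2) \<le> s1 ^ k" .
    have C: "(s1 - 1)\<^sup>2 * (1 + k * (u / s) + k * (real k - 1) / 2 * (u / s)\<^sup>2) \<ge>
        (s - 1)\<^sup>2 + u * ((s - 1) * (2 + k * w)) + u\<^sup>2 * P" (is "?l \<ge> ?r")
    proof -
      define v where "v = u / (s - 1)"
      have v: "v \<ge> 0" "u = v * (s - 1)" using u s2 by (auto simp: v_def)
      have us: "u / s = v * w" using s2 by (simp add: w_def v_def)
      have s11: "s1 - 1 = (s - 1) * (1 + v)" using s2 by (simp add: s1u v_def field_simps)
      have "?l - ?r = (s - 1)\<^sup>2 * (v ^ 3 * (w * k) + (2 * v ^ 3 + v ^ 4) * (k * (real k - 1) / 2 * w\<^sup>2))"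
        unfolding us s11 P_def unfolding v(2) by (simp add: field_simps power2_eq_square power3_eq_cube power4_eq_xxxx)
      moreover have "\<dots> \<ge> 0" using v(1) w kk by (intro mult_nonneg_nonneg add_nonneg_nonneg) auto
      ultimately show ?thesis by linarith
    qed
    have "s ^ k * ((s - 1)\<^sup>2 + u * ((s - 1) * (2 + k * w)) + u\<^sup>2 * P) \<le>
       s ^ k * ((s1 - 1)\<^sup>2 * (1 + k * (u / s) + k * (real k - 1) / 2 * (u / s)\<^sup>2))"
      using C s2 by (intro mult_left_mono) auto
    also have "\<dots> = (s1 - 1)\<^sup>2 * (s ^ k * (1 + k * (u / s) + k * (real k - 1) / 2 * (u / s)\<^sup>2))"
      by simp
    also have "\<dots> \<le> (s1 - 1)\<^sup>2 * s1 ^ k"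
      using B by (intro mult_left_mono) auto
    finally show ?thesis .
  qed
  have "e * ((s1 - 1)\<^sup>2 * s1 ^ k - (s - 1)\<^sup>2 * s ^ k) \<ge> e * (s ^ k * (u * ((s - 1) * (2 + k * w)) + u\<^sup>2 * P))"
    using A e0 by (intro mult_left_mono) (auto simp: algebra_simps)
  moreover have "(s - 1) * (M - s) / s * (s ^ k * (s - 1) * (2 + k * w)) = s ^ k * (L * w * (s - 1) * (2 + k * w))"
    by (simp add: s w_def)
  ultimately have "(1 - M / s\<^sup>2) * ((s1 - 1)\<^sup>2 * s1 ^ k - (s - 1)\<^sup>2 * s ^ k)
      - (s - 1) * (M - s) / s * (s ^ k * (s - 1) * (2 + k * w))
     \<ge> s ^ k * (e * u\<^sup>2 * P - (L * w - e * u) * ((s - 1) * (2 + k * w)))"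
    unfolding e_def [symmetric] by (simp add: algebra_simps)
  \<comment> \<open>The first-order terms nearly cancel: \<open>L * w - e * u\<close> is only of
    order \<open>L ^ 2\<close>, the order of the second-order gain \<open>e * u ^ 2 * P\<close>. All
    further differences go into the \<open>L ^ 3\<close> error.\<close>
  moreover have "e * u\<^sup>2 * P - (L * w - e * u) * ((s - 1) * (2 + k * w)) \<ge>
     L\<^sup>2 * (3 / 2 * k * w\<^sup>2 + k * (real k - 1) / 2 * w ^ 3) - (10 + 2 * M) * L ^ 3 * (real k + 1)\<^sup>2"
  proof -
    have "u\<^sup>2 \<ge> L\<^sup>2 - 2 * L ^ 3"
    proof -
      have "u\<^sup>2 = L\<^sup>2 - 2 * L ^ 4 + (L ^ 3)\<^sup>2"
        by (simp add: u_def power2_eq_square algebra_simps power3_eq_cube power4_eq_xxxx)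
      thus ?thesis using L3 by (smt (verit) zero_le_power2)
    qed
    hence "e * u\<^sup>2 \<ge> e * (L\<^sup>2 - 2 * L ^ 3)"
      using e0 by (intro mult_left_mono) auto
    moreover have "e * (L\<^sup>2 - 2 * L ^ 3) \<ge> e * L\<^sup>2 - 2 * L ^ 3"
      using e1 L3 by (simp add: algebra_simps)
    moreover have "e * L\<^sup>2 \<ge> w * L\<^sup>2 - L ^ 3"
      unfolding e using mult_right_mono [OF Lw, of "L\<^sup>2"] L by (simp add: algebra_simps power2_eq_square power3_eq_cube)
    ultimately have eu: "e * u\<^sup>2 \<ge> w * L\<^sup>2 - 3 * L ^ 3" by linarith
    have "e * u\<^sup>2 * P \<ge> (w * L\<^sup>2 - 3 * L ^ 3) * P"
      using eu P by (intro mult_right_mono) auto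
    moreover have "3 * L ^ 3 * P \<le> 3 * L ^ 3 * (2 * (real k + 1)\<^sup>2)"
      using P2 L3 by (intro mult_left_mono) auto
    ultimately have 1: "e * u\<^sup>2 * P \<ge> w * L\<^sup>2 * P - 6 * L ^ 3 * (real k + 1)\<^sup>2"
      by (simp add: algebra_simps)
    have k2: "2 + k * w \<le> 2 * (real k + 1)\<^sup>2" "0 \<le> 2 + k * w"
    proof -
      have "k * w \<le> k" using w by (simp add: mult_left_le)
      moreover have "2 + real k \<le> 2 * (real k + 1)\<^sup>2" by (simp add: field_simps power2_eq_square)
      ultimately show "2 + k * w \<le> 2 * (real k + 1)\<^sup>2" by linarith
    qed (use w in auto)
    have "L * w - e * u = L\<^sup>2 / s\<^sup>2 + e * L ^ 3"
      unfolding u_def e by (simp add: algebra_simps power2_eq_square)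
    hence "(L * w - e * u) * (s - 1) = L\<^sup>2 * (w / s) + e * (s - 1) * L ^ 3"
      using s2 by (simp add: w_def field_simps power2_eq_square)
    also have "\<dots> \<le> L\<^sup>2 * (w * (1/2) + L) + M * L ^ 3"
    proof -
      \<comment> \<open>The leading value 1/2 is attained only for \<open>M = 2\<close>; with it the
        \<open>k = 0\<close> contributions cancel exactly at order \<open>L ^ 2\<close>.\<close>
      have "1 / s \<le> 1 / 2 + L"
      proof -
        have "1 \<le> (1/2 + L) * (2 - L)"
          using L L3 by (simp add: field_simps power2_eq_square)
        also have "\<dots> \<le> (1/2 + L) * s" using M L s by (intro mult_left_mono) auto
        finally show ?thesis using s2 by (simp add: field_simps)
      qed
      hence "w * (1 / s) \<le> w * (1/2 + L)" using w by (intro mult_left_mono) auto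
      also have "\<dots> \<le> w * (1/2) + L" using w L by (simp add: algebra_simps)
      finally have "L\<^sup>2 * (w / s) \<le> L\<^sup>2 * (w * (1/2) + L)" by (intro mult_left_mono) auto
      moreover have "e * (s - 1) \<le> 1 * M"
        using e0 e1 s L s2 by (intro mult_mono) auto
      hence "e * (s - 1) * L ^ 3 \<le> M * L ^ 3" using L3 by (intro mult_right_mono) auto
      ultimately show ?thesis by linarith
    qed
    finally have 2: "(L * w - e * u) * (s - 1) \<le> L\<^sup>2 * (w * (1/2)) + (1 + M) * L ^ 3"
      by (simp add: algebra_simps power2_eq_square power3_eq_cube)
    have "(L * w - e * u) * (s - 1) * (2 + k * w) \<le> (L\<^sup>2 * (w * (1/2)) + (1 + M) * L ^ 3) * (2 + k * w)"
      using 2 k2 by (intro mult_right_mono) auto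
    moreover have "(1 + M) * L ^ 3 * (2 + k * w) \<le> (1 + M) * L ^ 3 * (2 * (real k + 1)\<^sup>2)"
      using k2 M L3 by (intro mult_left_mono) auto
    ultimately have 3: "(L * w - e * u) * ((s - 1) * (2 + k * w)) \<le>
        L\<^sup>2 * (w * (1 + k * w / 2)) + (2 + 2 * M) * L ^ 3 * (real k + 1)\<^sup>2"
    proof -
      have "(L\<^sup>2 * (w * (1/2)) + (1 + M) * L ^ 3) * (2 + k * w) =
          L\<^sup>2 * (w * (1 + k * w / 2)) + (1 + M) * L ^ 3 * (2 + k * w)"
        by (simp add: field_simps)
      moreover have "(1 + M) * L ^ 3 * (2 * (real k + 1)\<^sup>2) = (2 + 2 * M) * L ^ 3 * (real k + 1)\<^sup>2"
        by (simp add: algebra_simps)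
      moreover have "(L * w - e * u) * ((s - 1) * (2 + k * w)) = (L * w - e * u) * (s - 1) * (2 + k * w)"
        by simp
      ultimately show ?thesis
        using \<open>(L * w - e * u) * (s - 1) * (2 + k * w) \<le> _\<close>
          \<open>(1 + M) * L ^ 3 * (2 + k * w) \<le> _\<close> by linarith
    qed
    have 4: "w * L\<^sup>2 * P - L\<^sup>2 * (w * (1 + k * w / 2)) = L\<^sup>2 * (3 / 2 * k * w\<^sup>2 + k * (real k - 1) / 2 * w ^ 3)"
      by (simp add: P_def field_simps power2_eq_square power3_eq_cube)
    define K where "K = L ^ 3 * (real k + 1)\<^sup>2"
    have "K \<ge> 0" using L by (auto simp: K_def)
    moreover have "e * u\<^sup>2 * P \<ge> w * L\<^sup>2 * P - 6 * K"
        "(L * w - e * u) * ((s - 1) * (2 + k * w)) \<le> L\<^sup>2 * (w * (1 + k * w / 2)) + (2 * K + 2 * (M * K))"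
      using 1 3 by (simp_all add: K_def algebra_simps)
    moreover have "(10 + 2 * M) * L ^ 3 * (real k + 1)\<^sup>2 = 10 * K + 2 * (M * K)"
      by (simp add: K_def algebra_simps)
    ultimately show ?thesis using 4 by linarith
  qed
  moreover have "s ^ k \<ge> 0" using s2 by simp
  ultimately show ?thesis
    by (meson order_trans mult_left_mono)
qed

text \<open>Makes \<open>1 - M / s ^ 2\<close>, the weight of \<open>crit\<close> in
  \<open>tangent\<close>, nonnegative at \<open>s = M - L\<close>.\<close>

lemma le_square_diff:
  fixes M L :: real
  assumes "M \<ge> 2" "0 < L" "L \<le> 1/4"
  shows "M \<le> (M - L)\<^sup>2"
proof -
  have "M * 1 \<le> M * (M - 2 * L)" using assms by (intro mult_left_mono) auto
  also have "\<dots> \<le> (M - L)\<^sup>2" by (simp add: power2_eq_square algebra_simps)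
  finally show ?thesis by simp
qed

text \<open>The value of \<open>crit\<close> at \<open>M - L ^ 3\<close> stands in for that at
  \<open>M\<close>. Subtracting a nonnegative multiple of it from \<open>tangent\<close> leaves a
  sum to which \<open>tangent_term_lower\<close> applies term by term. The gain is a third moment
  without its \<open>k = 0\<close> term, where only an error of order \<open>L ^ 3\<close>
  survives.\<close>

lemma tangent_sum_lower:
  fixes M s s1 L :: real
  assumes M: "M \<ge> 2" and L: "0 < L" "L \<le> 1/4" "208 * (10 + 2 * M) * L \<le> 1" and s: "s = M - L" "s1 = M - L ^ 3"
    and U: "\<And>k. coeff U k \<ge> 0" "degree U \<le> N" and D: "crit (pCons 0 U) s1 \<ge> 0"
  shows "tangent M (pCons 0 U) s \<ge>
    L\<^sup>2 / 208 * ((\<Sum>k\<le>N. coeff U k * (real k + 1) ^ 3 * s ^ k) - coeff U 0) - (10 + 2 * M) * L ^ 3 * coeff U 0"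
proof -
  define w where "w = (s - 1) / s"
  define e where "e = 1 - M / s\<^sup>2"
  define q where "q = (s - 1) * (M - s) / s"
  define C where "C = 10 + 2 * M"
  have s2: "s \<ge> 7/4" using M L s by auto
  have w: "w \<ge> 3/7" using s2 by (simp add: w_def field_simps)
  have "s\<^sup>2 \<ge> M" unfolding s by (rule le_square_diff) (use M L in auto)
  hence e: "e \<ge> 0" using s2 by (simp add: e_def divide_le_eq)
  have "tangent M (pCons 0 U) s - e * crit (pCons 0 U) s1 =
     (\<Sum>k\<le>N. coeff U k * (real k + 1) * (e * ((s1 - 1)\<^sup>2 * s1 ^ k - (s - 1)\<^sup>2 * s ^ k)
      - q * (s ^ k * (s - 1) * (2 + k * w))))"
  proof -
    have "tangent M (pCons 0 U) s - e * crit (pCons 0 U) s1 =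
        e * (\<Sum>k\<le>N. coeff U k * (real k + 1) * ((s1 - 1)\<^sup>2 * s1 ^ k))
      - e * (\<Sum>k\<le>N. coeff U k * (real k + 1) * ((s - 1)\<^sup>2 * s ^ k))
      - q * (\<Sum>k\<le>N. coeff U k * (real k + 1) * (s ^ k * (s - 1) * (2 + k * w)))"
      unfolding tangent_def crit_sum [OF U(2)] using s2
      by (subst crit'_sum [OF U(2)]) (simp_all add: e_def q_def w_def algebra_simps)
    thus ?thesis
      unfolding sum_distrib_left sum_subtractf [symmetric] by (simp add: algebra_simps)
  qed
  also have "\<dots> \<ge> (\<Sum>k\<le>N. L\<^sup>2 / 208 * (coeff U k * (real k + 1) ^ 3 * s ^ k)
      - (if k = 0 then (L\<^sup>2 / 208 + C * L ^ 3) * coeff U 0 else 0))"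
  proof (intro sum_mono)
    fix k
    have "e * ((s1 - 1)\<^sup>2 * s1 ^ k - (s - 1)\<^sup>2 * s ^ k) - q * (s ^ k * (s - 1) * (2 + k * w)) \<ge>
      s ^ k * (L\<^sup>2 * (3 / 2 * k * w\<^sup>2 + k * (real k - 1) / 2 * w ^ 3) - C * L ^ 3 * (real k + 1)\<^sup>2)"
      unfolding e_def q_def C_def by (rule tangent_term_lower [OF M L(1,2) s w_def])
    moreover have "L\<^sup>2 * (3 / 2 * k * w\<^sup>2 + k * (real k - 1) / 2 * w ^ 3) - C * L ^ 3 * (real k + 1)\<^sup>2 \<ge>
      L\<^sup>2 / 208 * (real k + 1)\<^sup>2 - (if k = 0 then L\<^sup>2 / 208 + C * L ^ 3 else 0)"
    proof (cases "k = 0")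
      case False
      have w2: "w\<^sup>2 \<ge> 1/6" using power_mono [OF w, of 2] by (simp add: power2_eq_square)
      have w3: "w ^ 3 \<ge> 1/13" using power_mono [OF w, of 3] by (simp add: power3_eq_cube)
      define Y where "Y = 3 / 2 * k * w\<^sup>2 + k * (real k - 1) / 2 * w ^ 3"
      have "3 / 2 * k * w\<^sup>2 \<ge> 3/2 * k * (1/6)" using w2 by (intro mult_left_mono) auto
      moreover have "k * (real k - 1) / 2 * w ^ 3 \<ge> k * (real k - 1) / 2 * (1/13)"
        using w3 False by (intro mult_left_mono) auto
      \<comment> \<open>The bounds 1/6 for \<open>w ^ 2\<close> and 1/13 for \<open>w ^ 3\<close>
        lead to the constant 104. Half of this gain pays for the \<open>L ^ 3\<close> error, which
        leaves 208.\<close>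
      moreover have "(real k + 1)\<^sup>2 / 104 \<le> 3/2 * k * (1/6) + k * (real k - 1) / 2 * (1/13)"
      proof -
        have "(real k - 1) * (3 * real k + 1) \<ge> 0" using False by simp
        moreover have "real k \<ge> 1" using False by simp
        ultimately show ?thesis by (simp add: power2_eq_square field_simps)
      qed
      ultimately have "(real k + 1)\<^sup>2 / 104 \<le> Y"
        unfolding Y_def by (meson add_mono order_trans)
      hence 1: "L\<^sup>2 * ((real k + 1)\<^sup>2 / 104) \<le> L\<^sup>2 * Y"
        by (intro mult_left_mono) auto
      have "(C * L) * (L\<^sup>2 * (real k + 1)\<^sup>2) \<le> (1/208) * (L\<^sup>2 * (real k + 1)\<^sup>2)"
        using L(3) by (intro mult_right_mono) (auto simp: C_def algebra_simps)
      hence 2: "C * L ^ 3 * (real k + 1)\<^sup>2 \<le> L\<^sup>2 * ((real k + 1)\<^sup>2 / 208)"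
        by (simp add: power2_eq_square power3_eq_cube algebra_simps)
      have "L\<^sup>2 / 208 * (real k + 1)\<^sup>2 = L\<^sup>2 * ((real k + 1)\<^sup>2 / 104) - L\<^sup>2 * ((real k + 1)\<^sup>2 / 208)"
        by simp
      hence "L\<^sup>2 / 208 * (real k + 1)\<^sup>2 - 0 \<le> L\<^sup>2 * Y - C * L ^ 3 * (real k + 1)\<^sup>2"
        using 1 2 by linarith
      thus ?thesis using False unfolding Y_def [symmetric] by (simp only: if_False)
    qed auto
    moreover have "s ^ k \<ge> 0" using s2 by simp
    ultimately have *: "e * ((s1 - 1)\<^sup>2 * s1 ^ k - (s - 1)\<^sup>2 * s ^ k) - q * (s ^ k * (s - 1) * (2 + k * w)) \<ge>
       s ^ k * (L\<^sup>2 / 208 * (real k + 1)\<^sup>2 - (if k = 0 then L\<^sup>2 / 208 + C * L ^ 3 else 0))"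
      by (meson order_trans mult_left_mono)
    have "L\<^sup>2 / 208 * (coeff U k * (real k + 1) ^ 3 * s ^ k)
      - (if k = 0 then (L\<^sup>2 / 208 + C * L ^ 3) * coeff U 0 else 0) = coeff U k * (real k + 1) *
       (s ^ k * (L\<^sup>2 / 208 * (real k + 1)\<^sup>2 - (if k = 0 then L\<^sup>2 / 208 + C * L ^ 3 else 0)))"
      by (cases "k = 0") (auto simp: field_simps power2_eq_square power3_eq_cube)
    also have "\<dots> \<le> coeff U k * (real k + 1) * (e * ((s1 - 1)\<^sup>2 * s1 ^ k - (s - 1)\<^sup>2 * s ^ k)
      - q * (s ^ k * (s - 1) * (2 + k * w)))"
      using * U(1) by (intro mult_left_mono) auto
    finally show "L\<^sup>2 / 208 * (coeff U k * (real k + 1) ^ 3 * s ^ k)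
      - (if k = 0 then (L\<^sup>2 / 208 + C * L ^ 3) * coeff U 0 else 0) \<le> \<dots>" .
  qed
  also have "(\<Sum>k\<le>N. L\<^sup>2 / 208 * (coeff U k * (real k + 1) ^ 3 * s ^ k)
      - (if k = 0 then (L\<^sup>2 / 208 + C * L ^ 3) * coeff U 0 else 0)) =
      L\<^sup>2 / 208 * (\<Sum>k\<le>N. coeff U k * (real k + 1) ^ 3 * s ^ k) - (L\<^sup>2 / 208 + C * L ^ 3) * coeff U 0"
    unfolding sum_subtractf sum_distrib_left by (simp add: sum.delta)
  finally have "L\<^sup>2 / 208 * (\<Sum>k\<le>N. coeff U k * (real k + 1) ^ 3 * s ^ k) - (L\<^sup>2 / 208 + C * L ^ 3) * coeff U 0
    \<le> tangent M (pCons 0 U) s - e * crit (pCons 0 U) s1" .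
  moreover have "e * crit (pCons 0 U) s1 \<ge> 0" using e D by auto
  ultimately show ?thesis by (simp add: C_def algebra_simps)
qed

lemma crit_antimono:
  fixes U :: "real poly"
  assumes U: "\<And>k. coeff U k \<ge> 0" and "1 \<le> x" "x \<le> y"
  shows "crit (pCons 0 U) y \<le> crit (pCons 0 U) x"
  unfolding crit_sum [OF order_refl]
  using assms by (intro diff_left_mono sum_mono mult_left_mono mult_mono power_mono) auto

lemma crit_le_1:
  fixes U :: "real poly"
  assumes U: "\<And>k. coeff U k \<ge> 0" and "1 \<le> x"
  shows "crit (pCons 0 U) x \<le> 1"
  unfolding crit_sum [OF order_refl]
  using assms by (auto intro!: sum_nonneg)

lemma crit'_nonneg:
  fixes U :: "real poly"
  assumes U: "\<And>k. coeff U k \<ge> 0" and x: "1 \<le> x"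
  shows "crit' (pCons 0 U) x \<ge> 0"
  using assms by (subst crit'_sum [OF order_refl]) (auto intro!: sum_nonneg mult_nonneg_nonneg add_nonneg_nonneg)

text \<open>\<open>crit \<ge> 0\<close> bounds the first moment \<open>S1\<close> by 2, so
  Cauchy-Schwarz bounds the square of the second moment, and with it that of \<open>crit'\<close>,
  by a multiple of the third.\<close>

lemma crit'_bound:
  fixes U :: "real poly"
  assumes U: "\<And>k. coeff U k \<ge> 0" "degree U \<le> N" and x: "7/4 \<le> x" "x \<le> M" and D: "crit (pCons 0 U) x \<ge> 0"
  shows "(crit' (pCons 0 U) x)\<^sup>2 \<le> 8 * M\<^sup>2 * (\<Sum>k\<le>N. coeff U k * (real k + 1) ^ 3 * x ^ k)"
proof -
  let ?t = "coeff U"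
  define S1 where "S1 = (\<Sum>k\<le>N. ?t k * (real k + 1) * x ^ k)"
  define S2 where "S2 = (\<Sum>k\<le>N. ?t k * (real k + 1)\<^sup>2 * x ^ k)"
  define S3 where "S3 = (\<Sum>k\<le>N. ?t k * (real k + 1) ^ 3 * x ^ k)"
  have nonneg: "S1 \<ge> 0" "S2 \<ge> 0" "S3 \<ge> 0"
    unfolding S1_def S2_def S3_def using U x by (auto intro!: sum_nonneg)
  have "S2 = (\<Sum>k\<le>N. sqrt (?t k * (real k + 1) * x ^ k) * sqrt (?t k * (real k + 1) ^ 3 * x ^ k))"
    unfolding S2_def
  proof (intro sum.cong refl)
    fix k
    have "sqrt (?t k * (real k + 1) * x ^ k) * sqrt (?t k * (real k + 1) ^ 3 * x ^ k) =
       sqrt ((?t k * (real k + 1)\<^sup>2 * x ^ k)\<^sup>2)"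
      unfolding real_sqrt_mult [symmetric] by (simp add: power2_eq_square power3_eq_cube algebra_simps)
    thus "?t k * (real k + 1)\<^sup>2 * x ^ k = sqrt (?t k * (real k + 1) * x ^ k) * sqrt (?t k * (real k + 1) ^ 3 * x ^ k)"
      using U x by simp
  qed
  hence "S2\<^sup>2 \<le> (\<Sum>k\<le>N. (sqrt (?t k * (real k + 1) * x ^ k))\<^sup>2) * (\<Sum>k\<le>N. (sqrt (?t k * (real k + 1) ^ 3 * x ^ k))\<^sup>2)"
    by (simp add: Cauchy_Schwarz_ineq_sum)
  also have "\<dots> = S1 * S3"
    unfolding S1_def S3_def using U x by (intro arg_cong2 [of _ _ _ _ "(*)"] sum.cong) auto
  finally have cs: "S2\<^sup>2 \<le> S1 * S3" .
  have "(x - 1)\<^sup>2 * S1 \<le> 1"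
    using D poly_pderiv_pCons_sum(1) [OF U(2)] by (simp add: crit_def S1_def)
  moreover have "(3/4)\<^sup>2 * S1 \<le> (x - 1)\<^sup>2 * S1"
    using x nonneg by (intro mult_right_mono power_mono) auto
  ultimately have "S1 \<le> 2" by (simp add: power2_eq_square)
  hence "S1 * S3 \<le> 2 * S3" using nonneg by (intro mult_right_mono)
  with cs have S2: "S2\<^sup>2 \<le> 2 * S3" by simp
  have "crit' (pCons 0 U) x \<le> 2 * M * S2"
    unfolding S2_def sum_distrib_left
  proof (subst crit'_sum [OF U(2)])
    show "(\<Sum>k\<le>N. ?t k * (real k + 1) * (x ^ k * (x - 1) * (2 + k * ((x - 1) / x)))) \<le>
      (\<Sum>k\<le>N. 2 * M * (?t k * (real k + 1)\<^sup>2 * x ^ k))"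
    proof (intro sum_mono)
      fix k :: nat
      have "k * ((x - 1) / x) \<le> k" using x by (intro mult_left_le) auto
      hence "(x - 1) * (2 + k * ((x - 1) / x)) \<le> M * (2 * (real k + 1))"
        using x by (intro mult_mono) auto
      hence "?t k * (real k + 1) * x ^ k * ((x - 1) * (2 + k * ((x - 1) / x))) \<le>
          ?t k * (real k + 1) * x ^ k * (M * (2 * (real k + 1)))"
        using U x by (intro mult_left_mono) auto
      thus "?t k * (real k + 1) * (x ^ k * (x - 1) * (2 + k * ((x - 1) / x))) \<le>
         2 * M * (?t k * (real k + 1)\<^sup>2 * x ^ k)"
        by (simp add: power2_eq_square algebra_simps)
    qed
  qed (use x in auto)
  hence "(crit' (pCons 0 U) x)\<^sup>2 \<le> (2 * M * S2)\<^sup>2"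
    using crit'_nonneg [of U x] U x by (intro power_mono) auto
  also have "\<dots> = 4 * M\<^sup>2 * S2\<^sup>2" by (simp add: power_mult_distrib)
  also have "\<dots> \<le> 4 * M\<^sup>2 * (2 * S3)" using S2 by (intro mult_left_mono) auto
  finally show ?thesis by (simp add: S3_def)
qed

text \<open>Cauchy-Schwarz between the first and the third moment makes \<open>D\<^sup>2\<close> comparable to \<open>tangent\<close>, so that
  the remainder in \<open>tangent_step_poly\<close> is a small relative error.\<close>

lemma crit_sq_bound:
  fixes M s s1 L :: real
  assumes M: "M \<ge> 2" and L: "0 < L" "L \<le> 1/4" "208 * (10 + 2 * M) * L \<le> 1" and s: "s = M - L" "s1 = M - L ^ 3"
    and U: "\<And>k. coeff U k \<ge> 0" "coeff U 0 \<le> 1" and D: "crit (pCons 0 U) s1 \<ge> 0"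
  shows "(crit (pCons 0 U) s)\<^sup>2 \<le> (32 + 53248 * M\<^sup>2) * (max 0 (tangent M (pCons 0 U) s) + L\<^sup>2)"
proof -
  define S3 where "S3 = (\<Sum>k\<le>degree U. coeff U k * (real k + 1) ^ 3 * s ^ k)"
  define T where "T = tangent M (pCons 0 U) s"
  define T' where "T' = max 0 T"
  define DD where "DD = crit' (pCons 0 U) s"
  define E where "E = crit (pCons 0 U) s"
  have s2: "s \<ge> 7/4" using M L s by auto
  have "L ^ 3 \<le> L" using L power_decreasing [of 1 3 L] by auto
  hence ss: "s \<le> s1" using s by auto
  have E: "0 \<le> E" "E \<le> 1"
    using crit_antimono [of U s s1] crit_le_1 [of U s] D U s2 ss by (auto simp: E_def)
  have DD: "DD \<ge> 0" "DD\<^sup>2 \<le> 8 * M\<^sup>2 * S3"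
    using crit'_nonneg [of U s] crit'_bound [OF U(1) order_refl s2, of M] E U s2 s L by (auto simp: DD_def S3_def E_def)
  have T1: "T \<ge> L\<^sup>2 / 208 * (S3 - coeff U 0) - (10 + 2 * M) * L ^ 3 * coeff U 0"
    unfolding T_def S3_def by (rule tangent_sum_lower [OF M L s U(1) order_refl D])
  have S3: "L\<^sup>2 * S3 \<le> 208 * T' + 2 * L\<^sup>2"
  proof -
    have "208 * ((10 + 2 * M) * L ^ 3 * coeff U 0) = (208 * (10 + 2 * M) * L) * (L\<^sup>2 * coeff U 0)"
      by (simp add: power2_eq_square power3_eq_cube algebra_simps)
    also have "\<dots> \<le> 1 * (L\<^sup>2 * coeff U 0)"
      using L U by (intro mult_right_mono) auto
    finally have "208 * ((10 + 2 * M) * L ^ 3 * coeff U 0) \<le> L\<^sup>2 * coeff U 0" by simp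
    moreover have "L\<^sup>2 * coeff U 0 \<le> L\<^sup>2 * 1" using U by (intro mult_left_mono) auto
    ultimately show ?thesis using T1 by (simp add: T'_def algebra_simps)
  qed
  define e where "e = 1 - M / s\<^sup>2"
  define q where "q = (s - 1) * (M - s) / s"
  have e: "e \<ge> 1/4" "e \<le> 1"
  proof -
    have "e = (s - 1) / s - L / s\<^sup>2"
    proof -
      have "M = s + L" by (simp add: s)
      thus ?thesis using s2 unfolding e_def by (simp add: field_simps power2_eq_square)
    qed
    moreover have "(s - 1) / s \<ge> 3/7" using s2 by (simp add: field_simps)
    moreover have "L / s\<^sup>2 \<le> (1/4) / (7/4)\<^sup>2"
      using s2 L by (intro frac_le power_mono) auto
    moreover have "3/7 - (1/4) / (7/4)\<^sup>2 \<ge> (1/4::real)" by (simp add: power2_eq_square)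
    ultimately show "e \<ge> 1/4" by linarith
  qed (use M in \<open>auto simp: e_def\<close>)
  have q: "0 \<le> q" "q \<le> L"
    using s s2 L by (auto simp: q_def field_simps)
  have "e * E = T + q * DD"
    by (simp add: T_def tangent_def e_def q_def E_def DD_def)
  moreover have "1/4 * E \<le> e * E" using E e by (intro mult_right_mono)
  moreover have "q * DD \<le> L * DD" using q DD by (intro mult_right_mono)
  ultimately have E4: "E \<le> 4 * (T' + L * DD)" by (auto simp: T'_def)
  have "T' \<le> 1"
  proof -
    have "e * E \<le> 1 * 1" using e E by (intro mult_mono) auto
    thus ?thesis using \<open>e * E = T + q * DD\<close> q DD by (simp add: T'_def) (smt (verit) mult_nonneg_nonneg)
  qed
  moreover have "T' \<ge> 0" by (simp add: T'_def)
  ultimately have T'2: "T'\<^sup>2 \<le> T'" by (simp add: power2_eq_square mult_left_le)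
  have "E\<^sup>2 \<le> (4 * (T' + L * DD))\<^sup>2" using E4 E by (intro power_mono) auto
  also have "\<dots> \<le> 32 * (T'\<^sup>2 + (L * DD)\<^sup>2)"
    using zero_le_power2 [of "T' - L * DD"] by (simp add: power2_eq_square algebra_simps)
  also have "\<dots> \<le> 32 * (T' + L\<^sup>2 * (8 * M\<^sup>2 * S3))"
    using T'2 DD mult_left_mono [OF DD(2), of "L\<^sup>2"] by (auto simp: power_mult_distrib)
  \<comment> \<open>Here 53248 = 256 * 208 arises: the factor 208 of
    \<open>tangent_sum_lower\<close> converts \<open>L ^ 2 * S3\<close> back into
    \<open>tangent\<close>.\<close>
  also have "\<dots> = 32 * T' + 256 * M\<^sup>2 * (L\<^sup>2 * S3)" by simp
  also have "\<dots> \<le> 32 * T' + 256 * M\<^sup>2 * (208 * T' + 2 * L\<^sup>2)"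
    using S3 by (intro add_left_mono mult_left_mono) auto
  also have "\<dots> \<le> (32 + 53248 * M\<^sup>2) * (T' + L\<^sup>2)"
    using M L by (simp add: algebra_simps)
  finally show ?thesis by (simp add: E_def T'_def T_def)
qed

section \<open>Propagation while the criticality functional is nonnegative\<close>

lemma pgf_ge_1:
  assumes "\<And>k. coeff U k \<ge> 0" "1 \<le> x"
  shows "poly (pgf_poly U) x \<ge> 1 + (x - 1) * coeff U 0"
proof -
  have "coeff U 0 * x ^ 0 \<le> (\<Sum>k\<le>degree U. coeff U k * x ^ k)"
    using assms by (intro member_le_sum [where f = "\<lambda>k. coeff U k * x ^ k"]) auto
  hence "coeff U 0 \<le> poly U x" by (simp add: poly_altdef)
  thus ?thesis
    using assms by (auto simp: poly_pgf_poly intro!: mult_left_mono)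
qed

lemma poly_nonneg: "(\<And>k. coeff U k \<ge> 0) \<Longrightarrow> (x::real) \<ge> 0 \<Longrightarrow> poly U x \<ge> 0"
  unfolding poly_altdef by (auto intro!: sum_nonneg)

text \<open>\<open>crit \<ge> 0\<close> says \<open>x (x - 1) G' \<le> G\<close>, while nonnegative
  coefficients give \<open>(x - 1) G' \<ge> G - 1\<close>; together
  \<open>G \<le> x / (x - 1)\<close>.\<close>

lemma pgf_le:
  fixes U :: "real poly"
  assumes U: "\<And>k. coeff U k \<ge> 0" and x: "3/2 \<le> x" and D: "crit (pCons 0 U) x \<ge> 0"
  shows "poly (pgf_poly U) x \<le> 3"
proof -
  let ?G = "poly (pgf_poly U) x" and ?G1 = "poly (pderiv (pgf_poly U)) x"
  have 1: "x * ((x - 1) * ?G1) \<le> ?G" using D by (simp add: crit_pCons mult_ac)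
  have "poly (pderiv U) x \<ge> 0"
    using x U by (intro poly_nonneg) (auto simp: coeff_pderiv)
  hence "?G1 \<ge> poly U x" using x by (simp add: poly_pderiv_pgf_poly)
  hence "(x - 1) * ?G1 \<ge> ?G - 1" using x by (simp add: poly_pgf_poly mult_left_mono)
  hence "x * (?G - 1) \<le> x * ((x - 1) * ?G1)" using x by (intro mult_left_mono) auto
  with 1 have "x * (?G - 1) \<le> ?G" by simp
  hence "(x - 1) * ?G \<le> x" by (simp add: algebra_simps)
  also have "\<dots> \<le> (x - 1) * 3" using x by simp
  finally show ?thesis using x by (subst (asm) mult_le_cancel_left) auto
qed

lemma tangent_le_1:
  fixes U :: "real poly"
  assumes U: "\<And>k. coeff U k \<ge> 0" and x: "7/4 \<le> x" "x \<le> M" "M \<le> x\<^sup>2"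
  shows "tangent M (pCons 0 U) x \<le> 1"
proof -
  have e: "0 \<le> 1 - M / x\<^sup>2" "1 - M / x\<^sup>2 \<le> 1" using x by (auto simp: divide_le_eq)
  have "(1 - M / x\<^sup>2) * crit (pCons 0 U) x \<le> (1 - M / x\<^sup>2) * 1"
    using crit_le_1 [of U x] U x e by (intro mult_left_mono) auto
  moreover have "(x - 1) * (M - x) / x * crit' (pCons 0 U) x \<ge> 0"
    using crit'_nonneg [of U x] U x by (intro mult_nonneg_nonneg) auto
  moreover have "A \<le> e * 1 \<Longrightarrow> e \<le> 1 \<Longrightarrow> B \<ge> 0 \<Longrightarrow> A - B \<le> 1" for A B e :: real
    by linarith
  ultimately show ?thesis using e unfolding tangent_def by blast
qed

text \<open>The remainder in \<open>tangent_step_poly\<close> has a prefactor of order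
  \<open>L\<close> and is quadratic in \<open>L\<close> and \<open>D\<close>.
  \<open>crit_sq_bound\<close> bounds \<open>D ^ 2\<close> by a multiple of
  \<open>T + L ^ 2\<close>, and the assumed lower bound on \<open>T\<close> turns
  \<open>L ^ 2\<close> into a multiple of \<open>T\<close>, so the loss is relative and of order
  \<open>L\<close>. The gain \<open>m / s \<ge> 1\<close> is given away.\<close>

lemma tangent_step_lower:
  fixes s s1 L :: real and m :: nat
  assumes m: "m \<ge> 2" and L: "0 < L" "L \<le> 1/4" "208 * (10 + 2 * m) * L \<le> 1" and s: "s = m - L" "s1 = m - L ^ 3"
    and U: "\<And>k. coeff U k \<ge> 0" "coeff U 0 \<le> 1" and D: "crit (pCons 0 U) s1 \<ge> 0"
    and c: "0 < c" "c * L\<^sup>2 \<le> tangent m (pCons 0 U) s"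
    and K: "K = (3 + (real m)\<^sup>2) * (1 + 32 + 53248 * (real m)\<^sup>2) * (1 + 1 / c)"
  shows "tangent m (step_poly m U) s \<ge> poly (pgf_poly U) s ^ (m - 1) * (tangent m (pCons 0 U) s * (1 - K * L))"
proof -
  define T where "T = tangent m (pCons 0 U) s"
  define D where "D = crit (pCons 0 U) s"
  define G where "G = poly (pgf_poly U) s"
  define C where "C = 32 + 53248 * (real m)\<^sup>2"
  have s2: "s \<ge> 7/4" using m L s by auto
  have "L ^ 3 \<le> L" using L power_decreasing [of 1 3 L] by auto
  hence ss: "s \<le> s1" using s by auto
  have D0: "D \<ge> 0" using crit_antimono [of U s s1] assms(9) U s2 ss by (auto simp: D_def)
  have G: "1 \<le> G" "G \<le> 3"
    using pgf_ge_1 [of U s] pgf_le [of U s] U(1) s2 D0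
    by (auto simp: G_def D_def intro: order_trans [rotated])
  have T: "T > 0" using c L by (smt (verit) T_def zero_less_mult_iff zero_less_power)
  have LT: "L\<^sup>2 \<le> T / c" using c by (simp add: T_def field_simps)
  have D2: "D\<^sup>2 \<le> C * (T + L\<^sup>2)"
    using crit_sq_bound [of "real m" L s s1 U] m L s U assms(9) T by (auto simp: D_def C_def T_def)
  have C: "C > 0" by (simp add: C_def add_pos_nonneg)
  have GG: "G ^ (m - 1) = G ^ (m - 2) * G"
  proof -
    obtain k where "m = Suc (Suc k)" using m by (metis add_2_eq_Suc le_Suc_ex)
    thus ?thesis by simp
  qed
  define X where "X = L\<^sup>2 * G\<^sup>2 - 2 * m * L * G * D + m * (real m - 1) * D\<^sup>2"
  have "G ^ (m - 2) * X \<le> G ^ (m - 1) * ((3 + (real m)\<^sup>2) * (L\<^sup>2 + D\<^sup>2))"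
  proof -
    have "X \<le> L\<^sup>2 * G\<^sup>2 + m * (real m - 1) * D\<^sup>2"
      using L G D0 by (simp add: X_def)
    also have "\<dots> \<le> G * (3 * L\<^sup>2) + G * ((real m)\<^sup>2 * D\<^sup>2)"
    proof (rule add_mono)
      show "L\<^sup>2 * G\<^sup>2 \<le> G * (3 * L\<^sup>2)" 
        using G mult_right_mono [of G 3 "G * L\<^sup>2"] by (simp add: power2_eq_square mult_ac)
      have "m * (real m - 1) * D\<^sup>2 \<le> 1 * ((real m)\<^sup>2 * D\<^sup>2)"
        unfolding mult_1 by (intro mult_right_mono) (auto simp: power2_eq_square algebra_simps)
      also have "\<dots> \<le> G * ((real m)\<^sup>2 * D\<^sup>2)" using G by (intro mult_right_mono) auto
      finally show "m * (real m - 1) * D\<^sup>2 \<le> G * ((real m)\<^sup>2 * D\<^sup>2)" .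
    qed
    also have "\<dots> \<le> G * ((3 + (real m)\<^sup>2) * (L\<^sup>2 + D\<^sup>2))"
      unfolding distrib_left [symmetric] using G
      by (intro mult_left_mono) (auto simp: algebra_simps)
    finally have "G ^ (m - 2) * X \<le> G ^ (m - 2) * (G * ((3 + (real m)\<^sup>2) * (L\<^sup>2 + D\<^sup>2)))"
      using G by (intro mult_left_mono) auto
    thus ?thesis unfolding GG by (simp only: mult.assoc)
  qed
  also have "\<dots> \<le> G ^ (m - 1) * (K * T)"
  proof -
    have "L\<^sup>2 + D\<^sup>2 \<le> (1 + C) * (T + L\<^sup>2)" using D2 T by (simp add: algebra_simps)
    also have "\<dots> \<le> (1 + C) * (T + T / c)" using C LT by (intro mult_left_mono) auto
    also have "\<dots> = (1 + C) * (1 + 1 / c) * T" by (simp add: field_simps)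
    finally have "(3 + (real m)\<^sup>2) * (L\<^sup>2 + D\<^sup>2) \<le> (3 + (real m)\<^sup>2) * ((1 + C) * (1 + 1 / c) * T)"
      by (intro mult_left_mono) auto
    also have "\<dots> = K * T" by (simp add: K C_def)
    finally show ?thesis using G by (intro mult_left_mono) auto
  qed
  finally have X: "G ^ (m - 2) * X \<le> G ^ (m - 1) * (K * T)" .
  have K0: "K \<ge> 0" unfolding K using c by (intro mult_nonneg_nonneg) auto
  have "L / s ^ 3 \<le> L" "L / s ^ 3 \<ge> 0"
    using L s2 one_le_power [of s 3] by (auto simp: divide_le_eq mult_le_cancel_left1)
  hence "L / s ^ 3 * (G ^ (m - 2) * X) \<le> L * (G ^ (m - 1) * (K * T))"
  proof -
    have "L / s ^ 3 * (G ^ (m - 2) * X) \<le> L / s ^ 3 * (G ^ (m - 1) * (K * T))"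
      using X \<open>L / s ^ 3 \<ge> 0\<close> by (rule mult_left_mono)
    also have "\<dots> \<le> L * (G ^ (m - 1) * (K * T))"
      using \<open>L / s ^ 3 \<le> L\<close> G K0 T by (intro mult_right_mono) auto
    finally show ?thesis .
  qed
  moreover have "tangent m (step_poly m U) s = (m / s) * G ^ (m - 1) * T - L / s ^ 3 * (G ^ (m - 2) * X)"
    using tangent_step_poly [of m s U] m s2 by (simp add: G_def T_def X_def D_def s)
  moreover have "(m / s) * G ^ (m - 1) * T \<ge> G ^ (m - 1) * T"
  proof -
    have "m / s \<ge> 1" using s s2 L by simp
    hence "m / s * (G ^ (m - 1) * T) \<ge> 1 * (G ^ (m - 1) * T)" using G T by (intro mult_right_mono) auto
    thus ?thesis by simp
  qed
  ultimately have "tangent m (step_poly m U) s \<ge> G ^ (m - 1) * T - L * (G ^ (m - 1) * (K * T))"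
    by linarith
  thus ?thesis by (simp add: G_def T_def algebra_simps)
qed

text \<open>Dichotomy on \<open>crit\<close> at \<open>s\<close>. If it exceeds 1/4,
  \<open>crit_sq_bound\<close> forces \<open>tangent\<close> above \<open>1 / (32 * C)\<close>.
  Otherwise the first moment is at least \<open>3 / (4 M ^ 2)\<close>, and since little of it sits
  at \<open>k = 0\<close>, the third moment over \<open>k \<ge> 1\<close> is bounded below.\<close>

lemma tangent_lower_small:
  fixes M s s1 L :: real
  assumes M: "M \<ge> 2" and L: "0 < L" "L \<le> 1/4" "208 * (10 + 2 * M) * L \<le> 1" and s: "s = M - L" "s1 = M - L ^ 3"
    and U: "\<And>k. coeff U k \<ge> 0" "coeff U 0 \<le> 1" and D: "crit (pCons 0 U) s1 \<ge> 0"
    and t: "coeff U 0 \<le> 1 / (4 * M\<^sup>2)" and C: "C = 32 + 53248 * M\<^sup>2" and L': "32 * C * L\<^sup>2 \<le> 1"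
  shows "tangent M (pCons 0 U) s \<ge> L\<^sup>2 / (32 * C)"
proof -
  define T where "T = tangent M (pCons 0 U) s"
  define S3 where "S3 = (\<Sum>k\<le>degree U. coeff U k * (real k + 1) ^ 3 * s ^ k)"
  have s2: "s \<ge> 7/4" using M L s by auto
  have C0: "C > 0" by (simp add: C add_pos_nonneg)
  have T1: "T \<ge> L\<^sup>2 / 208 * (S3 - coeff U 0) - (10 + 2 * M) * L ^ 3 * coeff U 0"
    unfolding T_def S3_def by (rule tangent_sum_lower [OF M L s U(1) order_refl D])
  show ?thesis
  proof (cases "crit (pCons 0 U) s > 1/4")
    case True
    hence "(1/4)\<^sup>2 < (crit (pCons 0 U) s)\<^sup>2" by (intro power_strict_mono) auto
    also have "\<dots> \<le> C * (max 0 T + L\<^sup>2)"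
      unfolding C T_def by (rule crit_sq_bound [OF M L s U D])
    finally have "1 / 32 < C * max 0 T" using L' by (simp add: algebra_simps power2_eq_square)
    hence "1 / 32 < C * T" using C0 by (cases "T \<ge> 0") (auto simp: max_def)
    moreover have "L\<^sup>2 \<le> 1" using L by (simp add: power_le_one)
    ultimately have "L\<^sup>2 < 32 * C * T" by simp
    thus ?thesis using C0 by (simp add: T_def field_simps)
  next
    case False
    hence "3/4 \<le> (s - 1)\<^sup>2 * (\<Sum>k\<le>degree U. coeff U k * (real k + 1) * s ^ k)"
      using poly_pderiv_pCons_sum(1) [OF order_refl, of U] by (simp add: crit_def)
    also have "\<dots> \<le> M\<^sup>2 * S3"
      unfolding S3_def
    proof (rule mult_mono [OF _ sum_mono])
      fix k
      have "(real k + 1) \<le> (real k + 1) ^ 3" by (intro self_le_power) auto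
      thus "coeff U k * (real k + 1) * s ^ k \<le> coeff U k * (real k + 1) ^ 3 * s ^ k"
        using U s2 by (intro mult_right_mono mult_left_mono) auto
    qed (use s s2 L U in \<open>auto intro!: sum_nonneg power_mono\<close>)
    finally have "3 / (4 * M\<^sup>2) \<le> S3" using M by (simp add: field_simps)
    hence S: "S3 - coeff U 0 \<ge> 1 / (2 * M\<^sup>2)" using t M by (simp add: field_simps)
    have "208 * ((10 + 2 * M) * L ^ 3 * coeff U 0) = (208 * (10 + 2 * M) * L) * (L\<^sup>2 * coeff U 0)"
      by (simp add: power2_eq_square power3_eq_cube algebra_simps)
    also have "\<dots> \<le> 1 * (L\<^sup>2 * coeff U 0)"
      using L U by (intro mult_right_mono) auto
    also have "\<dots> \<le> L\<^sup>2 * (1 / (4 * M\<^sup>2))"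
      unfolding mult_1 using t by (intro mult_left_mono) auto
    finally have "(10 + 2 * M) * L ^ 3 * coeff U 0 \<le> L\<^sup>2 / 208 * (1 / (4 * M\<^sup>2))" by simp
    moreover have "L\<^sup>2 / 208 * (1 / (2 * M\<^sup>2)) \<le> L\<^sup>2 / 208 * (S3 - coeff U 0)"
      using S by (intro mult_left_mono) auto
    ultimately have "T \<ge> L\<^sup>2 / 208 * (1 / (2 * M\<^sup>2)) - L\<^sup>2 / 208 * (1 / (4 * M\<^sup>2))"
      using T1 by linarith
    also have "L\<^sup>2 / 208 * (1 / (2 * M\<^sup>2)) - L\<^sup>2 / 208 * (1 / (4 * M\<^sup>2)) = L\<^sup>2 / (832 * M\<^sup>2)"
      by simp
    finally have "T \<ge> L\<^sup>2 / (832 * M\<^sup>2)" .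
    moreover have "L\<^sup>2 / (32 * C) \<le> L\<^sup>2 / (832 * M\<^sup>2)"
      using M by (intro divide_left_mono) (auto simp: C add_pos_nonneg)
    ultimately show ?thesis by (simp add: T_def)
  qed
qed

text \<open>As long as \<open>D\<close> is nonnegative slightly below \<open>m\<close>, \<open>tangent\<close> lies between \<open>c2 L\<^sup>2\<close> and \<open>1\<close> and grows
  at least by the factor \<open>G\<^sup>m\<^sup>-\<^sup>1 (1 - C L)\<close> in each step. The lower bound persists because a law for
  which it could fail has a large atom away from zero, which makes \<open>G\<^sup>m\<^sup>-\<^sup>1\<close> bounded away from \<open>1\<close>.\<close>

lemma nonneg_crit_growth:
  fixes m :: nat and \<rho> :: real
  assumes m: "m \<ge> 2" and \<rho>: "\<rho> > 0"
  obtains C L0 where "C > 0" "0 < L0" "L0 \<le> 1/4"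
    "\<And>(L::real) U I. \<lbrakk>0 < L; L \<le> L0; \<And>i k. coeff (U i) k \<ge> 0; \<And>i. coeff (U i) 0 \<le> 1;
       coeff (U 0) 1 \<ge> \<rho> * coeff (U 0) 0;
       \<And>i. i < I \<Longrightarrow> crit (pCons 0 (U i)) (real m - L ^ 3) \<ge> 0;
       \<And>i. i < I \<Longrightarrow> tangent m (pCons 0 (U (Suc i))) (real m - L) \<ge> tangent m (step_poly m (U i)) (real m - L)\<rbrakk>
     \<Longrightarrow> (1 - C * L) ^ I * L\<^sup>2 * (\<Prod>i<I. poly (pgf_poly (U i)) (real m - L) ^ (m - 1)) \<le> C"
    "C * L0 \<le> 1/2"
proof -
  define M where "M = real m"
  define A where "A = 32 + 53248 * M\<^sup>2"
  define c1 where "c1 = 1 / (32 * A)"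
  \<comment> \<open>Half of \<open>c1\<close> allows for one step with the loss
    \<open>1 - K L \<ge> 1/2\<close>. The second entry covers a start with sizeable
    \<open>coeff (U 0) 0\<close>, where \<open>\<rho>\<close> guarantees a sizeable coefficient in
    degree 1.\<close>
  define c2 where "c2 = min (c1 / 2) (\<rho> / (208 * M\<^sup>2))"
  define K where "K = (3 + M\<^sup>2) * (1 + 32 + 53248 * M\<^sup>2) * (1 + 1 / c2)"
  define C where "C = max K (1 / c2)"
  \<comment> \<open>The entries give, in order: \<open>L \<le> 1/4\<close>; the threshold of
    \<open>tangent_sum_lower\<close>; \<open>32 A L ^ 2 \<le> 1\<close>;
    \<open>C L \<le> 1/2\<close>; \<open>C L\<close> at most half of the gain \<open>x\<close> used
    in the invariant; an error of at most half of the initial gain.\<close>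
  define L0 where "L0 = Min {1/4, 1 / (208 * (10 + 2 * M)), 1 / (1 + 32 * A), 1 / (2 * C), 3 / (32 * M\<^sup>2) / C, \<rho> / (208 * M\<^sup>2) / (10 + 2 * M)}"
  have M: "M \<ge> 2" using m by (simp add: M_def)
  have A: "A > 0" by (simp add: A_def add_pos_nonneg)
  have c1: "c1 > 0" using A by (simp add: c1_def)
  have c2: "0 < c2" "c2 \<le> c1 / 2" "c2 \<le> c1" "c2 \<le> \<rho> / (208 * M\<^sup>2)" using c1 \<rho> M by (auto simp: c2_def)
  have C: "C > 0" using c2 by (auto simp: C_def less_max_iff_disj)
  have KC: "0 \<le> K" "K \<le> C" unfolding K_def C_def using c2 by (auto intro!: mult_nonneg_nonneg)
  have L0: "L0 > 0" "L0 \<le> 1/4" "L0 \<le> 1 / (208 * (10 + 2 * M))" "L0 \<le> 1 / (1 + 32 * A)" "L0 \<le> 1 / (2 * C)"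
      "L0 \<le> 3 / (32 * M\<^sup>2) / C" "L0 \<le> \<rho> / (208 * M\<^sup>2) / (10 + 2 * M)"
    using A C M \<rho> by (auto simp: L0_def)
  show ?thesis
  proof (rule that [OF C L0(1,2)])
    show "C * L0 \<le> 1 / 2" using L0(5) C by (simp add: field_simps)
  next
    fix L :: real and U :: "nat \<Rightarrow> real poly" and I :: nat
    assume L: "0 < L" "L \<le> L0" and U: "\<And>i k. coeff (U i) k \<ge> 0" "\<And>i. coeff (U i) 0 \<le> 1"
      and U0: "coeff (U 0) 1 \<ge> \<rho> * coeff (U 0) 0"
      and D: "\<And>i. i < I \<Longrightarrow> crit (pCons 0 (U i)) (real m - L ^ 3) \<ge> 0"
      and step: "\<And>i. i < I \<Longrightarrow> tangent m (pCons 0 (U (Suc i))) (real m - L) \<ge> tangent m (step_poly m (U i)) (real m - L)"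
    define s where "s = m - L"
    define G where "G = (\<lambda>i. poly (pgf_poly (U i)) s)"
    define T where "T = (\<lambda>i. tangent m (pCons 0 (U i)) s)"
    have L1: "L \<le> 1/4" "208 * (10 + 2 * M) * L \<le> 1" "C * L \<le> 1/2" "C * L \<le> 3 / (32 * M\<^sup>2)"
        "(10 + 2 * M) * L \<le> \<rho> / (208 * M\<^sup>2)" "32 * A * L \<le> 1"
    proof -
      have div: "b * L \<le> a" if "L0 \<le> a / b" "b > 0" for a b :: real
        using that order_trans [OF L(2) that(1)] by (simp add: field_simps)
      have "(1 + 32 * A) * L \<le> 1" using A by (intro div L0) auto
      thus "32 * A * L \<le> 1" using L by (simp add: algebra_simps)
      have "(2 * C) * L \<le> 1" using C by (intro div L0) auto
      thus "C * L \<le> 1/2" by simp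
      show "L \<le> 1/4" using L L0 by simp
      show "208 * (10 + 2 * M) * L \<le> 1" using M by (intro div L0) auto
      show "C * L \<le> 3 / (32 * M\<^sup>2)" using C by (intro div L0)
      show "(10 + 2 * M) * L \<le> \<rho> / (208 * M\<^sup>2)" using M by (intro div L0) auto
    qed
    have L2: "32 * A * L\<^sup>2 \<le> 1"
    proof -
      have "32 * A * L\<^sup>2 = 32 * A * L * L" by (simp add: power2_eq_square)
      also have "\<dots> \<le> 1 * 1" using L1 L A by (intro mult_mono) auto
      finally show ?thesis by simp
    qed
    have KL: "K * L \<le> C * L" using KC L by (intro mult_right_mono) auto
    have s2: "s \<ge> 7/4" "s \<le> m" using m L L1 by (auto simp: s_def)
    have G1: "G i \<ge> 1" "G i \<ge> 1 + (s - 1) * coeff (U i) 0" for i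
      using pgf_ge_1 [of "U i" s] U s2 by (auto simp: G_def intro: order_trans [rotated])
    have small: "T i \<ge> c1 * L\<^sup>2" if "i < I" "coeff (U i) 0 \<le> 1 / (4 * M\<^sup>2)" for i
      using tangent_lower_small [of M L s "M - L ^ 3" "U i" A] M L L1 L2 that U D [OF that(1)]
      by (simp add: T_def s_def M_def A_def c1_def)
    have nxt: "T (Suc i) \<ge> G i ^ (m - 1) * (T i * (1 - K * L))" if "i < I" "T i \<ge> c2 * L\<^sup>2" for i
      using tangent_step_lower [of m L s "m - L ^ 3" "U i" c2 K] m L L1 U D [OF that(1)] that(2) c2(1) step [OF that(1)]
      by (simp add: T_def s_def M_def K_def G_def)
    \<comment> \<open>For \<open>I = 0\<close> nothing is known about \<open>crit\<close>, so the
      lower bound may fail; the claim then only needs \<open>c2 * L ^ 2 \<le> 1\<close>.\<close>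
    have inv: "I = 0 \<or> (i \<le> I \<longrightarrow> T i \<ge> c2 * L\<^sup>2)" for i
    proof (induction i)
      case 0
      show ?case
      proof (cases "I = 0 \<or> coeff (U 0) 0 \<le> 1 / (4 * M\<^sup>2)")
        case True
        moreover have "c2 * L\<^sup>2 \<le> c1 * L\<^sup>2" using c2 by (intro mult_right_mono) auto
        ultimately show ?thesis using small [of 0] by fastforce
      next
        case False
        define N where "N = Suc (degree (U 0))"
        have "coeff (U 0) 0 + 8 * coeff (U 0) 1 * s = (\<Sum>k\<in>{0,1}. coeff (U 0) k * (real k + 1) ^ 3 * s ^ k)"
          by simp
        also have "\<dots> \<le> (\<Sum>k\<le>N. coeff (U 0) k * (real k + 1) ^ 3 * s ^ k)"
          using U s2 by (intro sum_mono2) (auto simp: N_def)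
        finally have S: "(\<Sum>k\<le>N. coeff (U 0) k * (real k + 1) ^ 3 * s ^ k) - coeff (U 0) 0 \<ge> 8 * coeff (U 0) 1 * s"
          by simp
        have T0: "T 0 \<ge> L\<^sup>2 / 208 * ((\<Sum>k\<le>N. coeff (U 0) k * (real k + 1) ^ 3 * s ^ k) - coeff (U 0) 0)
            - (10 + 2 * M) * L ^ 3 * coeff (U 0) 0"
          using tangent_sum_lower [of M L s "M - L ^ 3" "U 0" N] M L L1 U D [of 0] False
          by (simp add: T_def s_def M_def N_def)
        have "2 * \<rho> / M\<^sup>2 \<le> 8 * coeff (U 0) 1 * s"
        proof -
          have "\<rho> * (1 / (4 * M\<^sup>2)) \<le> \<rho> * coeff (U 0) 0" using False \<rho> by (intro mult_left_mono) auto
          also have "\<dots> \<le> coeff (U 0) 1" by (rule U0)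
          finally have 1: "\<rho> / (4 * M\<^sup>2) \<le> coeff (U 0) 1" by simp
          have "8 * (\<rho> / (4 * M\<^sup>2)) * 1 \<le> 8 * coeff (U 0) 1 * s"
            using 1 s2 U \<rho> by (intro mult_mono) auto
          thus ?thesis by simp
        qed
        hence "L\<^sup>2 / 208 * (2 * \<rho> / M\<^sup>2) \<le> L\<^sup>2 / 208 * ((\<Sum>k\<le>N. coeff (U 0) k * (real k + 1) ^ 3 * s ^ k) - coeff (U 0) 0)"
          using S by (intro mult_left_mono) auto
        moreover have "(10 + 2 * M) * L ^ 3 * coeff (U 0) 0 \<le> L\<^sup>2 / 208 * (\<rho> / M\<^sup>2)"
        proof -
          have "(10 + 2 * M) * L ^ 3 * coeff (U 0) 0 \<le> (10 + 2 * M) * L ^ 3 * 1"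
            using U L M by (intro mult_left_mono) auto
          also have "\<dots> = ((10 + 2 * M) * L) * L\<^sup>2" by (simp add: power2_eq_square power3_eq_cube)
          also have "\<dots> \<le> (\<rho> / (208 * M\<^sup>2)) * L\<^sup>2" using L1 by (intro mult_right_mono) auto
          finally show ?thesis by (simp add: field_simps)
        qed
        moreover have "L\<^sup>2 / 208 * (2 * \<rho> / M\<^sup>2) = 2 * (L\<^sup>2 / 208 * (\<rho> / M\<^sup>2))" by simp
        ultimately have "T 0 \<ge> L\<^sup>2 / 208 * (\<rho> / M\<^sup>2)" using T0 by linarith
        moreover have "c2 * L\<^sup>2 \<le> \<rho> / (208 * M\<^sup>2) * L\<^sup>2" using c2 by (intro mult_right_mono) auto
        ultimately show ?thesis by (simp add: field_simps)
      qed
    next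
      case (Suc i)
      show ?case
      proof (cases "I = 0 \<or> \<not> Suc i \<le> I")
        case True
        thus ?thesis by auto
      next
        case False
        hence i: "Suc i \<le> I" "I \<noteq> 0" by auto
        with Suc have Ti: "T i \<ge> c2 * L\<^sup>2" and iI: "i < I" by auto
        have T0: "T i \<ge> 0" using Ti c2 by (smt (verit) mult_nonneg_nonneg zero_le_power2)
        have "T (Suc i) \<ge> c2 * L\<^sup>2"
        proof (cases "coeff (U i) 0 \<le> 1 / (4 * M\<^sup>2)")
          case True
          have "c2 * L\<^sup>2 \<le> (c1 / 2) * L\<^sup>2" using c2 by (intro mult_right_mono) auto
          also have "\<dots> = (c1 * L\<^sup>2) * (1 / 2)" by simp
          also have "\<dots> \<le> T i * (1 - K * L)"
            using small [OF iI True] KL L1(3) c1 T0 by (intro mult_mono) auto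
          also have "\<dots> = 1 * (T i * (1 - K * L))" by simp
          also have "\<dots> \<le> G i ^ (m - 1) * (T i * (1 - K * L))"
            using G1(1) [of i] KL L1(3) T0 by (intro mult_right_mono one_le_power mult_nonneg_nonneg) auto
          finally show ?thesis using nxt [OF iI Ti] by linarith
        next
          case False
          \<comment> \<open>The product of the lower bounds 3/4 for \<open>s - 1\<close> and
            \<open>1 / (4 M ^ 2)\<close> for \<open>coeff (U i) 0\<close>, so
            \<open>G i \<ge> 1 + x\<close>. This outweighs the loss
            \<open>1 - K L \<ge> 1 - x / 2\<close>.\<close>
          define x where "x = 3 / (16 * M\<^sup>2)"
          have x: "0 < x" "x \<le> 1"
            using M power_mono [of 2 M 2] by (auto simp: x_def field_simps)
          have "(3/4) * (1 / (4 * M\<^sup>2)) \<le> (s - 1) * coeff (U i) 0"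
            using s2 False U by (intro mult_mono) auto
          hence "G i \<ge> 1 + x" using G1(2) [of i] by (simp add: x_def)
          also have "G i \<le> G i ^ (m - 1)" using G1(1) [of i] m by (intro self_le_power) auto
          finally have Gx: "G i ^ (m - 1) \<ge> 1 + x" .
          have Kx: "K * L \<le> x / 2" using KL L1(4) by (simp add: x_def)
          have "1 \<le> (1 + x) * (1 - x / 2)" using x by (simp add: algebra_simps)
          also have "\<dots> \<le> G i ^ (m - 1) * (1 - K * L)" using Gx Kx x by (intro mult_mono) auto
          finally have "1 * T i \<le> (G i ^ (m - 1) * (1 - K * L)) * T i" using T0 by (intro mult_right_mono)
          thus ?thesis using nxt [OF iI Ti] Ti by (simp add: mult_ac)
        qed
        thus ?thesis by blast
      qed
    qed
    have "i \<le> I \<Longrightarrow> I \<noteq> 0 \<Longrightarrow> (1 - K * L) ^ i * (c2 * L\<^sup>2) * (\<Prod>j<i. G j ^ (m - 1)) \<le> T i" for i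
    proof (induction i)
      case 0
      thus ?case using inv [of 0] by simp
    next
      case (Suc i)
      have "(1 - K * L) ^ Suc i * (c2 * L\<^sup>2) * (\<Prod>j<Suc i. G j ^ (m - 1)) =
         G i ^ (m - 1) * (((1 - K * L) ^ i * (c2 * L\<^sup>2) * (\<Prod>j<i. G j ^ (m - 1))) * (1 - K * L))"
        by (simp add: mult_ac)
      also have "\<dots> \<le> G i ^ (m - 1) * (T i * (1 - K * L))"
        using Suc G1(1) [of i] KL L1(3) by (intro mult_left_mono mult_right_mono) auto
      also have "\<dots> \<le> T (Suc i)" using Suc inv [of i] by (intro nxt) auto
      finally show ?case .
    qed
    from this [of I] have "I \<noteq> 0 \<Longrightarrow> (1 - K * L) ^ I * (c2 * L\<^sup>2) * (\<Prod>j<I. G j ^ (m - 1)) \<le> T I" by simp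
    moreover have "T I \<le> 1"
    proof -
      have "real m \<le> s\<^sup>2" unfolding s_def using m L L1 by (intro le_square_diff) auto
      thus ?thesis
        unfolding T_def using U s2 by (intro tangent_le_1) auto
    qed
    moreover have "I = 0 \<Longrightarrow> c2 * L\<^sup>2 \<le> 1"
    proof -
      have "c1 \<le> 1" using A unfolding c1_def by (simp add: A_def add_pos_nonneg)
      hence "c2 * L\<^sup>2 \<le> 1 * 1" using c2 L1 L by (intro mult_mono) (auto simp: power_le_one)
      thus ?thesis by simp
    qed
    ultimately have le1: "(1 - K * L) ^ I * (c2 * L\<^sup>2) * (\<Prod>j<I. G j ^ (m - 1)) \<le> 1"
      by (cases "I = 0") auto
    have "(1 - C * L) ^ I * L\<^sup>2 * (\<Prod>j<I. G j ^ (m - 1)) \<le> (1 - K * L) ^ I * L\<^sup>2 * (\<Prod>j<I. G j ^ (m - 1))"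
      using KL L1(3) G1(1) by (intro mult_right_mono power_mono prod_nonneg) (auto intro: order_trans [of 0 1])
    also have "\<dots> \<le> 1 / c2" using le1 c2 by (simp add: field_simps)
    also have "\<dots> \<le> C" by (simp add: C_def)
    finally show "(1 - C * L) ^ I * L\<^sup>2 * (\<Prod>i<I. poly (pgf_poly (U i)) (real m - L) ^ (m - 1)) \<le> C"
      by (simp add: G_def s_def)
  qed
qed

section \<open>Effect of truncation, the negative phase, and the combined growth bound\<close>

lemma poly_pderiv_mono:
  fixes J V :: "real poly"
  assumes "\<And>k. k \<ge> 1 \<Longrightarrow> coeff J k \<le> coeff V k" "x \<ge> 0"
  shows "poly (pderiv J) x \<le> poly (pderiv V) x" "poly (pderiv (pderiv J)) x \<le> poly (pderiv (pderiv V)) x"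
proof -
  have "poly (pderiv (V - J)) x \<ge> 0" "poly (pderiv (pderiv (V - J))) x \<ge> 0"
    using assms by (auto intro!: poly_nonneg simp: coeff_pderiv)
  thus "poly (pderiv J) x \<le> poly (pderiv V) x" "poly (pderiv (pderiv J)) x \<le> poly (pderiv (pderiv V)) x"
    by (auto simp: pderiv_diff)
qed

text \<open>Larger coefficients lower \<open>crit\<close> and raise \<open>crit'\<close>. Deleting
  coefficients by truncation can therefore only increase \<open>tangent\<close>, and the nonnegative
  phase needs no truncation error.\<close>

lemma tangent_antimono:
  fixes J V :: "real poly"
  assumes "\<And>k. k \<ge> 1 \<Longrightarrow> coeff J k \<le> coeff V k" "1 \<le> x" "x \<le> M" "M \<le> x\<^sup>2"
  shows "tangent M V x \<le> tangent M J x"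
proof -
  have x0: "x \<ge> 0" using assms by simp
  note P = poly_pderiv_mono [of J V, OF assms(1) x0, simplified]
  have "1 - M / x\<^sup>2 \<ge> 0" using assms by (auto simp: divide_le_eq)
  moreover have "crit V x \<le> crit J x" unfolding crit_def using P by (intro diff_left_mono mult_left_mono) auto
  moreover have "crit' J x \<le> crit' V x" unfolding crit'_def using P assms by (intro add_mono mult_left_mono) auto
  moreover have "(x - 1) * (M - x) / x \<ge> 0" using assms by auto
  ultimately show ?thesis unfolding tangent_def by (intro diff_mono mult_left_mono)
qed

text \<open>Meant for the part removed by truncation: apart from its constant it starts beyond
  degree \<open>K\<close>, so the gap between the radii \<open>x\<close> and \<open>M\<close> yields
  the geometric factor \<open>z ^ K\<close>.\<close>

lemma poly_pderiv_tail:
  fixes W :: "real poly"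
  assumes W: "\<And>k. coeff W k \<ge> 0" "\<And>k. 1 \<le> k \<Longrightarrow> k \<le> K \<Longrightarrow> coeff W k = 0"
    and b: "\<And>k. k * x ^ (k - 1) \<le> C * z ^ k * M ^ k" and "0 \<le> z" "z \<le> 1" "0 \<le> M" "0 \<le> C"
  shows "poly (pderiv W) x \<le> C * z ^ K * poly W M"
proof -
  have *: "W = (\<Sum>k\<le>degree W. monom (coeff W k) k)" by (rule poly_as_sum_of_monoms [symmetric])
  have "poly (pderiv W) x = (\<Sum>k\<le>degree W. coeff W k * (k * x ^ (k - 1)))"
    by (subst *) (simp add: pderiv_sum pderiv_monom poly_sum poly_monom mult_ac)
  also have "\<dots> \<le> (\<Sum>k\<le>degree W. coeff W k * (C * z ^ K * M ^ k))"
  proof (intro sum_mono)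
    fix k
    show "coeff W k * (k * x ^ (k - 1)) \<le> coeff W k * (C * z ^ K * M ^ k)"
    proof (cases "k = 0 \<or> k > K")
      case True
      moreover have "k * x ^ (k - 1) \<le> C * z ^ K * M ^ k" if "k > K"
      proof -
        have "z ^ k \<le> z ^ K" using that assms by (intro power_decreasing) auto
        hence "C * z ^ k * M ^ k \<le> C * z ^ K * M ^ k" using assms by (intro mult_right_mono mult_left_mono) auto
        with b [of k] show ?thesis by linarith
      qed
      ultimately show ?thesis using W(1) [of k] assms by (auto intro!: mult_left_mono)
    qed (use W in auto)
  qed
  also have "\<dots> = C * z ^ K * poly W M"
    by (simp add: poly_altdef sum_distrib_left mult_ac)
  finally show ?thesis .
qed

text \<open>Once \<open>D\<close> is negative, \<open>-D\<close> itself grows by the factor \<open>G\<^sup>m\<^sup>-\<^sup>1\<close>.\<close>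

lemma neg_crit_growth:
  fixes x :: real and m :: nat
  assumes m: "m \<ge> 2" and x: "1 < x" "x < m"
    and U: "\<And>i k. coeff (U i) k \<ge> 0" and D: "crit (pCons 0 (U 0)) x < 0"
    and step: "\<And>i. i < I \<Longrightarrow> crit (pCons 0 (U (Suc i))) x \<le> crit (step_poly m (U i)) x + (m - x) / (2 * m)"
    and i: "1 \<le> i" "i \<le> I"
  shows "(m - x) / (2 * m) * (\<Prod>j\<in>{1..<i}. poly (pgf_poly (U j)) x ^ (m - 1)) \<le> - crit (pCons 0 (U i)) x"
proof -
  define G where "G = (\<lambda>i. poly (pgf_poly (U i)) x)"
  define D where "D = (\<lambda>i. crit (pCons 0 (U i)) x)"
  define e where "e = (m - x) / (2 * m)"
  have e: "e > 0" using x m by (simp add: e_def)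
  have G1: "G i \<ge> 1" for i
    using pgf_ge_1 [of "U i" x] U x by (auto simp: G_def intro: order_trans [rotated])
  have nxt: "D (Suc i) \<le> G i ^ (m - 1) * (D i - e)" if "i < I" "D i < 0" for i
  proof -
    define G1 where "G1 = poly (pderiv (pgf_poly (U i))) x"
    have Di: "D i = G i - x * ((x - 1) * G1)" by (simp add: D_def crit_pCons G_def G1_def)
    hence "G i < x * ((x - 1) * G1)" using that by simp
    hence 1: "1 < x * ((x - 1) * G1)" using \<open>G i \<ge> 1\<close> by linarith
    have "(x - 1) * G1 > 0" using 1 x by (smt (verit) zero_less_mult_iff)
    hence "x * ((x - 1) * G1) \<le> m * ((x - 1) * G1)" using x by (intro mult_right_mono) auto
    with 1 have "1 / m \<le> (x - 1) * G1" using m by (simp add: field_simps)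
    hence "(m - x) * (1 / m) \<le> (m - x) * ((x - 1) * G1)" using x by (intro mult_left_mono) auto
    moreover have "(m - x) * (1 / m) = 2 * e" using m by (simp add: e_def field_simps)
    moreover have "G i - m * (x - 1) * G1 = D i - (m - x) * ((x - 1) * G1)"
      by (simp add: Di algebra_simps)
    \<comment> \<open>Of the gain \<open>2 * e\<close>, which is due to \<open>x < m\<close>, one
      \<open>e\<close> pays for the truncation error allowed by the step hypothesis and the other
      one remains.\<close>
    ultimately have 2: "G i - m * (x - 1) * G1 \<le> D i - 2 * e" by linarith
    have "crit (step_poly m (U i)) x = G i ^ (m - 1) * (G i - m * (x - 1) * G1)"
      using m by (subst crit_step_poly) (auto simp: G_def G1_def)
    also have "\<dots> \<le> G i ^ (m - 1) * (D i - 2 * e)" using 2 \<open>G i \<ge> 1\<close> by (intro mult_left_mono) auto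
    finally have "D (Suc i) \<le> G i ^ (m - 1) * (D i - 2 * e) + e"
      using step [OF that(1)] by (simp add: D_def e_def)
    also have "e \<le> G i ^ (m - 1) * e" using \<open>G i \<ge> 1\<close> e by (simp add: one_le_power)
    hence "G i ^ (m - 1) * (D i - 2 * e) + e \<le> G i ^ (m - 1) * (D i - e)"
      by (simp add: algebra_simps)
    finally show ?thesis .
  qed
  have "D i < 0 \<and> e * (\<Prod>j\<in>{1..<i}. G j ^ (m - 1)) \<le> - D i"
    using i(1)
    using i(2)
  proof (induction i rule: dec_induct)
    case base
    \<comment> \<open>\<open>D 0\<close> may be arbitrarily close to zero; the first step pushes it
      below \<open>- e\<close>, which is why the product starts at 1.\<close>
    have "D 1 \<le> G 0 ^ (m - 1) * (D 0 - e)" using nxt [of 0] base assms(5) by (simp add: D_def)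
    also have "\<dots> \<le> 1 * (D 0 - e)"
      using one_le_power [OF G1] e assms(5) by (intro mult_right_mono_neg) (auto simp: D_def)
    finally show ?case using e assms(5) by (simp add: D_def)
  next
    case (step i)
    hence IH: "D i < 0" "e * (\<Prod>j\<in>{1..<i}. G j ^ (m - 1)) \<le> - D i" by auto
    have 1: "D (Suc i) \<le> G i ^ (m - 1) * (D i - e)" using nxt IH step by auto
    have 2: "G i ^ (m - 1) * (D i - e) \<le> 1 * (D i - e)"
      using one_le_power [OF G1] e IH by (intro mult_right_mono_neg) auto
    have "e * (\<Prod>j\<in>{1..<Suc i}. G j ^ (m - 1)) = G i ^ (m - 1) * (e * (\<Prod>j\<in>{1..<i}. G j ^ (m - 1)))"
      using step by (simp add: atLeastLessThanSuc mult_ac)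
    also have "\<dots> \<le> G i ^ (m - 1) * (- (D i - e))"
      using IH G1 [of i] e by (intro mult_left_mono) auto
    also have "\<dots> = - (G i ^ (m - 1) * (D i - e))" by (rule mult_minus_right)
    also have "\<dots> \<le> - D (Suc i)" using 1 by (rule le_imp_neg_le)
    finally have 3: "e * (\<Prod>j\<in>{1..<Suc i}. G j ^ (m - 1)) \<le> - D (Suc i)" .
    have "D (Suc i) < 0" using order_trans [OF 1 2] e IH(1) by simp
    with 3 show ?case by blast
  qed
  thus ?thesis by (simp add: D_def G_def e_def)
qed

text \<open>The generations split at the first \<open>t\<close> with negative \<open>crit\<close>:
  \<open>nonneg_crit_growth\<close> applies before \<open>t\<close>, \<open>neg_crit_growth\<close>
  after it, and the single factor at \<open>t\<close> is bounded by \<open>B\<close>. The power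
  \<open>L ^ 5\<close> combines \<open>L ^ 2\<close> from the first phase with
  \<open>L ^ 3 = m - s1\<close> from the second. Truncation moves \<open>crit\<close> in the wrong
  direction for the second phase, hence the slack \<open>L ^ 3 / (2 * m)\<close>.\<close>

lemma growth_bound:
  fixes m :: nat and \<rho> :: real
  assumes m: "m \<ge> 2" and \<rho>: "\<rho> > 0"
  obtains C L0 where "C > 0" "0 < L0" "L0 \<le> 1/4" "C * L0 \<le> 1/2"
    "\<And>(L::real) U I B. \<lbrakk>0 < L; L \<le> L0; \<And>i k. coeff (U i) k \<ge> 0; \<And>i. coeff (U i) 0 \<le> 1;
       coeff (U 0) 1 \<ge> \<rho> * coeff (U 0) 0;
       \<And>i k. i < I \<Longrightarrow> k \<ge> 1 \<Longrightarrow> coeff (pCons 0 (U (Suc i))) k \<le> coeff (step_poly m (U i)) k;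
       \<And>i. i < I \<Longrightarrow> crit (pCons 0 (U (Suc i))) (real m - L ^ 3) \<le>
            crit (step_poly m (U i)) (real m - L ^ 3) + L ^ 3 / (2 * m);
       B \<ge> 1; \<And>i. i \<le> I \<Longrightarrow> poly (pgf_poly (U i)) (real m - L ^ 3) \<le> B;
       \<And>i. i \<le> I \<Longrightarrow> - crit (pCons 0 (U i)) (real m - L ^ 3) \<le> B\<rbrakk>
     \<Longrightarrow> (1 - C * L) ^ I * (\<Prod>i<I. poly (pgf_poly (U i)) (real m - L) ^ (m - 1)) \<le> C * (2 * m) / L ^ 5 * B ^ m"
proof -
  from nonneg_crit_growth [OF m \<rho>] obtain C L0 where C: "C > 0" "0 < L0" "L0 \<le> 1/4" "C * L0 \<le> 1/2" and
    A: "\<And>(L::real) U I. \<lbrakk>0 < L; L \<le> L0; \<And>i k. coeff (U i) k \<ge> 0; \<And>i. coeff (U i) 0 \<le> 1;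
       coeff (U 0) 1 \<ge> \<rho> * coeff (U 0) 0;
       \<And>i. i < I \<Longrightarrow> crit (pCons 0 (U i)) (real m - L ^ 3) \<ge> 0;
       \<And>i. i < I \<Longrightarrow> tangent m (pCons 0 (U (Suc i))) (real m - L) \<ge> tangent m (step_poly m (U i)) (real m - L)\<rbrakk>
     \<Longrightarrow> (1 - C * L) ^ I * L\<^sup>2 * (\<Prod>i<I. poly (pgf_poly (U i)) (real m - L) ^ (m - 1)) \<le> C"
    by metis
  show ?thesis
  proof (rule that [OF C])
    fix L B :: real and U :: "nat \<Rightarrow> real poly" and I :: nat
    assume L: "0 < L" "L \<le> L0" and U: "\<And>i k. coeff (U i) k \<ge> 0" "\<And>i. coeff (U i) 0 \<le> 1"
      and U0: "coeff (U 0) 1 \<ge> \<rho> * coeff (U 0) 0"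
      and trunc: "\<And>i k. i < I \<Longrightarrow> k \<ge> 1 \<Longrightarrow> coeff (pCons 0 (U (Suc i))) k \<le> coeff (step_poly m (U i)) k"
      and step: "\<And>i. i < I \<Longrightarrow> crit (pCons 0 (U (Suc i))) (real m - L ^ 3) \<le>
            crit (step_poly m (U i)) (real m - L ^ 3) + L ^ 3 / (2 * m)"
      and B: "B \<ge> 1" "\<And>i. i \<le> I \<Longrightarrow> poly (pgf_poly (U i)) (real m - L ^ 3) \<le> B"
        "\<And>i. i \<le> I \<Longrightarrow> - crit (pCons 0 (U i)) (real m - L ^ 3) \<le> B"
    define s where "s = real m - L"
    define s1 where "s1 = real m - L ^ 3"
    define D where "D = (\<lambda>i. crit (pCons 0 (U i)) s1)"
    define G where "G = (\<lambda>i. poly (pgf_poly (U i)) s)"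
    have L1: "L \<le> 1/4" using L C by simp
    have L3: "L ^ 3 \<le> L" "0 < L ^ 3" using L L1 power_decreasing [of 1 3 L] by auto
    have "C * L \<le> C * L0" using L C by (intro mult_left_mono) auto
    hence "C * L \<le> 1/2" using C(4) by linarith
    moreover have "0 \<le> C * L" using L C by simp
    ultimately have CL: "0 \<le> C * L" "C * L \<le> 1/2" by simp_all
    have s: "7/4 \<le> s" "s \<le> s1" "s1 < m" "s \<le> m" using L1 L3 m L by (auto simp: s_def s1_def)
    have ms: "real m \<le> s\<^sup>2" unfolding s_def using m L L1 by (intro le_square_diff) auto
    have G1: "G i \<ge> 1" for i
      using pgf_ge_1 [of "U i" s] U s by (auto simp: G_def intro: order_trans [rotated])
    have Gle: "G i \<le> poly (pgf_poly (U i)) s1" for i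
    proof -
      have "poly (U i) s \<le> poly (U i) s1"
        unfolding poly_altdef using s U by (intro sum_mono mult_left_mono power_mono) auto
      thus ?thesis unfolding G_def poly_pgf_poly using s U
        by (intro add_left_mono mult_mono poly_nonneg) auto
    qed
    have PA: "(1 - C * L) ^ i * L\<^sup>2 * (\<Prod>j<i. G j ^ (m - 1)) \<le> C" if "i \<le> I" "\<And>j. j < i \<Longrightarrow> D j \<ge> 0" for i
      unfolding G_def s_def using that
    proof (intro A L U U0)
      fix j assume "j < i"
      thus "tangent m (pCons 0 (U (Suc j))) (real m - L) \<ge> tangent m (step_poly m (U j)) (real m - L)"
        using trunc [of j] that(1) s ms by (intro tangent_antimono) (auto simp: s_def)
    qed (auto simp: D_def s1_def)
    show "(1 - C * L) ^ I * (\<Prod>i<I. poly (pgf_poly (U i)) (real m - L) ^ (m - 1)) \<le> C * (2 * m) / L ^ 5 * B ^ m"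
    proof (cases "\<exists>j<I. D j < 0")
      case False
      hence "(1 - C * L) ^ I * (\<Prod>j<I. G j ^ (m - 1)) \<le> C / L\<^sup>2" using PA [of I] L by (force simp: field_simps)
      also have "\<dots> = C / L ^ 5 * L ^ 3" using L by (simp add: field_simps flip: power_add)
      also have "\<dots> \<le> C / L ^ 5 * (2 * m * B ^ m)"
      proof (rule mult_left_mono)
        have "L ^ 3 \<le> 1 * 1" using L3 L1 by simp
        also have "\<dots> \<le> 2 * m * B ^ m" using m B by (intro mult_mono one_le_power) auto
        finally show "L ^ 3 \<le> 2 * m * B ^ m" .
      qed (use C L in auto)
      finally show ?thesis by (simp add: G_def s_def)
    next
      case True
      define t where "t = (LEAST j. j < I \<and> D j < 0)"
      have t: "t < I" "D t < 0" using LeastI_ex [OF True] by (auto simp: t_def)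
      have tl: "D j \<ge> 0" if "j < t" for j
        using that not_less_Least [of j "\<lambda>j. j < I \<and> D j < 0"] t by (auto simp: t_def)
      have P1: "(1 - C * L) ^ t * L\<^sup>2 * (\<Prod>j<t. G j ^ (m - 1)) \<le> C" using PA t tl by auto
      have P2: "G t ^ (m - 1) \<le> B ^ (m - 1)"
        using order_trans [OF Gle B(2) [folded s1_def], of t] t G1 [of t] by (intro power_mono) (auto simp: s1_def)
      have "(m - s1) / (2 * m) * (\<Prod>j\<in>{1..<I-t}. poly (pgf_poly (U (t + j))) s1 ^ (m - 1)) \<le> - crit (pCons 0 (U (t + (I - t)))) s1"
        using m s U t step
        by (intro neg_crit_growth [where U = "\<lambda>j. U (t + j)" and I = "I - t"]) (auto simp: D_def s1_def)
      also have "\<dots> \<le> B" using t B(3) [of I] by (simp add: s1_def)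
      finally have "(\<Prod>j\<in>{1..<I-t}. poly (pgf_poly (U (t + j))) s1 ^ (m - 1)) \<le> 2 * m * B / L ^ 3"
        using L m by (simp add: s1_def field_simps)
      moreover have "(\<Prod>j\<in>{1..<I-t}. G (t + j) ^ (m - 1)) \<le> (\<Prod>j\<in>{1..<I-t}. poly (pgf_poly (U (t + j))) s1 ^ (m - 1))"
        using Gle G1 by (intro prod_mono conjI power_mono zero_le_power) (auto intro: order_trans [of 0 1])
      ultimately have P3: "(\<Prod>j\<in>{1..<I-t}. G (t + j) ^ (m - 1)) \<le> 2 * m * B / L ^ 3" by linarith
      have split: "(\<Prod>j<I. G j ^ (m - 1)) = (\<Prod>j<t. G j ^ (m - 1)) * (G t ^ (m - 1) * (\<Prod>j\<in>{1..<I-t}. G (t + j) ^ (m - 1)))"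
      proof -
        have "(\<Prod>j<I. G j ^ (m - 1)) = (\<Prod>j<t. G j ^ (m - 1)) * (\<Prod>j\<in>{t..<I}. G j ^ (m - 1))"
          using t by (subst prod.union_disjoint [symmetric]) (auto simp: ivl_disj_un lessThan_atLeast0 intro!: prod.cong)
        also have "(\<Prod>j\<in>{t..<I}. G j ^ (m - 1)) = (\<Prod>j\<in>{0..<I-t}. G (t + j) ^ (m - 1))"
          using t by (intro prod.reindex_bij_witness [of _ "\<lambda>j. t + j" "\<lambda>j. j - t"]) auto
        also have "{0..<I-t} = insert 0 {1..<I-t}" using t by auto
        finally show ?thesis by simp
      qed
      have prod0: "(\<Prod>j\<in>X. G (f j) ^ (m - 1)) \<ge> 0" for X and f :: "nat \<Rightarrow> nat"
        using G1 by (intro prod_nonneg) (auto intro: order_trans [of 0 1])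
      have "(1 - C * L) ^ I \<le> (1 - C * L) ^ t" using CL t by (intro power_decreasing) auto
      hence "(1 - C * L) ^ I * (\<Prod>j<I. G j ^ (m - 1)) \<le> (1 - C * L) ^ t * (\<Prod>j<I. G j ^ (m - 1))"
        using prod0 [of id] by (intro mult_right_mono) auto
      also have "\<dots> = ((1 - C * L) ^ t * (\<Prod>j<t. G j ^ (m - 1))) * (G t ^ (m - 1) * (\<Prod>j\<in>{1..<I-t}. G (t + j) ^ (m - 1)))"
        by (simp only: split mult.assoc)
      also have "\<dots> \<le> (C / L\<^sup>2) * (B ^ (m - 1) * (2 * m * B / L ^ 3))"
        using P1 P2 P3 L C B G1 [of t] CL prod0 [of "\<lambda>j. t + j"] prod0 [of "\<lambda>j. j"]
        by (intro mult_mono) (auto simp: field_simps intro!: mult_nonneg_nonneg)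
      also have "\<dots> = C * (2 * m) / L ^ 5 * B ^ m"
      proof -
        have "B ^ m = B ^ (m - 1) * B" using m by (cases m) auto
        thus ?thesis using L by (simp add: field_simps flip: power_add)
      qed
      finally show ?thesis by (simp add: G_def s_def)
    qed
  qed
qed

section \<open>The recursion for tail power series\<close>

unbundle no vec_syntax

definition pgf_fps :: "'a::comm_ring_1 fps \<Rightarrow> 'a fps" where
  "pgf_fps U = 1 + (fps_X - 1) * U"

definition fps_step :: "nat \<Rightarrow> 'a::comm_ring_1 fps \<Rightarrow> 'a fps" where
  "fps_step m U = fps_shift 1 (U * (\<Sum>l<m. pgf_fps U ^ l))"

text \<open>Polymorphic in the field so that one recursion serves both the true tails at real
  \<open>p\<close> and their continuation to complex \<open>p\<close>; formal power series avoid all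
  questions of convergence.\<close>

primrec tails :: "nat \<Rightarrow> (nat \<Rightarrow> real) \<Rightarrow> 'a::real_normed_field \<Rightarrow> nat \<Rightarrow> 'a fps" where
  "tails m \<tau> p 0 = fps_const p * Abs_fps (\<lambda>k. of_real (\<tau> k))"
| "tails m \<tau> p (Suc n) = fps_step m (tails m \<tau> p n)"

lemma pgf_fps_nth: "pgf_fps U $ k = (if k = 0 then 1 - U $ 0 else U $ (k - 1) - U $ k)"
  by (simp add: pgf_fps_def ring_distribs)

lemma sum_pgf_fps_nth: "(\<Sum>l\<le>k. pgf_fps U $ l) = 1 - U $ k"
  by (induction k) (auto simp: pgf_fps_nth)

lemma pgf_fps_power: "pgf_fps U ^ m = pgf_fps (U * (\<Sum>l<m. pgf_fps U ^ l))"
proof -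
  have "pgf_fps U ^ m - 1 = (pgf_fps U - 1) * (\<Sum>l<m. pgf_fps U ^ l)"
    by (rule power_diff_1_eq)
  thus ?thesis by (simp add: pgf_fps_def algebra_simps)
qed

lemma pgf_fps_step_nth:
  "pgf_fps (fps_step m U) $ k = (if k = 0 then (pgf_fps U ^ m) $ 0 + (pgf_fps U ^ m) $ 1 else (pgf_fps U ^ m) $ Suc k)"
  unfolding pgf_fps_power [of U m] by (auto simp: fps_step_def pgf_fps_nth)

lemma sum_pgf_fps_step: "(\<Sum>l\<le>k. pgf_fps (fps_step m U) $ l) = (\<Sum>l\<le>Suc k. (pgf_fps U ^ m) $ l)"
  unfolding pgf_fps_power [of U m] sum_pgf_fps_nth by (simp add: fps_step_def)

text \<open>Coefficient \<open>k\<close> of the next generation needs only the coefficients up to \<open>k + 1\<close> of the present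
  one, hence the norms may be truncated at a degree that decreases by one in each step.\<close>

definition tnorm :: "real \<Rightarrow> nat \<Rightarrow> 'a::real_normed_field fps \<Rightarrow> real" where
  "tnorm s K f = (\<Sum>k<K. norm (f $ k) * s ^ k)"

lemma tnorm_nonneg: "s \<ge> 0 \<Longrightarrow> tnorm s K f \<ge> 0"
  unfolding tnorm_def by (intro sum_nonneg) auto

lemma tnorm_mult:
  assumes s: "s \<ge> 0"
  shows "tnorm s K (f * g) \<le> tnorm s K f * tnorm s K g"
proof -
  have "tnorm s K (f * g) \<le> (\<Sum>k<K. \<Sum>i\<le>k. norm (f $ i) * s ^ i * (norm (g $ (k - i)) * s ^ (k - i)))"
    unfolding tnorm_def
  proof (intro sum_mono)
    fix k
    have "norm ((f * g) $ k) \<le> (\<Sum>i\<le>k. norm (f $ i) * norm (g $ (k - i)))"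
      unfolding fps_mult_nth atLeast0AtMost
      by (intro order_trans [OF norm_sum] sum_mono norm_mult_ineq)
    hence "norm ((f * g) $ k) * s ^ k \<le> (\<Sum>i\<le>k. norm (f $ i) * norm (g $ (k - i))) * s ^ k"
      using s by (intro mult_right_mono) auto
    also have "\<dots> = (\<Sum>i\<le>k. norm (f $ i) * s ^ i * (norm (g $ (k - i)) * s ^ (k - i)))"
      unfolding sum_distrib_right
    proof (intro sum.cong refl)
      fix i assume "i \<in> {..k}"
      hence "s ^ k = s ^ i * s ^ (k - i)" by (simp flip: power_add)
      thus "norm (f $ i) * norm (g $ (k - i)) * s ^ k = norm (f $ i) * s ^ i * (norm (g $ (k - i)) * s ^ (k - i))"
        by simp
    qed
    finally show "norm ((f * g) $ k) * s ^ k \<le> \<dots>" .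
  qed
  also have "\<dots> = (\<Sum>(i, j)\<in>{(i, j). i + j < K}. norm (f $ i) * s ^ i * (norm (g $ j) * s ^ j))"
    by (rule sum.triangle_reindex [symmetric])
  also have "\<dots> \<le> (\<Sum>(i, j)\<in>{..<K} \<times> {..<K}. norm (f $ i) * s ^ i * (norm (g $ j) * s ^ j))"
    using s by (intro sum_mono2) auto
  also have "\<dots> = tnorm s K f * tnorm s K g"
    by (simp add: tnorm_def sum_product sum.cartesian_product)
  finally show ?thesis .
qed

lemma tnorm_add: "s \<ge> 0 \<Longrightarrow> tnorm s K (f + g) \<le> tnorm s K f + tnorm s K g"
  unfolding tnorm_def sum.distrib [symmetric] distrib_right [symmetric]
  by (intro sum_mono mult_right_mono) (auto intro: norm_triangle_ineq)

lemma tnorm_sum: "s \<ge> 0 \<Longrightarrow> tnorm s K (\<Sum>i\<in>A. f i) \<le> (\<Sum>i\<in>A. tnorm s K (f i))"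
proof (induction A rule: infinite_finite_induct)
  case (insert x F)
  thus ?case using tnorm_add [of s K "f x" "\<Sum>i\<in>F. f i"] by auto
qed (auto simp: tnorm_def)

lemma tnorm_1: "s \<ge> 0 \<Longrightarrow> tnorm s K 1 \<le> 1"
  unfolding tnorm_def by (cases K) (auto simp: lessThan_Suc_eq_insert_0 sum.reindex)

lemma tnorm_power: "s \<ge> 0 \<Longrightarrow> tnorm s K (f ^ n) \<le> tnorm s K f ^ n"
proof (induction n)
  case 0
  thus ?case using tnorm_1 by simp
next
  case (Suc n)
  have "tnorm s K (f * f ^ n) \<le> tnorm s K f * tnorm s K (f ^ n)"
    using Suc by (intro tnorm_mult) auto
  also have "\<dots> \<le> tnorm s K f * tnorm s K f ^ n"
    using Suc by (intro mult_left_mono tnorm_nonneg) auto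
  finally show ?case by simp
qed

lemma tnorm_X_minus_1: "s \<ge> 0 \<Longrightarrow> tnorm s K (fps_X - 1 :: 'a::real_normed_field fps) \<le> s + 1"
proof -
  assume s: "s \<ge> 0"
  have "tnorm s K (fps_X - 1 :: 'a fps) \<le> tnorm s (Suc (Suc K)) (fps_X - 1 :: 'a fps)"
    unfolding tnorm_def using s by (intro sum_mono2) auto
  also have "\<dots> = (\<Sum>k\<in>{0,1}. norm ((fps_X - 1 :: 'a fps) $ k) * s ^ k)"
    unfolding tnorm_def by (intro sum.mono_neutral_right) auto
  also have "\<dots> = s + 1" by simp
  finally show ?thesis .
qed

text \<open>Source of the factor \<open>1 / s\<close> in the growth per step; it costs one degree of
  truncation.\<close>

lemma tnorm_shift: "s \<ge> 0 \<Longrightarrow> s * tnorm s K (fps_shift 1 f) \<le> tnorm s (Suc K) f"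
  unfolding tnorm_def sum_distrib_left by (subst sum.lessThan_Suc_shift) (simp add: mult_ac)

lemma tnorm_mono: "0 \<le> s \<Longrightarrow> s \<le> t \<Longrightarrow> K \<le> L \<Longrightarrow> tnorm s K f \<le> tnorm t L f"
  unfolding tnorm_def
  by (rule order_trans [OF sum_mono [where g = "\<lambda>k. norm (f $ k) * t ^ k"] sum_mono2])
     (auto intro!: mult_left_mono power_mono)

text \<open>Factor the difference of m-th powers and cancel \<open>fps_X - 1\<close>, as power
  series over a field have no zero divisors. Nothing is divided by \<open>s - 1\<close>, so the
  resulting norm bound also works at radius 1.\<close>

lemma fps_step_diff:
  fixes U B :: "'a::field fps"
  shows "fps_step m (U + B) - fps_step m U =
    fps_shift 1 (B * (\<Sum>l<m. pgf_fps U ^ (m - Suc l) * (pgf_fps U + (fps_X - 1) * B) ^ l))"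
proof -
  define V where "V = (\<lambda>U::'a fps. U * (\<Sum>l<m. pgf_fps U ^ l))"
  have V: "(fps_X - 1) * V U = pgf_fps U ^ m - 1" for U
    using pgf_fps_power [of U m] by (simp add: V_def pgf_fps_def)
  have G: "pgf_fps (U + B) = pgf_fps U + (fps_X - 1) * B" by (simp add: pgf_fps_def algebra_simps)
  have "(fps_X - 1) * (V (U + B) - V U) = pgf_fps (U + B) ^ m - pgf_fps U ^ m"
    unfolding right_diff_distrib V by simp
  also have "\<dots> = (pgf_fps (U + B) - pgf_fps U) * (\<Sum>l<m. pgf_fps U ^ (m - Suc l) * pgf_fps (U + B) ^ l)"
    by (rule power_diff_sumr2)
  also have "\<dots> = (fps_X - 1) * (B * (\<Sum>l<m. pgf_fps U ^ (m - Suc l) * (pgf_fps U + (fps_X - 1) * B) ^ l))"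
    unfolding G by simp
  finally have "(fps_X - 1) * (V (U + B) - V U) = \<dots>" .
  moreover have "(fps_X - 1 :: 'a fps) \<noteq> 0"
  proof
    assume "(fps_X - 1 :: 'a fps) = 0"
    hence "(fps_X - 1 :: 'a fps) $ 0 = 0 $ 0" by (rule arg_cong)
    thus False by simp
  qed
  ultimately have "V (U + B) - V U = B * (\<Sum>l<m. pgf_fps U ^ (m - Suc l) * (pgf_fps U + (fps_X - 1) * B) ^ l)"
    by simp
  thus ?thesis by (simp add: fps_step_def V_def flip: fps_shift_diff)
qed

lemma tnorm_step_diff:
  fixes U B :: "'a::real_normed_field fps"
  assumes s: "s > 0" and G: "tnorm s (Suc K) (pgf_fps U) \<le> \<gamma>" and B: "tnorm s (Suc K) B \<le> b" and m: "m \<ge> 1"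
  shows "tnorm s K (fps_step m (U + B) - fps_step m U) \<le> m / s * b * (\<gamma> + (s + 1) * b) ^ (m - 1)"
proof -
  let ?n = "tnorm s (Suc K)"
  have b0: "b \<ge> 0" "\<gamma> \<ge> 0" using B G tnorm_nonneg [of s "Suc K"] s by (meson less_imp_le order_trans)+
  have G': "?n (pgf_fps U + (fps_X - 1) * B) \<le> \<gamma> + (s + 1) * b"
  proof -
    have "?n ((fps_X - 1) * B) \<le> ?n (fps_X - 1 :: 'a fps) * ?n B" using s by (intro tnorm_mult) auto
    also have "\<dots> \<le> (s + 1) * b"
      using s B by (intro mult_mono tnorm_X_minus_1 tnorm_nonneg) auto
    finally show ?thesis using tnorm_add [of s "Suc K" "pgf_fps U" "(fps_X - 1) * B"] G s by linarith
  qed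
  have "s * tnorm s K (fps_step m (U + B) - fps_step m U) \<le>
      ?n (B * (\<Sum>l<m. pgf_fps U ^ (m - Suc l) * (pgf_fps U + (fps_X - 1) * B) ^ l))"
    unfolding fps_step_diff using s by (intro tnorm_shift) auto
  also have "\<dots> \<le> ?n B * (\<Sum>l<m. ?n (pgf_fps U ^ (m - Suc l) * (pgf_fps U + (fps_X - 1) * B) ^ l))"
    using s by (intro order_trans [OF tnorm_mult] mult_left_mono tnorm_sum tnorm_nonneg) auto
  also have "\<dots> \<le> b * (\<Sum>l<m. (\<gamma> + (s + 1) * b) ^ (m - 1))"
  proof (intro mult_mono sum_mono)
    fix l assume l: "l \<in> {..<m}"
    have "?n (pgf_fps U ^ (m - Suc l) * (pgf_fps U + (fps_X - 1) * B) ^ l) \<le>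
       ?n (pgf_fps U ^ (m - Suc l)) * ?n ((pgf_fps U + (fps_X - 1) * B) ^ l)"
      using s by (intro tnorm_mult) auto
    also have "\<dots> \<le> (\<gamma> + (s + 1) * b) ^ (m - Suc l) * (\<gamma> + (s + 1) * b) ^ l"
    proof (intro mult_mono)
      show "?n (pgf_fps U ^ (m - Suc l)) \<le> (\<gamma> + (s + 1) * b) ^ (m - Suc l)"
        using s G b0 by (intro order_trans [OF tnorm_power power_mono] tnorm_nonneg) (auto intro: add_increasing2)
      show "?n ((pgf_fps U + (fps_X - 1) * B) ^ l) \<le> (\<gamma> + (s + 1) * b) ^ l"
        using s G' by (intro order_trans [OF tnorm_power power_mono] tnorm_nonneg) auto
    qed (use s b0 in \<open>auto intro!: tnorm_nonneg\<close>)
    also have "\<dots> = (\<gamma> + (s + 1) * b) ^ (m - 1)"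
      using l by (simp flip: power_add)
    finally show "?n (pgf_fps U ^ (m - Suc l) * (pgf_fps U + (fps_X - 1) * B) ^ l) \<le> \<dots>" .
  qed (use B b0 s in \<open>auto intro!: sum_nonneg tnorm_nonneg\<close>)
  finally show ?thesis using s by (simp add: field_simps)
qed

section \<open>Probability laws: nonnegative coefficients and majorization\<close>

definition fps_nonneg :: "real fps \<Rightarrow> bool" where
  "fps_nonneg f \<longleftrightarrow> (\<forall>k. f $ k \<ge> 0)"

lemma fps_nonneg_mult: "fps_nonneg f \<Longrightarrow> fps_nonneg g \<Longrightarrow> fps_nonneg (f * g)"
  unfolding fps_nonneg_def fps_mult_nth by (auto intro!: sum_nonneg)

lemma fps_nonneg_power: "fps_nonneg f \<Longrightarrow> fps_nonneg (f ^ n)"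
  by (induction n) (auto simp: fps_nonneg_mult, auto simp: fps_nonneg_def)

lemma fps_nonneg_sum: "(\<And>i. i \<in> A \<Longrightarrow> fps_nonneg (f i)) \<Longrightarrow> fps_nonneg (\<Sum>i\<in>A. f i)"
  unfolding fps_nonneg_def by (auto simp: fps_sum_nth intro!: sum_nonneg)

lemma fps_nonneg_step:
  assumes "fps_nonneg U" "fps_nonneg (pgf_fps U)"
  shows "fps_nonneg (fps_step m U)" "fps_nonneg (pgf_fps (fps_step m U))"
proof -
  have "fps_nonneg (U * (\<Sum>l<m. pgf_fps U ^ l))"
    using assms by (intro fps_nonneg_mult fps_nonneg_sum fps_nonneg_power)
  thus "fps_nonneg (fps_step m U)" by (simp add: fps_nonneg_def fps_step_def)
  show "fps_nonneg (pgf_fps (fps_step m U))"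
    using fps_nonneg_power [OF assms(2), of m] by (auto simp: fps_nonneg_def pgf_fps_step_nth)
qed

lemma tnorm_1_nonneg: "fps_nonneg f \<Longrightarrow> tnorm 1 (Suc k) f = (\<Sum>l\<le>k. f $ l)"
  by (simp add: tnorm_def fps_nonneg_def lessThan_Suc_atMost)

text \<open>A sum of \<open>m\<close> copies is at most \<open>k + 1\<close> only if every copy is;
  submultiplicativity of the norm at radius 1 expresses this.\<close>

lemma fps_step_nth_ge:
  assumes "fps_nonneg (pgf_fps U)"
  shows "1 - fps_step m U $ k \<le> (1 - U $ Suc k) ^ m"
proof -
  have "1 - fps_step m U $ k = (\<Sum>l\<le>Suc k. (pgf_fps U ^ m) $ l)"
    unfolding sum_pgf_fps_nth [symmetric] sum_pgf_fps_step ..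
  also have "\<dots> = tnorm 1 (Suc (Suc k)) (pgf_fps U ^ m)"
    using assms by (intro tnorm_1_nonneg [symmetric] fps_nonneg_power)
  also have "\<dots> \<le> tnorm 1 (Suc (Suc k)) (pgf_fps U) ^ m" by (intro tnorm_power) auto
  also have "\<dots> = (1 - U $ Suc k) ^ m"
    unfolding tnorm_1_nonneg [OF assms] sum_pgf_fps_nth ..
  finally show ?thesis .
qed

lemma fps_power_nth_1: "(f ^ n) $ Suc 0 = of_nat n * (f $ 0) ^ (n - 1) * (f $ Suc 0 :: 'a::comm_ring_1)"
proof (induction n)
  case (Suc n)
  have "(f ^ Suc n) $ Suc 0 = f $ 0 * (f ^ n) $ Suc 0 + f $ Suc 0 * (f $ 0) ^ n"
    by (simp add: fps_mult_nth fps_power_zeroth)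
  also have "f $ 0 * (f ^ n) $ Suc 0 = of_nat n * (f $ 0) ^ n * f $ Suc 0"
    unfolding Suc by (cases n) (auto simp: mult_ac)
  finally show ?case by (simp add: algebra_simps)
qed auto

text \<open>With at least two copies, a sum of at most 1 forces some copy to vanish.\<close>

lemma fps_step_nth_0_le:
  assumes "fps_nonneg (pgf_fps U)" "fps_nonneg U" and m: "m \<ge> 2"
  shows "1 - fps_step m U $ 0 \<le> m * (1 - U $ 0)"
proof -
  let ?G = "pgf_fps U"
  obtain k where k: "m = Suc (Suc k)" using m by (metis add_2_eq_Suc le_Suc_ex)
  have nn: "?G $ 0 \<ge> 0" "?G $ 1 \<ge> 0" using assms by (auto simp: fps_nonneg_def)
  have s: "?G $ 0 + ?G $ 1 \<le> 1" using assms by (auto simp: fps_nonneg_def pgf_fps_nth)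
  have "1 - fps_step m U $ 0 = (?G ^ m) $ 0 + (?G ^ m) $ 1"
    using sum_pgf_fps_nth [of "fps_step m U" 0] sum_pgf_fps_step [of m U 0] by simp
  also have "\<dots> = (?G $ 0) ^ Suc k * (?G $ 0 + m * ?G $ 1)"
    unfolding k by (simp add: fps_power_nth_1 fps_power_zeroth algebra_simps del: power_Suc) (simp add: algebra_simps)
  also have "\<dots> \<le> ?G $ 0 * m"
  proof (intro mult_mono)
    have "?G $ 0 * (?G $ 0) ^ k \<le> ?G $ 0 * 1" using nn s by (intro mult_left_mono power_le_one) auto
    thus "(?G $ 0) ^ Suc k \<le> ?G $ 0" by simp
    have "?G $ 0 + m * ?G $ 1 \<le> m * (?G $ 0 + ?G $ 1)" using nn m by (simp add: algebra_simps mult_le_cancel_right1)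
    also have "\<dots> \<le> real m * 1" using s by (intro mult_left_mono) auto
    finally show "?G $ 0 + m * ?G $ 1 \<le> m" by simp
  qed (use nn in auto)
  finally show ?thesis by (simp add: pgf_fps_nth mult.commute)
qed

definition majorized :: "'a::real_normed_field fps \<Rightarrow> real fps \<Rightarrow> bool" where
  "majorized f g \<longleftrightarrow> (\<forall>k. norm (f $ k) \<le> g $ k)"

lemma majorized_mult: "majorized f f' \<Longrightarrow> majorized g g' \<Longrightarrow> majorized (f * g) (f' * g')"
  unfolding majorized_def fps_mult_nth
proof safe
  fix k
  assume *: "\<forall>k. norm (f $ k) \<le> f' $ k" "\<forall>k. norm (g $ k) \<le> g' $ k"
  have "norm (\<Sum>i = 0..k. f $ i * g $ (k - i)) \<le> (\<Sum>i = 0..k. norm (f $ i) * norm (g $ (k - i)))"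
    by (intro order_trans [OF norm_sum] sum_mono norm_mult_ineq)
  also have "\<dots> \<le> (\<Sum>i = 0..k. f' $ i * g' $ (k - i))"
    using * by (intro sum_mono mult_mono) (auto intro: order_trans [OF norm_ge_zero])
  finally show "norm (\<Sum>i = 0..k. f $ i * g $ (k - i)) \<le> \<dots>" .
qed

lemma majorized_power: "majorized f g \<Longrightarrow> majorized (f ^ n) (g ^ n)"
  by (induction n) (auto simp: majorized_mult, auto simp: majorized_def)

lemma majorized_pgf_step:
  assumes "majorized (pgf_fps U) (fps_const c * pgf_fps U')"
  shows "majorized (pgf_fps (fps_step m U)) (fps_const (c ^ m) * pgf_fps (fps_step m U'))"
proof -
  have "majorized (pgf_fps U ^ m) (fps_const (c ^ m) * pgf_fps U' ^ m)"
    using majorized_power [OF assms, of m] by (simp add: power_mult_distrib fps_const_power)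
  thus ?thesis
    unfolding majorized_def pgf_fps_step_nth fps_mult_left_const_nth
    by (auto simp: distrib_left intro: order_trans [OF norm_triangle_ineq add_mono])
qed

section \<open>Truncation of tail series to polynomials\<close>

definition fps_trunc :: "nat \<Rightarrow> real fps \<Rightarrow> real poly" where
  "fps_trunc K f = (\<Sum>k<K. monom (f $ k) k)"

lemma coeff_fps_trunc: "coeff (fps_trunc K f) k = (if k < K then f $ k else 0)"
  by (simp add: fps_trunc_def coeff_sum sum.delta' if_distrib cong: if_cong)

lemma fps_of_poly_pgf: "fps_of_poly (pgf_poly P) = pgf_fps (fps_of_poly P)"
proof -
  have "fps_of_poly [:-1, 1::real:] = fps_X - 1"
    by (intro fps_ext) (auto simp: coeff_pCons split: nat.split)
  thus ?thesis
    by (simp add: pgf_poly_def pgf_fps_def fps_of_poly_add fps_of_poly_mult del: mult_pCons_left)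
qed

lemma fps_of_poly_step: "fps_of_poly (step_poly m P) = fps_of_poly P * (\<Sum>l<m. pgf_fps (fps_of_poly P) ^ l)"
  by (simp add: step_poly_def fps_of_poly_mult fps_of_poly_sum fps_of_poly_power fps_of_poly_pgf)

definition fps_agree :: "nat \<Rightarrow> 'a fps \<Rightarrow> 'a fps \<Rightarrow> bool" where
  "fps_agree K f g \<longleftrightarrow> (\<forall>k<K. f $ k = g $ k)"

lemma fps_agree_refl: "fps_agree K f f"
  by (simp add: fps_agree_def)

lemma fps_agree_mult: "fps_agree K f f' \<Longrightarrow> fps_agree K g g' \<Longrightarrow> fps_agree K (f * g) (f' * g' :: 'a::comm_ring_1 fps)"
  by (auto simp: fps_agree_def fps_mult_nth intro!: sum.cong)

lemma fps_agree_power: "fps_agree K f g \<Longrightarrow> fps_agree K (f ^ n) (g ^ n :: 'a::comm_ring_1 fps)"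
  by (induction n) (auto simp: fps_agree_mult fps_agree_refl)

lemma fps_agree_sum: "(\<And>i. i \<in> A \<Longrightarrow> fps_agree K (f i) (g i)) \<Longrightarrow> fps_agree K (\<Sum>i\<in>A. f i) (\<Sum>i\<in>A. g i :: 'a::comm_ring_1 fps)"
  by (auto simp: fps_agree_def fps_sum_nth)

lemma fps_agree_pgf: "fps_agree K f g \<Longrightarrow> fps_agree K (pgf_fps f) (pgf_fps g)"
  by (auto simp: fps_agree_def pgf_fps_nth)

lemma fps_agree_trunc: "fps_agree K (fps_of_poly (fps_trunc K f)) f"
  by (simp add: fps_agree_def coeff_fps_trunc)

lemma coeff_step_poly_trunc:
  assumes "Suc k < K"
  shows "coeff (step_poly m (fps_trunc K U)) (Suc k) = fps_step m U $ k"
proof -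
  have "fps_agree K (fps_of_poly (step_poly m (fps_trunc K U))) (U * (\<Sum>l<m. pgf_fps U ^ l))"
    unfolding fps_of_poly_step
    by (intro fps_agree_mult fps_agree_sum fps_agree_power fps_agree_pgf fps_agree_trunc)
  thus ?thesis using assms by (auto simp: fps_agree_def fps_step_def)
qed

text \<open>Cutting the tails off at \<open>K\<close> replaces the variable by its minimum with
  \<open>K\<close>, so the result is again a probability law.\<close>

lemma trunc_pgf_nonneg:
  assumes "fps_nonneg U" "fps_nonneg (pgf_fps U)"
  shows "fps_nonneg (pgf_fps (fps_of_poly (fps_trunc K U)))" "fps_nonneg (fps_of_poly (fps_trunc K U))"
proof -
  show "fps_nonneg (pgf_fps (fps_of_poly (fps_trunc K U)))"
    unfolding fps_nonneg_def
  proof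
    fix k
    have "U $ (k - 1) \<ge> 0" "pgf_fps U $ k \<ge> 0" using assms by (auto simp: fps_nonneg_def)
    thus "pgf_fps (fps_of_poly (fps_trunc K U)) $ k \<ge> 0"
      by (auto simp: pgf_fps_nth coeff_fps_trunc split: if_splits)
  qed
  show "fps_nonneg (fps_of_poly (fps_trunc K U))"
    using assms by (auto simp: fps_nonneg_def coeff_fps_trunc)
qed

lemma coeff_step_poly_nonneg:
  assumes "fps_nonneg U" "fps_nonneg (pgf_fps U)"
  shows "coeff (step_poly m (fps_trunc K U)) k \<ge> 0"
proof -
  have "fps_nonneg (fps_of_poly (step_poly m (fps_trunc K U)))"
    unfolding fps_of_poly_step
    by (intro fps_nonneg_mult fps_nonneg_sum fps_nonneg_power trunc_pgf_nonneg assms)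
  thus ?thesis by (simp add: fps_nonneg_def)
qed

lemma poly_eq_sum:
  fixes p :: "real poly"
  shows "degree p \<le> N \<Longrightarrow> poly p x = (\<Sum>k\<le>N. coeff p k * x ^ k)"
  unfolding poly_altdef by (intro sum.mono_neutral_left) (auto simp: coeff_eq_0)

lemma tnorm_pgf_le:
  assumes "fps_nonneg U" "fps_nonneg (pgf_fps U)" "s \<ge> 0"
  shows "tnorm s K (pgf_fps U) \<le> poly (pgf_poly (fps_trunc K U)) s"
proof -
  let ?P = "pgf_poly (fps_trunc K U)"
  have P: "coeff ?P k = pgf_fps (fps_of_poly (fps_trunc K U)) $ k" for k
    by (simp flip: fps_of_poly_pgf)
  have nn: "coeff ?P k \<ge> 0" for k
    unfolding P using trunc_pgf_nonneg(1) [OF assms(1,2)] by (simp add: fps_nonneg_def)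
  have "tnorm s K (pgf_fps U) = (\<Sum>k<K. coeff ?P k * s ^ k)"
    unfolding tnorm_def
  proof (intro sum.cong refl)
    fix k assume "k \<in> {..<K}"
    hence "coeff ?P k = pgf_fps U $ k" unfolding P by (auto simp: pgf_fps_nth coeff_fps_trunc)
    thus "norm (pgf_fps U $ k) * s ^ k = coeff ?P k * s ^ k" using nn [of k] by simp
  qed
  also have "\<dots> \<le> (\<Sum>k\<le>K + degree ?P. coeff ?P k * s ^ k)"
    using nn assms by (intro sum_mono2) auto
  also have "\<dots> = poly ?P s" by (rule poly_eq_sum [symmetric]) auto
  finally show ?thesis .
qed

definition fps_of_real_rel :: "'a::real_normed_field fps \<Rightarrow> real fps \<Rightarrow> bool" where
  "fps_of_real_rel f g \<longleftrightarrow> (\<forall>k. f $ k = of_real (g $ k))"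

lemma fps_of_real_rel_mult: "fps_of_real_rel f f' \<Longrightarrow> fps_of_real_rel g g' \<Longrightarrow> fps_of_real_rel (f * g) (f' * g')"
  by (simp add: fps_of_real_rel_def fps_mult_nth)

lemma fps_of_real_rel_power: "fps_of_real_rel f g \<Longrightarrow> fps_of_real_rel (f ^ n) (g ^ n)"
  by (induction n) (auto simp: fps_of_real_rel_mult, auto simp: fps_of_real_rel_def)

lemma fps_of_real_rel_sum:
  "(\<And>i. i \<in> A \<Longrightarrow> fps_of_real_rel (f i) (g i)) \<Longrightarrow> fps_of_real_rel (\<Sum>i\<in>A. f i) (\<Sum>i\<in>A. g i)"
  by (auto simp: fps_of_real_rel_def fps_sum_nth)

lemma fps_of_real_rel_pgf: "fps_of_real_rel f g \<Longrightarrow> fps_of_real_rel (pgf_fps f) (pgf_fps g)"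
  by (auto simp: fps_of_real_rel_def pgf_fps_nth)

lemma tails_of_real: "tails m \<tau> (of_real p :: 'a::real_normed_field) n $ k = of_real (tails m \<tau> p n $ k)"
proof -
  have "fps_of_real_rel (tails m \<tau> (of_real p :: 'a) n) (tails m \<tau> p n)"
  proof (induction n)
    case (Suc n)
    have "fps_of_real_rel (tails m \<tau> (of_real p :: 'a) n * (\<Sum>l<m. pgf_fps (tails m \<tau> (of_real p :: 'a) n) ^ l))
        (tails m \<tau> p n * (\<Sum>l<m. pgf_fps (tails m \<tau> p n) ^ l))"
      using Suc by (intro fps_of_real_rel_mult fps_of_real_rel_sum fps_of_real_rel_power fps_of_real_rel_pgf)
    thus ?case by (simp add: fps_step_def fps_of_real_rel_def)
  qed (simp add: fps_of_real_rel_def)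
  thus ?thesis by (simp add: fps_of_real_rel_def)
qed

text \<open>\<open>\<tau> k\<close> is P(X0* > k), so \<open>tau1\<close> is the hypothesis P(X0* >=
  2) > 0; it supplies the constant \<open>\<rho>\<close> of \<open>growth_bound\<close>.\<close>

locale dr =
  fixes m :: nat and \<tau> :: "nat \<Rightarrow> real"
  assumes m: "m \<ge> 2" and tau0: "\<tau> 0 = 1" and tau_dec: "\<tau> (Suc k) \<le> \<tau> k" and tau_nonneg: "\<tau> k \<ge> 0"
    and tau1: "\<tau> 1 > 0" and tau_summable: "\<And>s::real. 0 \<le> s \<Longrightarrow> s < real m \<Longrightarrow> summable (\<lambda>k. \<tau> k * s ^ k)"
begin

abbreviation u :: "real \<Rightarrow> nat \<Rightarrow> real fps" where "u \<equiv> tails m \<tau>"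

lemma u_nonneg:
  assumes "0 \<le> p" "p \<le> 1"
  shows "fps_nonneg (u p n)" "fps_nonneg (pgf_fps (u p n))"
proof (induction n)
  case 0
  case 1
  show ?case using assms tau_nonneg by (auto simp: fps_nonneg_def)
next
  case 0
  case 2
  have "p * \<tau> k \<le> p * \<tau> (k - 1)" for k
    using assms tau_dec [of "k - 1"] by (cases k) (auto intro: mult_left_mono)
  thus ?case using assms tau0 by (auto simp: fps_nonneg_def pgf_fps_nth)
qed (auto intro: fps_nonneg_step)

lemma u_bounds:
  assumes "0 \<le> p" "p \<le> 1"
  shows "0 \<le> u p n $ k" "u p n $ k \<le> 1"
proof -
  have "1 - u p n $ k \<ge> 0"
    unfolding sum_pgf_fps_nth [symmetric] using u_nonneg(2) [OF assms] by (auto simp: fps_nonneg_def intro!: sum_nonneg)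
  thus "u p n $ k \<le> 1" by simp
qed (use u_nonneg(1) [OF assms] in \<open>auto simp: fps_nonneg_def\<close>)

lemma u_chain:
  assumes "0 \<le> p" "p \<le> 1"
  shows "1 - u p (i + k) $ l \<le> (1 - u p i $ (k + l)) ^ (m ^ k)"
proof (induction k arbitrary: l)
  case (Suc k)
  have "1 - u p (i + Suc k) $ l \<le> (1 - u p (i + k) $ Suc l) ^ m"
    using fps_step_nth_ge [OF u_nonneg(2) [OF assms]] by simp
  also have "\<dots> \<le> ((1 - u p i $ (k + Suc l)) ^ (m ^ k)) ^ m"
    using Suc [of "Suc l"] u_bounds [OF assms] by (intro power_mono) auto
  finally show ?case by (simp add: mult.commute flip: power_mult)
qed auto

lemma u_0_growth:
  assumes "0 \<le> p" "p \<le> 1"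
  shows "1 - u p (i + k) $ 0 \<le> real m ^ k * (1 - u p i $ 0)"
proof (induction k)
  case (Suc k)
  have "1 - u p (i + Suc k) $ 0 \<le> m * (1 - u p (i + k) $ 0)"
    using fps_step_nth_0_le [OF u_nonneg(2,1) [OF assms] m] by simp
  also have "\<dots> \<le> m * (real m ^ k * (1 - u p i $ 0))"
    using Suc by (intro mult_left_mono) auto
  finally show ?case by (simp add: mult_ac)
qed auto

text \<open>\<open>X\<close> at time \<open>i + k\<close> can only vanish if the \<open>m\<^sup>k\<close> copies at time \<open>i\<close> below it are all at most \<open>k\<close>.
  A lower bound on the probability of zero at time \<open>n\<close> therefore forces tails of order \<open>m\<^sup>-\<^sup>k\<close>.\<close>

lemma u_tail_bound:
  assumes p: "0 \<le> p" "p \<le> 1" and g: "exp (- E) \<le> 1 - u p n $ 0" and ik: "i + k \<le> n"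
  shows "real m ^ k * u p i $ k \<le> E + n * m"
proof -
  let ?t = "u p i $ k"
  have "exp (- E) \<le> real m ^ (n - (i + k)) * (1 - u p (i + k) $ 0)"
    using g u_0_growth [OF p, of "i + k" "n - (i + k)"] ik by simp
  also have "\<dots> \<le> exp (real m) ^ n * exp (- ?t) ^ (m ^ k)"
  proof (intro mult_mono)
    have "real m \<le> exp (real m)" using exp_ge_add_one_self [of "real m"] by linarith
    hence "real m ^ (n - (i + k)) \<le> exp (real m) ^ (n - (i + k))" by (intro power_mono) auto
    also have "\<dots> \<le> exp (real m) ^ n" by (intro power_increasing) auto
    finally show "real m ^ (n - (i + k)) \<le> exp (real m) ^ n" .
    have "1 - u p (i + k) $ 0 \<le> (1 - ?t) ^ (m ^ k)" using u_chain [OF p, of i k 0] by simp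
    also have "\<dots> \<le> exp (- ?t) ^ (m ^ k)"
      using u_bounds [OF p] exp_ge_add_one_self [of "- ?t"] by (intro power_mono) auto
    finally show "1 - u p (i + k) $ 0 \<le> exp (- ?t) ^ (m ^ k)" .
  qed (use u_bounds [OF p] in auto)
  also have "\<dots> = exp (n * m - real m ^ k * ?t)"
    by (simp add: exp_of_nat_mult [symmetric] exp_diff exp_minus field_simps flip: exp_of_nat_mult exp_add)
  finally show ?thesis by simp
qed

text \<open>In generation \<open>i\<close> the degrees up to \<open>n - i\<close> are those that can
  influence coefficient 0 of generation \<open>n\<close>, and those that \<open>u_tail_bound\<close>
  controls. The truncated tails can therefore be evaluated even at \<open>m\<close>.\<close>

definition w :: "real \<Rightarrow> nat \<Rightarrow> nat \<Rightarrow> real poly" where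
  "w p n i = fps_trunc (n + 1 - i) (u p i)"

lemma coeff_w: "coeff (w p n i) k = (if i + k \<le> n then u p i $ k else 0)"
  by (auto simp: w_def coeff_fps_trunc)

lemma coeff_w_step:
  assumes "i < n" "Suc (i + k) \<le> n"
  shows "coeff (step_poly m (w p n i)) (Suc k) = coeff (w p n (Suc i)) k"
  using coeff_step_poly_trunc [of k "n + 1 - i" m "u p i"] assms by (auto simp: w_def coeff_fps_trunc)

lemma coeff_w_step_le:
  assumes "0 \<le> p" "p \<le> 1" "i < n"
  shows "coeff (pCons 0 (w p n (Suc i))) k \<le> coeff (step_poly m (w p n i)) k"
proof (cases k)
  case 0
  thus ?thesis using coeff_step_poly_nonneg [OF u_nonneg [OF assms(1,2)]] by (simp add: w_def)
next
  case (Suc k')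
  have "coeff (step_poly m (w p n i)) k \<ge> 0"
    unfolding w_def by (intro coeff_step_poly_nonneg u_nonneg assms)
  thus ?thesis
    using coeff_w_step [OF assms(3), of k' p] Suc coeff_w [of p n "Suc i" k']
    by (cases "Suc (i + k') \<le> n") auto
qed

text \<open>By \<open>u_tail_bound\<close> each of the at most \<open>n + 1\<close> terms is at most
  \<open>E + n * m\<close>, even at radius \<open>m\<close>; the derivative costs one more factor
  \<open>n + 1\<close>.\<close>

lemma w_bounds:
  fixes x :: real
  assumes p: "0 \<le> p" "p \<le> 1" and g: "exp (- E) \<le> 1 - u p n $ 0" and E: "E \<ge> 0" and x: "1 \<le> x" "x \<le> m"
  defines "B \<equiv> (real m)\<^sup>2 * (real n + 1)\<^sup>2 * (E + n * m + 1)"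
  shows "poly (pgf_poly (w p n i)) x \<le> B" "- crit (pCons 0 (w p n i)) x \<le> B"
proof -
  define A where "A = E + n * m"
  have A: "A \<ge> 0" using E by (simp add: A_def)
  have le: "coeff (w p n i) k * x ^ k \<le> A" for k
  proof (cases "i + k \<le> n")
    case True
    have "coeff (w p n i) k * x ^ k \<le> coeff (w p n i) k * real m ^ k"
      using x u_bounds [OF p] by (intro mult_left_mono power_mono) (auto simp: coeff_w)
    also have "\<dots> \<le> A" using u_tail_bound [OF p g True] True by (simp add: coeff_w A_def mult.commute)
    finally show ?thesis .
  qed (use A in \<open>auto simp: coeff_w\<close>)
  have dw: "degree (w p n i) \<le> n" by (intro degree_le) (auto simp: coeff_w)
  have B: "B = (real m)\<^sup>2 * ((real n + 1)\<^sup>2 * A + (real n + 1)\<^sup>2)" by (simp add: B_def A_def algebra_simps)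
  have "poly (w p n i) x = (\<Sum>k\<le>n. coeff (w p n i) k * x ^ k)" by (rule poly_eq_sum [OF dw])
  also have "\<dots> \<le> (\<Sum>k\<le>n. A)" using le by (intro sum_mono)
  also have "\<dots> = (real n + 1) * A" by (simp add: algebra_simps)
  finally have "(x - 1) * poly (w p n i) x \<le> m * ((real n + 1) * A)"
    using x A u_bounds [OF p] by (intro mult_mono poly_nonneg) (auto simp: coeff_w)
  also have "m * ((real n + 1) * A) \<le> (real m)\<^sup>2 * ((real n + 1)\<^sup>2 * A)"
    using m A by (intro mult_mono mult_right_mono self_le_power) auto
  moreover have "1 * 1 \<le> (real m)\<^sup>2 * (real n + 1)\<^sup>2"
    using m by (intro mult_mono one_le_power) auto
  ultimately show "poly (pgf_poly (w p n i)) x \<le> B"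
    unfolding B poly_pgf_poly distrib_left by linarith
  have "(\<Sum>k\<le>n. coeff (w p n i) k * (real k + 1) * x ^ k) \<le> (\<Sum>k\<le>n. (real n + 1) * A)"
  proof (intro sum_mono)
    fix k assume "k \<in> {..n}"
    hence "(real k + 1) * (coeff (w p n i) k * x ^ k) \<le> (real n + 1) * A"
      using le x u_bounds [OF p] by (intro mult_mono) (auto simp: coeff_w)
    thus "coeff (w p n i) k * (real k + 1) * x ^ k \<le> (real n + 1) * A" by (simp add: mult_ac)
  qed
  also have "\<dots> = (real n + 1)\<^sup>2 * A" by (simp add: power2_eq_square algebra_simps)
  finally have "(x - 1)\<^sup>2 * poly (pderiv (pCons 0 (w p n i))) x \<le> (real m)\<^sup>2 * ((real n + 1)\<^sup>2 * A)"
    unfolding poly_pderiv_pCons_sum(1) [OF dw]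
    using x u_bounds [OF p] by (intro mult_mono power_mono) (auto simp: coeff_w intro!: sum_nonneg)
  also have "\<dots> \<le> B" unfolding B by (intro mult_left_mono) auto
  finally show "- crit (pCons 0 (w p n i)) x \<le> B" by (simp add: crit_def)
qed

end

section \<open>Perturbation of the parameter\<close>

text \<open>Write \<open>x / M\<close> as \<open>z ^ 2\<close>: one power \<open>z ^ k\<close>
  absorbs the linear factor \<open>k\<close>, the other is kept.\<close>

lemma times_power_bound:
  fixes x M :: real
  assumes "0 < x" "x < M"
  obtains C z where "C > 0" "0 < z" "z < 1" "\<And>k. real k * x ^ (k - 1) \<le> C * z ^ k * M ^ k"
proof -
  define z where "z = sqrt (x / M)"
  have z: "0 < z" "z < 1" "z\<^sup>2 * M = x" using assms by (auto simp: z_def real_less_lsqrt)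
  have "(\<lambda>n. of_nat n * z ^ n) \<longlonglongrightarrow> 0" using z by (intro powser_times_n_limit_0) auto
  hence "Bseq (\<lambda>n. real n * z ^ n)" by (intro convergent_imp_Bseq convergentI)
  then obtain K where K: "K > 0" "\<And>n. norm (real n * z ^ n) \<le> K" by (auto elim: BseqE)
  show ?thesis
  proof (rule that [of "K / x" z])
    fix k
    show "real k * x ^ (k - 1) \<le> K / x * z ^ k * M ^ k"
    proof (cases k)
      case (Suc j)
      have "real k * x ^ (k - 1) = (real k * z ^ k) * (z ^ k * M ^ k / x)"
      proof -
        have "x ^ k = z ^ k * (z ^ k * M ^ k)"
          unfolding z(3) [symmetric] by (simp add: power_mult_distrib power2_eq_square)
        moreover have "x ^ (k - 1) = x ^ k / x" using Suc assms by simp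
        ultimately show ?thesis by simp
      qed
      also have "\<dots> \<le> K * (z ^ k * M ^ k / x)"
        using K(2) [of k] z assms by (intro mult_right_mono) auto
      finally show ?thesis by (simp add: field_simps)
    qed (use K assms z in auto)
  qed (use K z assms in auto)
qed

text \<open>Bootstrapping: the growth rate is available only while \<open>x i \<le> \<beta>\<close>.
  As all factors are at least 1, the bound for the full product keeps every intermediate
  \<open>x i\<close> below \<open>\<beta>\<close>.\<close>

lemma perturbation_iteration:
  fixes x a :: "nat \<Rightarrow> real"
  assumes step: "\<And>i. i < n \<Longrightarrow> x i \<le> \<beta> \<Longrightarrow> x (Suc i) \<le> a i * x i"
    and a: "\<And>i. i < n \<Longrightarrow> a i \<ge> 1" and x: "x 0 \<le> x0" "x0 \<ge> 0" and le: "x0 * (\<Prod>i<n. a i) \<le> \<beta>" and i: "i \<le> n"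
  shows "x i \<le> x0 * (\<Prod>j<i. a j)"
  using i
proof (induction i)
  case (Suc i)
  have "(\<Prod>j<i. a j) \<le> (\<Prod>j<n. a j)"
    using Suc.prems a by (intro prod_mono2) (auto intro: order_trans [of 0 1])
  hence "x i \<le> \<beta>" using Suc x le mult_left_mono [of "\<Prod>j<i. a j" "\<Prod>j<n. a j" x0] by linarith
  hence "x (Suc i) \<le> a i * x i" using step Suc.prems by auto
  also have "\<dots> \<le> a i * (x0 * (\<Prod>j<i. a j))"
    using Suc a [of i] by (intro mult_left_mono) auto
  finally show ?case by (simp add: mult_ac)
qed (use x in auto)

context dr
begin

definition gf :: "real \<Rightarrow> nat \<Rightarrow> nat \<Rightarrow> real \<Rightarrow> real" where
  "gf p n i x = poly (pgf_poly (w p n i)) x"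

lemma gf_ge_1: "0 \<le> p \<Longrightarrow> p \<le> 1 \<Longrightarrow> 1 \<le> x \<Longrightarrow> gf p n i x \<ge> 1"
proof -
  assume p: "0 \<le> p" "p \<le> 1" and x: "1 \<le> x"
  have nonneg: "coeff (w p n i) k \<ge> 0" for k using u_bounds [OF p] by (simp add: coeff_w)
  have "1 \<le> 1 + (x - 1) * coeff (w p n i) 0" using nonneg x by simp
  also have "\<dots> \<le> gf p n i x" unfolding gf_def by (rule pgf_ge_1 [OF nonneg x])
  finally show ?thesis .
qed

text \<open>Truncation raises \<open>crit\<close>, so the error has to be estimated. The deleted
  part lives in degree 0, invisible to \<open>crit\<close>, and in degrees above
  \<open>n - i\<close>; \<open>poly_pderiv_tail\<close> applies, and its value at \<open>m\<close>
  is at most \<open>gf p n i m ^ m\<close>.\<close>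

lemma crit_w_step:
  fixes x :: real
  assumes p: "0 \<le> p" "p \<le> 1" and i: "i < I" "I \<le> n" and x: "1 \<le> x" "x \<le> m"
    and z: "\<And>k. real k * x ^ (k - 1) \<le> C * z ^ k * real m ^ k" "0 \<le> C" "0 \<le> z" "z \<le> 1"
    and B: "gf p n i m \<le> B"
  shows "crit (pCons 0 (w p n (Suc i))) x \<le> crit (step_poly m (w p n i)) x + (real m)\<^sup>2 * (C * z ^ (n - I) * B ^ m)"
proof -
  define V where "V = step_poly m (w p n i)"
  define W where "W = V - pCons 0 (w p n (Suc i))"
  have nonneg: "coeff (pCons 0 (w p n (Suc i))) k \<ge> 0" for k
    using u_bounds(1) [OF p, of "Suc i"] by (auto simp: coeff_pCons coeff_w simp del: tails.simps split: nat.split)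
  have W: "coeff W k \<ge> 0" for k using coeff_w_step_le [of p i n k] p i by (simp add: W_def V_def)
  have "poly (pderiv W) x \<le> C * z ^ (n - i) * poly W m"
  proof (rule poly_pderiv_tail [OF W _ z(1)])
    fix k assume k: "1 \<le> k" "k \<le> n - i"
    thus "coeff W k = 0"
      using coeff_w_step [of i n "k - 1" p] i by (cases k) (auto simp: W_def V_def)
  qed (use z in auto)
  also have "\<dots> \<le> C * z ^ (n - I) * B ^ m"
  proof (intro mult_mono power_decreasing)
    have "poly W m \<le> poly V m"
      using poly_nonneg [OF nonneg, of "real m"] by (simp add: W_def)
    also have "\<dots> = 1 * poly V m" by simp
    also have "\<dots> \<le> (real m - 1) * poly V m"
      using m coeff_step_poly_nonneg [OF u_nonneg [OF p], of m "n + 1 - i" i]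
      by (intro mult_right_mono poly_nonneg) (auto simp: V_def w_def)
    also have "\<dots> = gf p n i m ^ m - 1"
      unfolding V_def by (subst poly_step_poly) (simp add: gf_def)
    also have "\<dots> \<le> B ^ m"
      using power_mono [OF B, of m] gf_ge_1 [OF p, of "real m" n i] m by auto
    finally show "poly W m \<le> B ^ m" .
  qed (use i z poly_nonneg [of W "real m"] W in auto)
  finally have "(x - 1)\<^sup>2 * poly (pderiv W) x \<le> (real m)\<^sup>2 * (C * z ^ (n - I) * B ^ m)"
    using x W by (intro mult_mono power_mono poly_nonneg) (auto simp: coeff_pderiv)
  moreover have "crit (pCons 0 (w p n (Suc i))) x = crit V x + (x - 1)\<^sup>2 * poly (pderiv W) x"
    by (simp add: crit_def W_def pderiv_diff algebra_simps)
  ultimately show ?thesis by (simp add: V_def)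
qed

text \<open>The order of the quantifiers matters: \<open>C\<close> and \<open>L0\<close> are
  absolute, \<open>Cz\<close> and \<open>z\<close> depend on \<open>L\<close> only, and the rest is
  uniform in \<open>n\<close>, \<open>p\<close>, \<open>E\<close> and \<open>I\<close>. The
  condition on \<open>z ^ (n - I)\<close> keeps the truncation error within the slack of
  \<open>growth_bound\<close>.\<close>

lemma gf_growth:
  obtains C L0 where "C > 0" "0 < L0" "L0 \<le> 1/4" "C * L0 \<le> 1/2"
   "\<And>L. 0 < L \<Longrightarrow> L \<le> L0 \<Longrightarrow> \<exists>Cz z. 0 < z \<and> z < 1 \<and> Cz > 0 \<and>
      (\<forall>(n::nat) (p::real) (E::real) (I::nat). 0 \<le> p \<and> p \<le> 1 \<and> 1 \<le> n \<and> I \<le> n \<and> E \<ge> 0 \<and> exp (- E) \<le> 1 - u p n $ 0 \<and>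
        Cz * z ^ (n - I) * ((real m)\<^sup>2 * (real n + 1)\<^sup>2 * (E + n * m + 1)) ^ m \<le> 1 \<longrightarrow>
        (1 - C * L) ^ I * (\<Prod>i<I. gf p n i (real m - L) ^ (m - 1)) \<le>
          C * (2 * m) / L ^ 5 * ((real m)\<^sup>2 * (real n + 1)\<^sup>2 * (E + n * m + 1)) ^ m)"
proof -
  from growth_bound [OF m tau1] obtain C L0 where C: "C > 0" "0 < L0" "L0 \<le> 1/4" "C * L0 \<le> 1/2" and
    A: "\<And>(L::real) U I B. \<lbrakk>0 < L; L \<le> L0; \<And>i k. coeff (U i) k \<ge> 0; \<And>i. coeff (U i) 0 \<le> 1;
       coeff (U 0) 1 \<ge> \<tau> 1 * coeff (U 0) 0;
       \<And>i k. i < I \<Longrightarrow> k \<ge> 1 \<Longrightarrow> coeff (pCons 0 (U (Suc i))) k \<le> coeff (step_poly m (U i)) k;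
       \<And>i. i < I \<Longrightarrow> crit (pCons 0 (U (Suc i))) (real m - L ^ 3) \<le>
            crit (step_poly m (U i)) (real m - L ^ 3) + L ^ 3 / (2 * m);
       B \<ge> 1; \<And>i. i \<le> I \<Longrightarrow> poly (pgf_poly (U i)) (real m - L ^ 3) \<le> B;
       \<And>i. i \<le> I \<Longrightarrow> - crit (pCons 0 (U i)) (real m - L ^ 3) \<le> B\<rbrakk>
     \<Longrightarrow> (1 - C * L) ^ I * (\<Prod>i<I. poly (pgf_poly (U i)) (real m - L) ^ (m - 1)) \<le> C * (2 * m) / L ^ 5 * B ^ m"
    by metis
  show ?thesis
  proof (rule that [OF C])
    fix L :: real assume L: "0 < L" "L \<le> L0"
    define s1 where "s1 = real m - L ^ 3"
    have L3: "L ^ 3 \<le> 1/4" "0 < L ^ 3" using L C power_decreasing [of 1 3 L] by auto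
    have s1: "1 \<le> s1" "s1 < m" using m L3 by (auto simp: s1_def)
    obtain Cz z where z: "Cz > 0" "0 < z" "z < 1" "\<And>k. real k * s1 ^ (k - 1) \<le> Cz * z ^ k * real m ^ k"
      using times_power_bound [of s1 m] s1 by auto
    define K where "K = (real m)\<^sup>2 * Cz * (2 * m) / L ^ 3"
    have K: "K > 0" using m z L3 by (auto simp: K_def)
    show "\<exists>Cz z. 0 < z \<and> z < 1 \<and> Cz > 0 \<and>
      (\<forall>(n::nat) (p::real) (E::real) (I::nat). 0 \<le> p \<and> p \<le> 1 \<and> 1 \<le> n \<and> I \<le> n \<and> E \<ge> 0 \<and> exp (- E) \<le> 1 - u p n $ 0 \<and>
        Cz * z ^ (n - I) * ((real m)\<^sup>2 * (real n + 1)\<^sup>2 * (E + n * m + 1)) ^ m \<le> 1 \<longrightarrow>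
        (1 - C * L) ^ I * (\<Prod>i<I. gf p n i (real m - L) ^ (m - 1)) \<le>
          C * (2 * m) / L ^ 5 * ((real m)\<^sup>2 * (real n + 1)\<^sup>2 * (E + n * m + 1)) ^ m)"
    proof (rule exI [of _ K], rule exI [of _ z], intro conjI allI impI K z(2,3))
      fix n :: nat and p E :: real and I :: nat
      define B where "B = (real m)\<^sup>2 * (real n + 1)\<^sup>2 * (E + n * m + 1)"
      assume "0 \<le> p \<and> p \<le> 1 \<and> 1 \<le> n \<and> I \<le> n \<and> E \<ge> 0 \<and> exp (- E) \<le> 1 - u p n $ 0 \<and>
        K * z ^ (n - I) * ((real m)\<^sup>2 * (real n + 1)\<^sup>2 * (E + n * m + 1)) ^ m \<le> 1"
      hence p: "0 \<le> p" "p \<le> 1" and n: "1 \<le> n" "I \<le> n" and E: "E \<ge> 0" "exp (- E) \<le> 1 - u p n $ 0"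
        and KB: "K * z ^ (n - I) * B ^ m \<le> 1" by (auto simp: B_def)
      note wb = w_bounds [OF p E(2,1), folded B_def]
      have "1 * 1 * 1 \<le> B"
        unfolding B_def using m E by (intro mult_mono one_le_power) auto
      hence B1: "1 \<le> B" by simp
      have "(1 - C * L) ^ I * (\<Prod>i<I. gf p n i (real m - L) ^ (m - 1)) \<le> C * (2 * m) / L ^ 5 * B ^ m"
        unfolding gf_def
      proof (rule A [OF L])
        show "\<tau> 1 * coeff (w p n 0) 0 \<le> coeff (w p n 0) 1"
          using n tau0 by (simp add: coeff_w)
        show "coeff (pCons 0 (w p n (Suc i))) k \<le> coeff (step_poly m (w p n i)) k" if "i < I" for i k
          using that n p by (intro coeff_w_step_le) auto
        fix i
        show "poly (pgf_poly (w p n i)) (real m - L ^ 3) \<le> B" "- crit (pCons 0 (w p n i)) (real m - L ^ 3) \<le> B"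
          using wb [of s1 i] s1 by (auto simp: s1_def)
        assume i: "i < I"
        have "gf p n i m \<le> B" using wb [of "real m" i] m by (simp add: gf_def)
        hence "crit (pCons 0 (w p n (Suc i))) s1 \<le> crit (step_poly m (w p n i)) s1 + (real m)\<^sup>2 * (Cz * z ^ (n - I) * B ^ m)"
          using p i n s1 z by (intro crit_w_step) auto
        also have "(real m)\<^sup>2 * (Cz * z ^ (n - I) * B ^ m) = K * z ^ (n - I) * B ^ m * (L ^ 3 / (2 * m))"
          using m L3 by (simp add: K_def field_simps)
        also have "\<dots> \<le> 1 * (L ^ 3 / (2 * m))" using KB L3 by (intro mult_right_mono) auto
        finally show "crit (pCons 0 (w p n (Suc i))) (real m - L ^ 3) \<le>
            crit (step_poly m (w p n i)) (real m - L ^ 3) + L ^ 3 / (2 * m)" by (simp add: s1_def)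
      qed (use u_bounds [OF p] B1 in \<open>auto simp: coeff_w\<close>)
      thus "(1 - C * L) ^ I * (\<Prod>i<I. gf p n i (real m - L) ^ (m - 1)) \<le>
          C * (2 * m) / L ^ 5 * ((real m)\<^sup>2 * (real n + 1)\<^sup>2 * (E + n * m + 1)) ^ m"
        unfolding B_def .
    qed
  qed
qed

text \<open>Compares the complex orbit at \<open>y\<close> with the real one at \<open>p\<close>, at
  radius \<open>s\<close> before generation \<open>I\<close> and at radius 1 from then on. The
  switch is free because \<open>s \<ge> 1\<close>. At radius 1 the truncated generating function has
  norm at most 1, so the late factors contain no \<open>gf\<close>.\<close>

lemma tails_perturb_bound:
  fixes y :: complex and s \<beta> p :: real
  assumes p: "0 \<le> p" "p \<le> 1" and I: "I \<le> n" and s: "1 \<le> s" "s < m" and \<beta>: "0 < \<beta>" "\<beta> \<le> 1"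
    and le: "cmod (y - of_real p) * (\<Sum>k. \<tau> k * s ^ k) *
      ((\<Prod>i<I. m / s * (1 + (s + 1) * \<beta>) ^ (m - 1) * gf p n i s ^ (m - 1)) * (m * (1 + 2 * \<beta>) ^ (m - 1)) ^ (n - I)) \<le> \<beta>"
  shows "cmod (1 - tails m \<tau> y n $ 0) \<le> 2"
proof -
  define P where "P = (\<lambda>i. tails m \<tau> (of_real p :: complex) i)"
  define D where "D = (\<lambda>i. tails m \<tau> y i - P i)"
  define \<sigma> where "\<sigma> = (\<lambda>i. if i < I then s else 1)"
  \<comment> \<open>At \<open>i = n\<close> the truncation leaves only coefficient 0, the quantity
    of interest.\<close>
  define x where "x = (\<lambda>i. tnorm (\<sigma> i) (n + 1 - i) (D i))"
  define a where "a = (\<lambda>i. if i < I then m / s * (1 + (s + 1) * \<beta>) ^ (m - 1) * gf p n i s ^ (m - 1)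
     else m * (1 + 2 * \<beta>) ^ (m - 1))"
  define x0 where "x0 = cmod (y - of_real p) * (\<Sum>k. \<tau> k * s ^ k)"
  have sum: "summable (\<lambda>k. \<tau> k * s ^ k)" using s by (intro tau_summable) auto
  have G: "tnorm t K (pgf_fps (P i)) = tnorm t K (pgf_fps (u p i))" for t K i
  proof -
    have "pgf_fps (P i) $ k = of_real (pgf_fps (u p i) $ k)" for k
      by (simp add: P_def pgf_fps_nth tails_of_real)
    thus ?thesis by (simp add: tnorm_def)
  qed
  have x0: "x0 \<ge> 0" unfolding x0_def using tau_nonneg s sum by (intro mult_nonneg_nonneg suminf_nonneg) auto
  have prod_a: "(\<Prod>i<n. a i) = (\<Prod>i<I. m / s * (1 + (s + 1) * \<beta>) ^ (m - 1) * gf p n i s ^ (m - 1)) * (m * (1 + 2 * \<beta>) ^ (m - 1)) ^ (n - I)"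
  proof -
    have "{..<n} = {..<I} \<union> {I..<n}" using I by auto
    hence "(\<Prod>i<n. a i) = (\<Prod>i<I. a i) * (\<Prod>i\<in>{I..<n}. a i)"
      by (simp add: prod.union_disjoint ivl_disj_int)
    thus ?thesis by (simp add: a_def)
  qed
  have "x n \<le> x0 * (\<Prod>j<n. a j)"
  proof (rule perturbation_iteration [where n = n and \<beta> = \<beta>])
    show "x 0 \<le> x0"
    proof -
      have "x 0 \<le> tnorm s (n + 1) (D 0)" unfolding x_def \<sigma>_def using s by (auto intro: tnorm_mono)
      also have "\<dots> = (\<Sum>k<n+1. cmod (y - of_real p) * (\<tau> k * s ^ k))"
        unfolding tnorm_def
      proof (intro sum.cong refl)
        fix k
        have "D 0 $ k = (y - of_real p) * of_real (\<tau> k)" by (simp add: D_def P_def algebra_simps)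
        thus "cmod (D 0 $ k) * s ^ k = cmod (y - of_real p) * (\<tau> k * s ^ k)"
          using tau_nonneg [of k] by (simp add: norm_mult)
      qed
      also have "\<dots> = cmod (y - of_real p) * (\<Sum>k<n+1. \<tau> k * s ^ k)" by (rule sum_distrib_left [symmetric])
      also have "\<dots> \<le> x0"
        unfolding x0_def using sum s tau_nonneg by (intro mult_left_mono sum_le_suminf) auto
      finally show ?thesis .
    qed
    show "x0 * (\<Prod>i<n. a i) \<le> \<beta>" using le unfolding prod_a x0_def .
  next
    fix i assume i: "i < n"
    show "a i \<ge> 1"
    proof (cases "i < I")
      case True
      have "1 * 1 * 1 \<le> m / s * (1 + (s + 1) * \<beta>) ^ (m - 1) * gf p n i s ^ (m - 1)"
        using s \<beta> gf_ge_1 [OF p s(1), of n i] by (intro mult_mono one_le_power) auto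
      thus ?thesis using True by (simp add: a_def)
    next
      case False
      have "1 * 1 \<le> m * (1 + 2 * \<beta>) ^ (m - 1)" using m \<beta> by (intro mult_mono one_le_power) auto
      thus ?thesis using False by (simp add: a_def)
    qed
    assume xi: "x i \<le> \<beta>"
    have xi0: "x i \<ge> 0" unfolding x_def \<sigma>_def using s by (intro tnorm_nonneg) auto
    define \<gamma> where "\<gamma> = (if i < I then gf p n i s else 1)"
    have \<gamma>1: "\<gamma> \<ge> 1" using gf_ge_1 [OF p s(1), of n i] by (simp add: \<gamma>_def)
    have Suc: "n + 1 - i = Suc (n + 1 - Suc i)" using i by auto
    have "x (Suc i) \<le> tnorm (\<sigma> i) (n + 1 - Suc i) (D (Suc i))"
      unfolding x_def \<sigma>_def using s by (intro tnorm_mono) auto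
    also have "D (Suc i) = fps_step m (P i + D i) - fps_step m (P i)" by (simp add: D_def P_def)
    also have "tnorm (\<sigma> i) (n + 1 - Suc i) \<dots> \<le> m / \<sigma> i * x i * (\<gamma> + (\<sigma> i + 1) * x i) ^ (m - 1)"
    proof (rule tnorm_step_diff)
      show "tnorm (\<sigma> i) (Suc (n + 1 - Suc i)) (pgf_fps (P i)) \<le> \<gamma>"
      proof (cases "i < I")
        case True
        thus ?thesis
          using tnorm_pgf_le [OF u_nonneg [OF p], of s "n + 1 - i" i] s
          unfolding G Suc [symmetric] by (simp add: \<sigma>_def \<gamma>_def gf_def w_def)
      next
        case False
        have "tnorm 1 (Suc (n + 1 - Suc i)) (pgf_fps (u p i)) \<le> 1"
          unfolding tnorm_1_nonneg [OF u_nonneg(2) [OF p]] sum_pgf_fps_nth using u_bounds [OF p] by simp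
        thus ?thesis unfolding G using False by (simp add: \<sigma>_def \<gamma>_def)
      qed
      show "tnorm (\<sigma> i) (Suc (n + 1 - Suc i)) (D i) \<le> x i" by (simp only: x_def Suc order_refl)
    qed (use s m in \<open>auto simp: \<sigma>_def\<close>)
    also have "\<dots> \<le> m / \<sigma> i * x i * (\<gamma> * (1 + (\<sigma> i + 1) * \<beta>)) ^ (m - 1)"
    proof (intro mult_left_mono power_mono)
      have "(\<sigma> i + 1) * x i \<le> \<gamma> * ((\<sigma> i + 1) * \<beta>)"
      proof -
        have "1 * ((\<sigma> i + 1) * x i) \<le> \<gamma> * ((\<sigma> i + 1) * \<beta>)"
          using xi \<gamma>1 s xi0 by (intro mult_mono) (auto simp: \<sigma>_def)
        thus ?thesis by simp
      qed
      thus "\<gamma> + (\<sigma> i + 1) * x i \<le> \<gamma> * (1 + (\<sigma> i + 1) * \<beta>)" by (simp add: algebra_simps)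
    qed (use xi0 \<gamma>1 s in \<open>auto simp: \<sigma>_def\<close>)
    also have "\<dots> = a i * x i"
      by (simp add: a_def \<sigma>_def \<gamma>_def power_mult_distrib)
    finally show "x (Suc i) \<le> a i * x i" .
  qed (use x0 in auto)
  also have "\<dots> \<le> \<beta>" using le unfolding prod_a x0_def .
  finally have "x n \<le> 1" using \<beta> by simp
  hence "cmod (D n $ 0) \<le> 1" by (simp add: x_def tnorm_def)
  moreover have "cmod (of_real (1 - u p n $ 0)) \<le> 1" unfolding norm_of_real using u_bounds [OF p] by simp
  moreover have eq: "1 - tails m \<tau> y n $ 0 = of_real (1 - u p n $ 0) - D n $ 0"
    by (simp add: D_def P_def tails_of_real)
  ultimately show ?thesis
    using norm_triangle_ineq4 [of "of_real (1 - u p n $ 0)" "D n $ 0"] unfolding eq by linarith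
qed

end

lemma poly_exp_bound:
  fixes \<delta> a :: real
  assumes "\<delta> > 0"
  obtains K where "K > 0" "\<And>n::nat. (real n + 1)\<^sup>2 * (exp (\<delta> * n) + n * a + 1) \<le> K * exp (2 * \<delta> * n)"
proof -
  have "((\<lambda>n::nat. (real n + 1)\<^sup>2 * (exp (\<delta> * n) + n * a + 1) / exp (2 * \<delta> * n)) \<longlongrightarrow> 0) at_top"
    using assms by real_asymp
  hence "Bseq (\<lambda>n::nat. (real n + 1)\<^sup>2 * (exp (\<delta> * n) + n * a + 1) / exp (2 * \<delta> * n))"
    by (intro convergent_imp_Bseq convergentI)
  then obtain K where K: "K > 0" "\<And>n::nat. norm ((real n + 1)\<^sup>2 * (exp (\<delta> * n) + n * a + 1) / exp (2 * \<delta> * n)) \<le> K"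
    by (auto elim: BseqE)
  show ?thesis
  proof (rule that [OF K(1)])
    fix n :: nat
    have "(real n + 1)\<^sup>2 * (exp (\<delta> * n) + n * a + 1) / exp (2 * \<delta> * n) \<le> K"
      by (rule order_trans [OF abs_ge_self K(2) [of n, unfolded real_norm_def]])
    thus "(real n + 1)\<^sup>2 * (exp (\<delta> * n) + n * a + 1) \<le> K * exp (2 * \<delta> * n)"
      by (simp add: field_simps)
  qed
qed

lemma exp_neg_tendsto_0: "(c::real) > 0 \<Longrightarrow> (\<lambda>n::nat. exp (- c * n)) \<longlonglongrightarrow> 0"
  by real_asymp

text \<open>The first \<open>n - n div d\<close> generations are measured in the norm of radius \<open>s\<close> close to \<open>m\<close>, where the
  truncation errors are still negligible. In the remaining ones the norm of radius \<open>1\<close> loses a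
  factor of order \<open>m\<close> per step, which is affordable because they are few.\<close>

lemma (in dr) good_regime:
  assumes \<epsilon>: "\<epsilon> > 0"
  obtains \<delta> N where "\<delta> > 0"
    "\<And>n p y. \<lbrakk>n \<ge> N; 0 \<le> p; p \<le> 1; exp (- exp (\<delta> * n)) \<le> 1 - u p n $ 0; cmod (y - of_real p) \<le> exp (- \<epsilon> * n)\<rbrakk>
      \<Longrightarrow> cmod (1 - tails m \<tau> y n $ 0) \<le> 2"
proof -
  define M where "M = real m"
  have M: "M \<ge> 2" using m by (simp add: M_def)
  from gf_growth obtain C L0 where C: "C > 0" "0 < L0" "L0 \<le> 1/4" "C * L0 \<le> 1/2" and
   A: "\<And>L. 0 < L \<Longrightarrow> L \<le> L0 \<Longrightarrow> \<exists>Cz z. 0 < z \<and> z < 1 \<and> Cz > 0 \<and>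
      (\<forall>(n::nat) (p::real) (E::real) (I::nat). 0 \<le> p \<and> p \<le> 1 \<and> 1 \<le> n \<and> I \<le> n \<and> E \<ge> 0 \<and> exp (- E) \<le> 1 - u p n $ 0 \<and>
        Cz * z ^ (n - I) * ((real m)\<^sup>2 * (real n + 1)\<^sup>2 * (E + n * m + 1)) ^ m \<le> 1 \<longrightarrow>
        (1 - C * L) ^ I * (\<Prod>i<I. gf p n i (real m - L) ^ (m - 1)) \<le>
          C * (2 * m) / L ^ 5 * ((real m)\<^sup>2 * (real n + 1)\<^sup>2 * (E + n * m + 1)) ^ m)"
    by metis
  \<comment> \<open>Five sources of growth get the rate \<open>\<epsilon> / 16\<close> each:
    \<open>M / s\<close>, \<open>1 / (1 - C L)\<close>, the power with \<open>\<beta>\<close>, the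
    bound \<open>B ^ m\<close>, and \<open>Dm ^ (n - I)\<close>. Against the disc radius this leaves
    the net rate \<open>- 11/16 * \<epsilon>\<close>.\<close>
  obtain L where L: "0 < L" "L < L0" "M / (M - L) < exp (\<epsilon> / 16)" "1 / (1 - C * L) < exp (\<epsilon> / 16)"
  proof -
    have "((\<lambda>L. M / (M - L)) \<longlongrightarrow> M / (M - 0)) (at_right 0)"
      by (rule tendsto_divide [OF tendsto_const tendsto_diff [OF tendsto_const tendsto_ident_at]]) (use M in simp)
    moreover have "((\<lambda>L. 1 / (1 - C * L)) \<longlongrightarrow> 1 / (1 - C * 0)) (at_right 0)"
      by (rule tendsto_divide [OF tendsto_const tendsto_diff [OF tendsto_const tendsto_mult [OF tendsto_const tendsto_ident_at]]]) simp
    moreover have "1 < exp (\<epsilon> / 16)" using \<epsilon> by simp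
    ultimately have "eventually (\<lambda>L. M / (M - L) < exp (\<epsilon> / 16)) (at_right 0)" "eventually (\<lambda>L. 1 / (1 - C * L) < exp (\<epsilon> / 16)) (at_right 0)"
      using M by (auto dest!: order_tendstoD(2))
    moreover have "eventually (\<lambda>L. L \<in> {0<..<L0}) (at_right 0)"
      using C by (intro eventually_at_right_real)
    ultimately have "eventually (\<lambda>L. L \<in> {0<..<L0} \<and> M / (M - L) < exp (\<epsilon> / 16) \<and> 1 / (1 - C * L) < exp (\<epsilon> / 16)) (at_right 0)"
      by eventually_elim auto
    from eventually_happens [OF this] show ?thesis using that by auto
  qed
  define s where "s = M - L"
  have CL: "0 < 1 - C * L"
  proof -
    have "C * L \<le> C * L0" using L C by (intro mult_left_mono) auto
    thus ?thesis using C(4) by linarith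
  qed
  have s: "1 \<le> s" "s < m" using L C M by (auto simp: s_def M_def)
  define \<beta> where "\<beta> = min 1 (\<epsilon> / (16 * M * (M + 1)))"
  have \<beta>: "0 < \<beta>" "\<beta> \<le> 1" "\<beta> \<le> \<epsilon> / (16 * M * (M + 1))" using \<epsilon> M by (auto simp: \<beta>_def)
  have Mb: "M * ((M + 1) * \<beta>) \<le> \<epsilon> / 16"
  proof -
    have "M * (M + 1) * \<beta> \<le> M * (M + 1) * (\<epsilon> / (16 * M * (M + 1)))"
      using \<beta> M by (intro mult_left_mono) auto
    also have "\<dots> = \<epsilon> / 16"
    proof -
      have "A * (\<epsilon> / (16 * A)) = \<epsilon> / 16" if "A > 0" for A using that by simp
      from this [of "M * (M + 1)"] show ?thesis using M by (simp add: mult.assoc)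
    qed
    finally show ?thesis by (simp add: mult_ac)
  qed
  have b1: "(1 + (s + 1) * \<beta>) ^ (m - 1) \<le> exp (\<epsilon> / 16)"
  proof -
    have "(1 + (s + 1) * \<beta>) ^ (m - 1) \<le> exp ((s + 1) * \<beta>) ^ (m - 1)"
      using s \<beta> by (intro power_mono exp_ge_add_one_self) auto
    also have "\<dots> = exp ((m - 1) * ((s + 1) * \<beta>))" by (rule exp_of_nat_mult [symmetric])
    also have "real (m - 1) * ((s + 1) * \<beta>) \<le> M * ((M + 1) * \<beta>)"
      using s \<beta> M by (intro mult_mono) (auto simp: M_def)
    finally show ?thesis using Mb by (meson exp_le_cancel_iff order_trans)
  qed
  define Dm where "Dm = m * (1 + 2 * \<beta>) ^ (m - 1)"
  have Dm: "Dm \<ge> 1"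
  proof -
    have "1 * 1 \<le> Dm" unfolding Dm_def using m \<beta> by (intro mult_mono one_le_power) auto
    thus ?thesis by simp
  qed
  define d where "d = nat \<lceil>16 * ln Dm / \<epsilon>\<rceil> + 1"
  have d: "d \<ge> 1" "ln Dm / d \<le> \<epsilon> / 16"
  proof -
    have "16 * ln Dm / \<epsilon> \<le> d" unfolding d_def by linarith
    thus "ln Dm / d \<le> \<epsilon> / 16" using \<epsilon> by (simp add: d_def field_simps)
  qed (simp add: d_def)
  from A [of L] L obtain Cz z where z: "0 < z" "z < 1" "Cz > 0" and
    R: "\<And>(n::nat) (p::real) (E::real) (I::nat). \<lbrakk>0 \<le> p; p \<le> 1; 1 \<le> n; I \<le> n; E \<ge> 0; exp (- E) \<le> 1 - u p n $ 0;
        Cz * z ^ (n - I) * ((real m)\<^sup>2 * (real n + 1)\<^sup>2 * (E + n * m + 1)) ^ m \<le> 1\<rbrakk> \<Longrightarrow>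
        (1 - C * L) ^ I * (\<Prod>i<I. gf p n i s ^ (m - 1)) \<le>
          C * (2 * m) / L ^ 5 * ((real m)\<^sup>2 * (real n + 1)\<^sup>2 * (E + n * m + 1)) ^ m"
    unfolding s_def M_def by (metis less_imp_le)
  define \<zeta> where "\<zeta> = - ln z"
  have \<zeta>: "\<zeta> > 0" "z = exp (- \<zeta>)" using z by (auto simp: \<zeta>_def)
  \<comment> \<open>Chosen after \<open>d\<close> and \<open>z\<close>: \<open>B ^ m\<close> grows
    like \<open>exp (2 * \<delta> * M * n)\<close>, which must lose against
    \<open>z ^ (n div d)\<close>, about \<open>exp (- \<zeta> * n / d)\<close>, and must fit into
    its share of the rate.\<close>
  define \<delta> where "\<delta> = min (\<zeta> / (8 * d * M)) (\<epsilon> / (32 * M))"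
  have \<delta>: "\<delta> > 0" "2 * \<delta> * M \<le> \<zeta> / (4 * d)" "2 * \<delta> * M \<le> \<epsilon> / 16"
  proof -
    have "\<delta> \<le> \<zeta> / (8 * d * M)" "\<delta> \<le> \<epsilon> / (32 * M)" by (auto simp: \<delta>_def)
    thus "2 * \<delta> * M \<le> \<zeta> / (4 * d)" "2 * \<delta> * M \<le> \<epsilon> / 16" using M d by (auto simp: field_simps)
  qed (use \<zeta> \<epsilon> d M in \<open>auto simp: \<delta>_def\<close>)
  obtain K where K: "K > 0" "\<And>n::nat. (real n + 1)\<^sup>2 * (exp (\<delta> * n) + n * M + 1) \<le> K * exp (2 * \<delta> * n)"
    using poly_exp_bound [OF \<delta>(1)] by metis
  define S where "S = (\<Sum>k. \<tau> k * s ^ k)"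
  have S: "S \<ge> 0" unfolding S_def using s tau_nonneg by (intro suminf_nonneg tau_summable) auto
  define K1 where "K1 = (M\<^sup>2 * K) ^ m"
  have K1: "K1 > 0" using M K by (simp add: K1_def)
  define K2 where "K2 = S * (C * (2 * m) / L ^ 5 * K1)"
  have K2: "K2 \<ge> 0" unfolding K2_def using S C L K1 by auto
  have "eventually (\<lambda>n::nat. Cz * exp \<zeta> * K1 * exp (- (\<zeta> / (4 * d)) * n) < 1 \<and> K2 * exp (- (\<epsilon> / 2) * n) < \<beta> \<and> (1::nat) \<le> n) at_top"
  proof (intro eventually_conj)
    have "\<zeta> / (4 * d) > 0" using \<zeta> d by simp
    hence "((\<lambda>n::nat. exp (- (\<zeta> / (4 * d)) * n)) \<longlongrightarrow> 0) at_top" by (rule exp_neg_tendsto_0)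
    from tendsto_mult_left [OF this, of "Cz * exp \<zeta> * K1"]
    show "eventually (\<lambda>n::nat. Cz * exp \<zeta> * K1 * exp (- (\<zeta> / (4 * d)) * n) < 1) at_top"
      by (rule order_tendstoD(2)) simp
    have "((\<lambda>n::nat. exp (- (\<epsilon> / 2) * n)) \<longlongrightarrow> 0) at_top" by (rule exp_neg_tendsto_0) (use \<epsilon> in simp)
    from tendsto_mult_left [OF this, of K2]
    show "eventually (\<lambda>n::nat. K2 * exp (- (\<epsilon> / 2) * n) < \<beta>) at_top"
      using \<beta> by (intro order_tendstoD(2)) auto
  qed (rule eventually_ge_at_top)
  then obtain N where N: "\<And>n. n \<ge> N \<Longrightarrow> Cz * exp \<zeta> * K1 * exp (- (\<zeta> / (4 * d)) * n) < 1 \<and> K2 * exp (- (\<epsilon> / 2) * n) < \<beta> \<and> (1::nat) \<le> n"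
    unfolding eventually_at_top_linorder by auto
  show ?thesis
  proof (rule that [OF \<delta>(1), of N])
    fix n p y
    assume n: "n \<ge> N" and p: "0 \<le> p" "p \<le> 1" and g: "exp (- exp (\<delta> * n)) \<le> 1 - u p n $ 0"
      and y: "cmod (y - of_real p) \<le> exp (- \<epsilon> * n)"
    define h where "h = n div d"
    define I where "I = n - h"
    have h: "n - I = h" "I \<le> n" by (auto simp: I_def h_def)
    have hd: "real h \<le> n / d" "real h \<ge> n / d - 1"
      using real_of_int_div4 [of "int n" "int d"] real_of_int_div3 [of "int n" "int d"]
      by (simp_all add: h_def flip: zdiv_int)
    define B where "B = (real m)\<^sup>2 * (real n + 1)\<^sup>2 * (exp (\<delta> * n) + n * m + 1)"
    have Bm: "B ^ m \<le> K1 * exp (2 * \<delta> * M * n)"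
    proof -
      have "B = M\<^sup>2 * ((real n + 1)\<^sup>2 * (exp (\<delta> * n) + n * M + 1))" by (simp add: B_def M_def)
      also have "\<dots> \<le> M\<^sup>2 * (K * exp (2 * \<delta> * n))" using K(2) [of n] by (intro mult_left_mono) auto
      finally have "B ^ m \<le> (M\<^sup>2 * (K * exp (2 * \<delta> * n))) ^ m"
        by (intro power_mono) (auto simp: B_def add_nonneg_nonneg)
      also have "\<dots> = K1 * exp (2 * \<delta> * n) ^ m" by (simp add: K1_def power_mult_distrib)
      also have "exp (2 * \<delta> * n) ^ m = exp (2 * \<delta> * M * n)"
        unfolding exp_of_nat_mult [symmetric] by (simp add: M_def mult_ac)
      finally show ?thesis .
    qed
    \<comment> \<open>The factor \<open>exp \<zeta>\<close> pays for the rounding in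
      \<open>n div d\<close>.\<close>
    have zh: "z ^ h \<le> exp \<zeta> * exp (- (\<zeta> / d) * n)"
    proof -
      have "z ^ h = exp (- \<zeta> * h)" unfolding \<zeta>(2) by (simp add: exp_of_nat_mult [symmetric] mult.commute)
      also have "\<dots> \<le> exp (\<zeta> + - (\<zeta> / d) * n)"
      proof -
        have "\<zeta> * (n / d - 1) \<le> \<zeta> * h" using hd \<zeta> by (intro mult_left_mono) auto
        thus ?thesis by (simp add: algebra_simps)
      qed
      finally show ?thesis unfolding exp_add .
    qed
    have "Cz * z ^ h * B ^ m \<le> Cz * (exp \<zeta> * exp (- (\<zeta> / d) * n)) * (K1 * exp (2 * \<delta> * M * n))"
      using zh Bm z K1 by (intro mult_mono mult_left_mono) (auto simp: B_def add_nonneg_nonneg)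
    also have "\<dots> = Cz * exp \<zeta> * K1 * exp (- (\<zeta> / d) * n + 2 * \<delta> * M * n)"
      unfolding exp_add by (simp only: mult_ac)
    also have "\<dots> \<le> Cz * exp \<zeta> * K1 * exp (- (\<zeta> / (4 * d)) * n)"
    proof -
      have "2 * \<delta> * M * n \<le> \<zeta> / (4 * d) * n" using \<delta> by (intro mult_right_mono) auto
      moreover have "\<zeta> / d * n = 4 * (\<zeta> / (4 * d) * n)" by simp
      moreover have "\<zeta> / (4 * d) * n \<ge> 0" using \<zeta> by simp
      ultimately have "- (\<zeta> / d) * n + 2 * \<delta> * M * n \<le> - (\<zeta> / (4 * d)) * n" by simp
      thus ?thesis using z K1 by (intro mult_left_mono) auto
    qed
    also have "\<dots> \<le> 1" using N [OF n] by simp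
    finally have cond: "Cz * z ^ (n - I) * B ^ m \<le> 1" by (simp add: h)
    have "(1 - C * L) ^ I * (\<Prod>i<I. gf p n i s ^ (m - 1)) \<le> C * (2 * m) / L ^ 5 * B ^ m"
      unfolding B_def using cond g p h N [OF n] by (intro R) (auto simp: B_def)
    also have "\<dots> \<le> C * (2 * m) / L ^ 5 * (K1 * exp (2 * \<delta> * M * n))"
      using Bm C L by (intro mult_left_mono) auto
    also have "\<dots> \<le> C * (2 * m) / L ^ 5 * (K1 * exp (\<epsilon> / 16 * n))"
    proof -
      have "2 * \<delta> * M * n \<le> \<epsilon> / 16 * n" using \<delta>(3) by (intro mult_right_mono) auto
      thus ?thesis using C L K1 by (intro mult_left_mono) auto
    qed
    finally have G0: "(1 - C * L) ^ I * (\<Prod>i<I. gf p n i s ^ (m - 1)) \<le> C * (2 * m) / L ^ 5 * (K1 * exp (\<epsilon> / 16 * n))" .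
    have expI: "exp a ^ I \<le> exp (a * n)" if "a \<ge> 0" for a :: real
      unfolding exp_of_nat_mult [symmetric] using that h by (auto simp: mult.commute intro!: mult_left_mono)
    have pg: "(\<Prod>i<I. gf p n i s ^ (m - 1)) \<ge> 0"
      using gf_ge_1 [OF p s(1)] by (intro prod_nonneg) (auto intro: order_trans [of 0 1])
    have G: "(\<Prod>i<I. gf p n i s ^ (m - 1)) \<le> exp (\<epsilon> / 16 * n) * (C * (2 * m) / L ^ 5 * (K1 * exp (\<epsilon> / 16 * n)))"
    proof -
      have "(\<Prod>i<I. gf p n i s ^ (m - 1)) = (1 / (1 - C * L)) ^ I * ((1 - C * L) ^ I * (\<Prod>i<I. gf p n i s ^ (m - 1)))"
        using CL by (simp add: power_divide)
      also have "\<dots> \<le> exp (\<epsilon> / 16) ^ I * (C * (2 * m) / L ^ 5 * (K1 * exp (\<epsilon> / 16 * n)))"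
        using CL L pg by (intro mult_mono [OF power_mono G0]) auto
      also have "\<dots> \<le> exp (\<epsilon> / 16 * n) * (C * (2 * m) / L ^ 5 * (K1 * exp (\<epsilon> / 16 * n)))"
        using expI [of "\<epsilon> / 16"] \<epsilon> C L K1 by (intro mult_right_mono) auto
      finally show ?thesis .
    qed
    have Dh: "Dm ^ (n - I) \<le> exp (\<epsilon> / 16 * n)"
    proof -
      have "Dm ^ h = exp (h * ln Dm)" using Dm by (simp add: exp_of_nat_mult)
      also have "h * ln Dm \<le> (n / d) * ln Dm" using hd Dm by (intro mult_right_mono) auto
      also have "\<dots> = ln Dm / d * n" by simp
      also have "\<dots> \<le> \<epsilon> / 16 * n" using d by (intro mult_right_mono) auto
      finally show ?thesis by (simp add: h)
    qed
    have q: "(m / s * (1 + (s + 1) * \<beta>) ^ (m - 1)) ^ I \<le> exp (\<epsilon> / 8 * n)"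
    proof -
      have "m / s * (1 + (s + 1) * \<beta>) ^ (m - 1) \<le> exp (\<epsilon> / 16) * exp (\<epsilon> / 16)"
        using L b1 s \<beta> by (intro mult_mono) (auto simp: s_def M_def)
      also have "\<dots> = exp (\<epsilon> / 8)" by (simp flip: exp_add)
      finally have "(m / s * (1 + (s + 1) * \<beta>) ^ (m - 1)) ^ I \<le> exp (\<epsilon> / 8) ^ I"
        using s \<beta> by (intro power_mono) auto
      also have "\<dots> \<le> exp (\<epsilon> / 8 * n)" using \<epsilon> by (intro expI) auto
      finally show ?thesis .
    qed
    have "cmod (y - of_real p) * S * ((\<Prod>i<I. m / s * (1 + (s + 1) * \<beta>) ^ (m - 1) * gf p n i s ^ (m - 1)) * Dm ^ (n - I)) =
      cmod (y - of_real p) * S * (((m / s * (1 + (s + 1) * \<beta>) ^ (m - 1)) ^ I * (\<Prod>i<I. gf p n i s ^ (m - 1))) * Dm ^ (n - I))"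
      by (simp only: prod.distrib prod_constant card_lessThan power_mult_distrib)
    also have "\<dots> \<le> exp (- \<epsilon> * n) * S * ((exp (\<epsilon> / 8 * n) * (exp (\<epsilon> / 16 * n) * (C * (2 * m) / L ^ 5 * (K1 * exp (\<epsilon> / 16 * n))))) * exp (\<epsilon> / 16 * n))"
      using y S q G Dh s \<beta> pg Dm C L K1 by (intro mult_mono) (auto intro!: mult_nonneg_nonneg)
    also have "\<dots> = K2 * (exp (- \<epsilon> * n) * exp (\<epsilon> / 8 * n) * exp (\<epsilon> / 16 * n) * exp (\<epsilon> / 16 * n) * exp (\<epsilon> / 16 * n))"
      by (simp add: K2_def mult_ac)
    also have "\<dots> = K2 * exp (- (11 / 16) * \<epsilon> * n)"
      unfolding exp_add [symmetric] by (simp add: algebra_simps)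
    also have "\<dots> \<le> K2 * exp (- (\<epsilon> / 2) * n)"
      using K2 \<epsilon> by (intro mult_left_mono) auto
    also have "\<dots> \<le> \<beta>" using N [OF n] by simp
    finally show "cmod (1 - tails m \<tau> y n $ 0) \<le> 2"
      unfolding S_def Dm_def by (intro tails_perturb_bound [OF p h(2) s \<beta>(1,2)])
  qed
qed

section \<open>Holomorphy in the parameter and bounds on derivatives\<close>

definition fps_holomorphic :: "(complex \<Rightarrow> complex fps) \<Rightarrow> bool" where
  "fps_holomorphic F \<longleftrightarrow> (\<forall>k. (\<lambda>y. F y $ k) holomorphic_on UNIV)"

lemma fps_holomorphic_mult: "fps_holomorphic F \<Longrightarrow> fps_holomorphic G \<Longrightarrow> fps_holomorphic (\<lambda>y. F y * G y)"
  unfolding fps_holomorphic_def fps_mult_nth by (auto intro!: holomorphic_intros)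

lemma fps_holomorphic_power: "fps_holomorphic F \<Longrightarrow> fps_holomorphic (\<lambda>y. F y ^ n)"
  by (induction n) (auto simp: fps_holomorphic_mult, auto simp: fps_holomorphic_def)

lemma fps_holomorphic_sum: "(\<And>i. i \<in> A \<Longrightarrow> fps_holomorphic (F i)) \<Longrightarrow> fps_holomorphic (\<lambda>y. \<Sum>i\<in>A. F i y)"
  unfolding fps_holomorphic_def fps_sum_nth by (auto intro!: holomorphic_intros)

lemma fps_holomorphic_pgf: "fps_holomorphic F \<Longrightarrow> fps_holomorphic (\<lambda>y. pgf_fps (F y))"
  unfolding fps_holomorphic_def
proof
  fix k assume *: "\<forall>k. (\<lambda>y. F y $ k) holomorphic_on UNIV"
  show "(\<lambda>y. pgf_fps (F y) $ k) holomorphic_on UNIV"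
    using * by (cases "k = 0") (auto simp: pgf_fps_nth intro!: holomorphic_intros)
qed

lemma fps_holomorphic_tails: "fps_holomorphic (\<lambda>y. tails m \<tau> y n)"
proof (induction n)
  case 0
  show ?case by (auto simp: fps_holomorphic_def intro!: holomorphic_intros)
next
  case (Suc n)
  have "fps_holomorphic (\<lambda>y. tails m \<tau> y n * (\<Sum>l<m. pgf_fps (tails m \<tau> y n) ^ l))"
    using Suc by (intro fps_holomorphic_mult fps_holomorphic_sum fps_holomorphic_power fps_holomorphic_pgf)
  thus ?case by (simp add: fps_holomorphic_def fps_step_def)
qed

definition zero_prob :: "nat \<Rightarrow> (nat \<Rightarrow> real) \<Rightarrow> nat \<Rightarrow> complex \<Rightarrow> complex" where
  "zero_prob m \<tau> n y = (1 - tails m \<tau> y n $ 0) ^ m"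

lemma holomorphic_zero_prob [holomorphic_intros]: "zero_prob m \<tau> n holomorphic_on A"
proof -
  have "(\<lambda>y. tails m \<tau> y n $ 0) holomorphic_on UNIV"
    using fps_holomorphic_tails by (auto simp: fps_holomorphic_def)
  hence "zero_prob m \<tau> n holomorphic_on UNIV"
    unfolding zero_prob_def by (intro holomorphic_intros)
  thus ?thesis by (rule holomorphic_on_subset) auto
qed

lemma zero_prob_Cauchy:
  assumes "r > 0" "\<And>y. cmod (\<xi> - y) = r \<Longrightarrow> cmod (1 - tails m \<tau> y n $ 0) \<le> B"
  shows "cmod ((deriv ^^ k) (zero_prob m \<tau> n) \<xi>) \<le> fact k * B ^ m / r ^ k"
proof (rule Cauchy_inequality [OF _ _ assms(1)])
  show "continuous_on (cball \<xi> r) (zero_prob m \<tau> n)"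
    by (intro holomorphic_on_imp_continuous_on holomorphic_intros)
  show "cmod (zero_prob m \<tau> n y) \<le> B ^ m" if "cmod (\<xi> - y) = r" for y
    unfolding zero_prob_def norm_power using assms(2) [OF that] by (intro power_mono) auto
qed (intro holomorphic_intros)

context dr
begin

text \<open>A coefficientwise comparison that costs the factor \<open>c\<close> once for each of the \<open>m\<^sup>n\<close> independent
  initial variables.\<close>

lemma tails_majorized:
  fixes y :: complex
  assumes q: "0 \<le> q" "q \<le> 1" and c: "cmod y \<le> c * q" "cmod (1 - y) \<le> c * (1 - q)"
  shows "majorized (pgf_fps (tails m \<tau> y n)) (fps_const (c ^ (m ^ n)) * pgf_fps (u q n))"
proof (induction n)
  case 0
  show ?case
    unfolding majorized_def
  proof
    fix k
    show "cmod (pgf_fps (tails m \<tau> y 0) $ k) \<le> (fps_const (c ^ m ^ 0) * pgf_fps (u q 0)) $ k"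
    proof (cases k)
      case 0
      thus ?thesis using c tau0 by (simp add: pgf_fps_nth)
    next
      case (Suc j)
      have "cmod (y * of_real (\<tau> j) - y * of_real (\<tau> (Suc j))) = cmod y * (\<tau> j - \<tau> (Suc j))"
        using tau_dec [of j] by (simp flip: right_diff_distrib of_real_diff add: norm_mult)
      also have "\<dots> \<le> c * q * (\<tau> j - \<tau> (Suc j))" using c tau_dec [of j] by (intro mult_right_mono) auto
      finally show ?thesis using Suc by (simp add: pgf_fps_nth algebra_simps)
    qed
  qed
next
  case (Suc n)
  thus ?case using majorized_pgf_step [OF Suc] by (simp add: mult.commute flip: power_mult)
qed

text \<open>\<open>X\<close> is zero at time \<open>n\<close> if all \<open>m ^ n\<close> initial
  variables vanish; Bernoulli's inequality does the rest.\<close>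

lemma u_0_lower:
  assumes q: "0 \<le> q" "q \<le> 1"
  shows "1 - u q n $ 0 \<ge> 1 - real m ^ n * q"
proof -
  have "(1 - q) ^ (m ^ n) \<le> 1 - u q n $ 0"
  proof (induction n)
    case (Suc n)
    have "(1 - q) ^ (m ^ Suc n) = ((1 - q) ^ (m ^ n)) ^ m" by (simp add: mult.commute flip: power_mult)
    also have "\<dots> \<le> (1 - u q n $ 0) ^ m" using Suc q by (intro power_mono) auto
    also have "\<dots> = (pgf_fps (u q n) ^ m) $ 0" by (simp add: fps_power_zeroth pgf_fps_nth)
    also have "\<dots> \<le> pgf_fps (u q (Suc n)) $ 0"
      using fps_nonneg_power [OF u_nonneg(2) [OF q, of n], of m] by (simp add: pgf_fps_step_nth fps_nonneg_def)
    finally show ?case by (simp add: pgf_fps_nth)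
  qed (simp add: tau0)
  moreover have "1 + real (m ^ n) * (- q) \<le> (1 + (- q)) ^ (m ^ n)"
    using q by (intro Bernoulli_inequality) auto
  ultimately show ?thesis by simp
qed

text \<open>The disc about \<open>q + r\<close> touches \<open>q\<close> from the right, so
  \<open>cmod (1 - y) \<le> 1 - q\<close> without loss, even when \<open>1 - q\<close> is tiny. Only
  \<open>cmod y\<close> exceeds its counterpart, by a factor of at most
  \<open>c = 1 + 2 * r / q\<close>. A probability of zero below 1/2 forces
  \<open>q \<ge> 1 / (2 * m ^ n)\<close>, which keeps \<open>c ^ (m ^ n)\<close> at most
  \<open>exp 1\<close>.\<close>

lemma tiny_regime:
  fixes y :: complex
  assumes q: "0 \<le> q" "q \<le> 1" and g: "1 - u q n $ 0 \<le> 1 / 2" and r: "0 < r" "q + r \<le> 1" "4 * (real m ^ n)\<^sup>2 * r \<le> 1"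
    and y: "cmod (of_real (q + r) - y) \<le> r"
  shows "cmod (1 - tails m \<tau> y n $ 0) \<le> 3 * (1 - u q n $ 0)"
proof -
  have mq: "1 / 2 \<le> real m ^ n * q" using u_0_lower [OF q, of n] g by linarith
  have m0: "real m ^ n > 0" using m by simp
  have q0: "q > 0" using mq q by (cases "q = 0") auto
  define c where "c = 1 + 2 * r / q"
  have c: "c \<ge> 1" using r q0 by (simp add: c_def)
  have "cmod y \<le> cmod (of_real (q + r)) + cmod (of_real (q + r) - y)"
    using norm_triangle_ineq4 [of "of_real (q + r)" "of_real (q + r) - y"] by simp
  also have "\<dots> \<le> c * q" unfolding norm_of_real using y q0 r by (simp add: c_def field_simps)
  finally have y1: "cmod y \<le> c * q" .
  have "cmod (1 - y) \<le> cmod (of_real (1 - (q + r))) + r"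
    using norm_triangle_ineq [of "of_real (1 - (q + r))" "of_real (q + r) - y"] y by simp
  also have "\<dots> = 1 - q" unfolding norm_of_real using r by simp
  also have "\<dots> \<le> c * (1 - q)" using c q mult_right_mono [of 1 c "1 - q"] by simp
  finally have "majorized (pgf_fps (tails m \<tau> y n)) (fps_const (c ^ (m ^ n)) * pgf_fps (u q n))"
    using y1 by (intro tails_majorized q)
  hence "cmod (pgf_fps (tails m \<tau> y n) $ 0) \<le> (fps_const (c ^ (m ^ n)) * pgf_fps (u q n)) $ 0"
    unfolding majorized_def by blast
  hence "cmod (1 - tails m \<tau> y n $ 0) \<le> c ^ (m ^ n) * (1 - u q n $ 0)"
    by (simp add: pgf_fps_nth)
  also have "\<dots> \<le> 3 * (1 - u q n $ 0)"
  proof (rule mult_right_mono)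
    have "c ^ (m ^ n) \<le> exp (2 * r / q) ^ (m ^ n)"
      unfolding c_def using r q0 by (intro power_mono exp_ge_add_one_self) auto
    also have "\<dots> = exp (real m ^ n * (2 * r / q))" by (simp add: exp_of_nat_mult [symmetric])
    also have "real m ^ n * (2 * r / q) \<le> 1"
    proof -
      have "real m ^ n * (2 * r) = 4 * (real m ^ n * r) * (1 / 2)" by simp
      also have "\<dots> \<le> 4 * (real m ^ n * r) * (real m ^ n * q)" using mq m0 r by (intro mult_left_mono) auto
      also have "\<dots> = (4 * (real m ^ n)\<^sup>2 * r) * q" by (simp add: power2_eq_square)
      also have "\<dots> \<le> 1 * q" using r q0 by (intro mult_right_mono) auto
      finally show ?thesis using q0 by (simp add: field_simps)
    qed
    finally show "c ^ (m ^ n) \<le> 3" using exp_le by (meson exp_le_cancel_iff order_trans)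
  qed (use u_bounds [OF q] in simp)
  finally show ?thesis .
qed

text \<open>If the probability of zero is doubly exponentially small slightly to the left of \<open>p\<close>, a disc of
  radius of order \<open>m\<^sup>-\<^sup>2\<^sup>n\<close> suffices; otherwise the disc of the good regime contains \<open>p\<close>.\<close>

lemma zero_prob_deriv_bound:
  assumes \<epsilon>: "\<epsilon> > 0"
  obtains C N where "\<And>n p. n \<ge> N \<Longrightarrow> 0 \<le> p \<Longrightarrow> p \<le> 1 \<Longrightarrow>
    cmod ((deriv ^^ k) (zero_prob m \<tau> n) (of_real p)) \<le> C * exp (\<epsilon> * k * n)"
proof -
  obtain \<delta> N where \<delta>: "\<delta> > 0" and
    good: "\<And>n p y. \<lbrakk>n \<ge> N; 0 \<le> p; p \<le> 1; exp (- exp (\<delta> * n)) \<le> 1 - u p n $ 0; cmod (y - of_real p) \<le> exp (- \<epsilon> * n)\<rbrakk>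
      \<Longrightarrow> cmod (1 - tails m \<tau> y n $ 0) \<le> 2"
    using good_regime [OF \<epsilon>] by metis
  \<comment> \<open>\<open>exp (b * n)\<close> covers the exponential part of
    \<open>1 / r ^ k\<close>, namely \<open>exp (k * (\<epsilon> + 2 * ln m) * n)\<close>; the
    doubly exponential smallness beats it.\<close>
  define b where "b = k * (\<epsilon> + 2 * ln m) + 1"
  have b: "b > 0" using \<epsilon> m by (auto simp: b_def intro!: add_nonneg_pos mult_nonneg_nonneg)
  have "(\<lambda>n::nat. exp (- exp (\<delta> * n)) * exp (b * n)) \<longlonglongrightarrow> 0" using \<delta> b by real_asymp
  hence "Bseq (\<lambda>n::nat. exp (- exp (\<delta> * n)) * exp (b * n))" by (intro convergent_imp_Bseq convergentI)
  then obtain K where K: "K > 0" "\<And>n::nat. exp (- exp (\<delta> * n)) * exp (b * n) \<le> K"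
    by (auto elim!: BseqE)
  define C where "C = max (fact k * 2 ^ m * 2 ^ k) (fact k * 3 ^ m * 4 ^ k * K)"
  show ?thesis
  proof (rule that [of N C])
    fix n :: nat and p :: real
    assume n: "n \<ge> N" and p: "0 \<le> p" "p \<le> 1"
    define R where "R = exp (- \<epsilon> * n) / 2"
    define r where "r = exp (- \<epsilon> * n) / (4 * (real m ^ n)\<^sup>2)"
    have m1: "1 \<le> (real m ^ n)\<^sup>2" using m by (simp add: one_le_power)
    have R: "R > 0" by (simp add: R_def)
    have r: "r > 0" "r \<le> R" "4 * (real m ^ n)\<^sup>2 * r \<le> 1"
    proof -
      show "r > 0" unfolding r_def using m by simp
      have "2 \<le> 4 * (real m ^ n)\<^sup>2" using m1 by linarith
      thus "r \<le> R" unfolding r_def R_def using m by (intro divide_left_mono) auto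
      have "4 * (real m ^ n)\<^sup>2 * r = exp (- \<epsilon> * n)" unfolding r_def using m by simp
      thus "4 * (real m ^ n)\<^sup>2 * r \<le> 1" using \<epsilon> by simp
    qed
    \<comment> \<open>The test point lies left of \<open>p\<close> so that \<open>p = q + r\<close>
      is the centre needed in \<open>tiny_regime\<close>. If it is clipped to 0, then
      \<open>u_0_lower\<close> gives zero probability 1 and the good regime applies.\<close>
    define q where "q = max 0 (p - r)"
    have q: "0 \<le> q" "q \<le> 1" "\<bar>p - q\<bar> \<le> r" using p r by (auto simp: q_def)
    show "cmod ((deriv ^^ k) (zero_prob m \<tau> n) (of_real p)) \<le> C * exp (\<epsilon> * k * n)"
    proof (cases "exp (- exp (\<delta> * n)) \<le> 1 - u q n $ 0")
      case True
      have "cmod ((deriv ^^ k) (zero_prob m \<tau> n) (of_real p)) \<le> fact k * 2 ^ m / R ^ k"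
      proof (rule zero_prob_Cauchy [OF R])
        fix y assume "cmod (of_real p - y) = R"
        hence "cmod (y - of_real q) \<le> R + \<bar>p - q\<bar>"
          using norm_triangle_ineq [of "y - of_real p" "of_real (p - q)"] unfolding norm_of_real
          by (simp add: norm_minus_commute)
        also have "\<dots> \<le> exp (- \<epsilon> * n)" using q r by (simp add: R_def)
        finally show "cmod (1 - tails m \<tau> y n $ 0) \<le> 2" by (rule good [OF n q(1,2) True])
      qed
      also have "\<dots> = fact k * 2 ^ m * 2 ^ k * exp (\<epsilon> * k * n)"
      proof -
        have "1 / R = 2 * exp (\<epsilon> * n)" by (simp add: R_def exp_minus field_simps)
        hence "(1 / R) ^ k = 2 ^ k * exp (\<epsilon> * k * n)"
          by (simp add: power_mult_distrib exp_of_nat_mult [symmetric] mult_ac)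
        hence "1 / R ^ k = 2 ^ k * exp (\<epsilon> * k * n)" by (simp add: power_divide)
        hence "fact k * 2 ^ m * (1 / R ^ k) = fact k * 2 ^ m * (2 ^ k * exp (\<epsilon> * k * n))" by (simp only:)
        thus ?thesis by simp
      qed
      also have "\<dots> \<le> C * exp (\<epsilon> * k * n)" unfolding C_def by (intro mult_right_mono) auto
      finally show ?thesis .
    next
      case False
      have e1: "exp (- exp (\<delta> * n)) \<le> 1 / 2"
      proof -
        have "1 \<le> exp (\<delta> * n)" using \<delta> by simp
        hence "exp (- exp (\<delta> * n)) \<le> exp (- 1)" by simp
        also have "exp (- 1) \<le> (1 / 2 :: real)"
          using exp_ge_add_one_self [of 1] by (simp add: exp_minus field_simps)
        finally show ?thesis .
      qed
      have "q \<noteq> 0"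
      proof
        assume "q = 0"
        hence "1 \<le> 1 - u q n $ 0" using u_0_lower [OF q(1,2), of n] by simp
        thus False using False e1 by linarith
      qed
      hence pq: "p = q + r" by (auto simp: q_def max_def split: if_splits)
      have "cmod ((deriv ^^ k) (zero_prob m \<tau> n) (of_real p)) \<le> fact k * (3 * (1 - u q n $ 0)) ^ m / r ^ k"
      proof (rule zero_prob_Cauchy [OF r(1)])
        fix y assume "cmod (of_real p - y) = r"
        thus "cmod (1 - tails m \<tau> y n $ 0) \<le> 3 * (1 - u q n $ 0)"
          using False e1 r p by (intro tiny_regime [OF q(1,2)]) (auto simp: pq)
      qed
      also have "\<dots> \<le> fact k * (3 ^ m * exp (- exp (\<delta> * n))) / r ^ k"
      proof (intro divide_right_mono mult_left_mono)
        have "(1 - u q n $ 0) ^ m \<le> (1 - u q n $ 0) ^ 1"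
          using u_bounds [OF q(1,2), of n 0] m by (intro power_decreasing) auto
        hence "(1 - u q n $ 0) ^ m \<le> exp (- exp (\<delta> * n))" using False by simp
        thus "(3 * (1 - u q n $ 0)) ^ m \<le> 3 ^ m * exp (- exp (\<delta> * n))"
          unfolding power_mult_distrib by (intro mult_left_mono) auto
      qed (use r in auto)
      also have "\<dots> \<le> fact k * 3 ^ m * 4 ^ k * (exp (- exp (\<delta> * n)) * exp (b * n))"
      proof -
        have "exp (2 * ln m * n) = (real m ^ n)\<^sup>2"
        proof -
          have "exp (2 * ln m * n) = exp (n * ln m) * exp (n * ln m)" by (simp flip: exp_add)
          also have "exp (n * ln m) = real m ^ n" using m by (simp add: exp_of_nat_mult)
          finally show ?thesis by (simp add: power2_eq_square)
        qed
        hence "1 / r = 4 * exp ((\<epsilon> + 2 * ln m) * n)"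
          by (simp add: r_def distrib_right exp_add exp_minus field_simps)
        hence "(1 / r) ^ k = 4 ^ k * exp (k * (\<epsilon> + 2 * ln m) * n)"
          by (simp add: power_mult_distrib exp_of_nat_mult [symmetric] mult_ac)
        hence "1 / r ^ k = 4 ^ k * exp (k * (\<epsilon> + 2 * ln m) * n)" by (simp add: power_divide)
        also have "\<dots> \<le> 4 ^ k * exp (b * n)" by (intro mult_left_mono) (auto simp: b_def algebra_simps)
        finally have "fact k * (3 ^ m * exp (- exp (\<delta> * n))) * (1 / r ^ k) \<le>
            fact k * (3 ^ m * exp (- exp (\<delta> * n))) * (4 ^ k * exp (b * n))" by (intro mult_left_mono) auto
        thus ?thesis by (simp add: mult_ac)
      qed
      also have "\<dots> \<le> fact k * 3 ^ m * 4 ^ k * K" using K by (intro mult_left_mono) auto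
      also have "\<dots> \<le> C * 1" by (simp add: C_def)
      also have "\<dots> \<le> C * exp (\<epsilon> * k * n)"
      proof (rule mult_left_mono)
        show "C \<ge> 0" unfolding C_def by (auto simp: le_max_iff_disj)
      qed (use \<epsilon> in auto)
      finally show ?thesis .
    qed
  qed
qed

end

section \<open>The law of the process\<close>

lemma pmf_add_pair:
  fixes D Q :: "nat pmf"
  shows "pmf (map_pmf (\<lambda>(a, b). a + b) (pair_pmf D Q)) k = (Abs_fps (pmf D) * Abs_fps (pmf Q)) $ k"
proof -
  have eq: "(\<lambda>(a, b). a + b) -` {k} = (\<lambda>i. (i, k - i)) ` {0..k}" by (auto simp: image_iff)
  have "pmf (map_pmf (\<lambda>(a, b). a + b) (pair_pmf D Q)) k = (\<Sum>x\<in>(\<lambda>i. (i, k - i)) ` {0..k}. pmf (pair_pmf D Q) x)"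
    unfolding pmf_map eq by (rule measure_measure_pmf_finite) auto
  also have "\<dots> = (\<Sum>i=0..k. pmf D i * pmf Q (k - i))"
    by (subst sum.reindex) (auto simp: inj_on_def pmf_pair)
  finally show ?thesis by (simp add: fps_mult_nth)
qed

lemma pmf_sum_Pi_pmf:
  fixes D :: "nat pmf"
  assumes "finite A"
  shows "pmf (map_pmf (\<lambda>x. \<Sum>i\<in>A. x i) (Pi_pmf A 0 (\<lambda>_. D))) k = (Abs_fps (pmf D) ^ card A) $ k"
  using assms
proof (induction A arbitrary: k rule: finite_induct)
  case empty
  show ?case by (simp add: indicator_def)
next
  case (insert x A)
  let ?Q = "map_pmf (\<lambda>x. \<Sum>i\<in>A. x i) (Pi_pmf A 0 (\<lambda>_. D))"
  have "map_pmf (\<lambda>f. \<Sum>i\<in>insert x A. f i) (Pi_pmf (insert x A) 0 (\<lambda>_. D)) =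
     map_pmf (\<lambda>(a, f). a + (\<Sum>i\<in>A. f i)) (pair_pmf D (Pi_pmf A 0 (\<lambda>_. D)))"
    unfolding Pi_pmf_insert [OF insert(1,2)] map_pmf_comp
  proof (intro map_pmf_cong refl)
    fix y
    show "(\<Sum>i\<in>insert x A. (case y of (a, f) \<Rightarrow> f(x := a)) i) = (case y of (a, f) \<Rightarrow> a + (\<Sum>i\<in>A. f i))"
    proof (cases y)
      case (Pair a f)
      have "(\<Sum>i\<in>A. (f(x := a)) i) = (\<Sum>i\<in>A. f i)" using insert(2) by (intro sum.cong) auto
      thus ?thesis using insert(1,2) by (simp add: Pair del: fun_upd_apply) simp
    qed
  qed
  also have "\<dots> = map_pmf (\<lambda>(a, b). a + b) (pair_pmf D ?Q)"
    by (simp add: pair_map_pmf2 map_pmf_comp case_prod_unfold)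
  finally have "pmf (map_pmf (\<lambda>f. \<Sum>i\<in>insert x A. f i) (Pi_pmf (insert x A) 0 (\<lambda>_. D))) k =
      (Abs_fps (pmf D) * Abs_fps (pmf ?Q)) $ k" by (simp only: pmf_add_pair)
  also have "Abs_fps (pmf ?Q) = Abs_fps (pmf D) ^ card A"
    by (intro fps_ext) (simp add: insert.IH)
  finally show ?case using insert(1,2) by simp
qed

lemma pmf_map_pred:
  fixes D :: "nat pmf"
  shows "pmf (map_pmf (\<lambda>x. x - 1) D) k = (if k = 0 then pmf D 0 + pmf D 1 else pmf D (Suc k))"
proof -
  have "(\<lambda>x. x - 1 :: nat) -` {k} = (if k = 0 then {0, 1} else {Suc k})" by auto
  thus ?thesis by (simp add: pmf_map measure_measure_pmf_finite)
qed

definition tail_seq :: "nat pmf \<Rightarrow> nat \<Rightarrow> real" where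
  "tail_seq \<mu> k = measure_pmf.prob \<mu> {k<..}"

lemma tail_seq_0: "set_pmf \<mu> \<subseteq> {1..} \<Longrightarrow> tail_seq \<mu> 0 = 1"
  unfolding tail_seq_def by (subst measure_pmf.prob_eq_1) (auto simp: AE_measure_pmf_iff)

lemma tail_seq_Suc: "tail_seq \<mu> k = tail_seq \<mu> (Suc k) + pmf \<mu> (Suc k)"
proof -
  have "{k<..} = {Suc k<..} \<union> {Suc k}" by auto
  moreover have "measure_pmf.prob \<mu> ({Suc k<..} \<union> {Suc k}) = measure_pmf.prob \<mu> {Suc k<..} + measure_pmf.prob \<mu> {Suc k}"
    by (rule measure_pmf.finite_measure_Union) auto
  ultimately show ?thesis unfolding tail_seq_def by (simp add: measure_pmf_single)
qed

text \<open>Links law and recursion: the sum of \<open>m\<close> copies becomes the m-th power, and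
  the positive part merges the values 0 and 1 of the sum, as in
  \<open>pgf_fps_step_nth\<close>.\<close>

lemma pmf_dr_law:
  assumes p: "0 \<le> p" "p \<le> 1" and \<mu>: "set_pmf \<mu> \<subseteq> {1..}"
  shows "pmf (dr_law m \<mu> p n) k = pgf_fps (tails m (tail_seq \<mu>) p n) $ k"
proof (induction n arbitrary: k)
  case 0
  have "pmf \<mu> 0 = 0" using \<mu> by (auto simp: pmf_eq_0_set_pmf)
  thus ?case using p tail_seq_Suc [of \<mu> "k - 1"] tail_seq_0 [OF \<mu>]
    by (auto simp: pmf_initial_law pgf_fps_nth algebra_simps)
next
  case (Suc n)
  let ?U = "tails m (tail_seq \<mu>) p n"
  have F: "Abs_fps (pmf (dr_law m \<mu> p n)) = pgf_fps ?U" by (intro fps_ext) (simp add: Suc)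
  have eq: "dr_law m \<mu> p (Suc n) = map_pmf (\<lambda>x. x - 1) (map_pmf (\<lambda>x. \<Sum>i<m. x i) (Pi_pmf {..<m} 0 (\<lambda>_. dr_law m \<mu> p n)))"
    by (simp add: map_pmf_comp)
  show ?case
    unfolding eq pmf_map_pred pmf_sum_Pi_pmf [OF finite_lessThan] F card_lessThan tails.simps pgf_fps_step_nth ..
qed

text \<open>Rests on \<open>(S - 1)^+ = S - 1 + 1{S = 0}\<close>; the sum vanishes only if all
  copies do, which gives the m-th power.\<close>

lemma dr_law_mean:
  assumes "integrable (measure_pmf (dr_law m \<mu> p n)) real"
  shows "integrable (measure_pmf (dr_law m \<mu> p (Suc n))) real"
    and "dr_mean m \<mu> (Suc n) p = m * dr_mean m \<mu> n p - 1 + pmf (dr_law m \<mu> p n) 0 ^ m"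
proof -
  let ?D = "dr_law m \<mu> p n"
  let ?P = "Pi_pmf {..<m} 0 (\<lambda>_. ?D)"
  have comp: "map_pmf (\<lambda>x. x i) ?P = ?D" if "i < m" for i using that by (simp add: Pi_pmf_component)
  have int1: "integrable (measure_pmf ?P) (\<lambda>x. real (x i))" if "i < m" for i
    using assms comp [OF that] integrable_map_pmf_eq [of "\<lambda>x. x i" ?P real] by simp
  have E1: "measure_pmf.expectation ?P (\<lambda>x. real (x i)) = dr_mean m \<mu> n p" if "i < m" for i
  proof -
    have "dr_mean m \<mu> n p = measure_pmf.expectation (map_pmf (\<lambda>x. x i) ?P) real"
      by (simp only: dr_mean_def comp [OF that])
    thus ?thesis by (simp only: integral_map_pmf)
  qed
  define Z where "Z = {x :: nat \<Rightarrow> nat. (\<Sum>i<m. x i) = 0}"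
  have eq: "real ((\<Sum>i<m. x i) - 1) = (\<Sum>i<m. real (x i)) - 1 + indicator Z x" for x
  proof -
    have "real (S - 1) = real S - 1 + (if S = 0 then 1 else 0)" for S :: nat by (cases S) auto
    from this [of "\<Sum>i<m. x i"] show ?thesis by (simp add: Z_def indicator_def)
  qed
  have intZ: "integrable (measure_pmf ?P) (indicator Z :: _ \<Rightarrow> real)" 
    by (intro integrable_real_indicator) (auto simp: measure_pmf.emeasure_finite less_top [symmetric])
  have intS: "integrable (measure_pmf ?P) (\<lambda>x. \<Sum>i<m. real (x i))"
    using int1 by (intro Bochner_Integration.integrable_sum) auto
  have int2: "integrable (measure_pmf ?P) (\<lambda>x. real ((\<Sum>i<m. x i) - 1))"
    unfolding eq using intZ intS by (intro Bochner_Integration.integrable_add Bochner_Integration.integrable_diff) auto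
  thus "integrable (measure_pmf (dr_law m \<mu> p (Suc n))) real"
    by (simp add: integrable_map_pmf_eq)
  have "dr_mean m \<mu> (Suc n) p = measure_pmf.expectation ?P (\<lambda>x. real ((\<Sum>i<m. x i) - 1))"
    by (simp add: dr_mean_def)
  also have "\<dots> = (\<Sum>i<m. measure_pmf.expectation ?P (\<lambda>x. real (x i))) - 1 + measure_pmf.prob ?P Z"
  proof -
    have "measure_pmf.expectation ?P (\<lambda>x. (\<Sum>i<m. real (x i)) - 1 + indicator Z x) =
        measure_pmf.expectation ?P (\<lambda>x. (\<Sum>i<m. real (x i)) - 1) + measure_pmf.expectation ?P (indicator Z)"
      using intZ intS by (intro Bochner_Integration.integral_add Bochner_Integration.integrable_diff) auto
    also have "measure_pmf.expectation ?P (\<lambda>x. (\<Sum>i<m. real (x i)) - 1) = measure_pmf.expectation ?P (\<lambda>x. \<Sum>i<m. real (x i)) - 1"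
      using intS by (subst Bochner_Integration.integral_diff) auto
    also have "measure_pmf.expectation ?P (\<lambda>x. \<Sum>i<m. real (x i)) = (\<Sum>i<m. measure_pmf.expectation ?P (\<lambda>x. real (x i)))"
      using int1 by (intro Bochner_Integration.integral_sum) auto
    finally show ?thesis unfolding eq by simp
  qed
  also have "(\<Sum>i<m. measure_pmf.expectation ?P (\<lambda>x. real (x i))) = m * dr_mean m \<mu> n p"
    using E1 by simp
  also have "measure_pmf.prob ?P Z = pmf (map_pmf (\<lambda>x. \<Sum>i<m. x i) ?P) 0"
    unfolding pmf_map Z_def by (intro arg_cong2 [of _ _ _ _ measure]) auto
  also have "\<dots> = pmf ?D 0 ^ m" by (simp add: pmf_sum_Pi_pmf fps_power_zeroth)
  finally show "dr_mean m \<mu> (Suc n) p = m * dr_mean m \<mu> n p - 1 + pmf (dr_law m \<mu> p n) 0 ^ m" .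
qed

lemma integrable_real_pmf:
  fixes \<mu> :: "nat pmf"
  assumes "integrable (measure_pmf \<mu>) (\<lambda>k. (s::real) ^ k)" "s > 1"
  shows "integrable (measure_pmf \<mu>) real"
proof (rule Bochner_Integration.integrable_bound [OF integrable_mult_right [OF assms(1), of "1 / (s - 1)"]])
  have "real k \<le> s ^ k / (s - 1)" for k
    using Bernoulli_inequality [of "s - 1" k] assms(2) by (simp add: field_simps)
  moreover have "s ^ k \<ge> 0" for k using assms(2) by simp
  ultimately show "AE x in measure_pmf \<mu>. norm (real x) \<le> norm (1 / (s - 1) * s ^ x)"
    using assms(2) by simp
qed auto

lemma initial_law_expectation:
  assumes p: "0 \<le> p" "p \<le> 1" and int: "integrable (measure_pmf \<mu>) real"
  shows "integrable (measure_pmf (initial_law \<mu> p)) real" "dr_mean m \<mu> 0 p = p * measure_pmf.expectation \<mu> real"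
proof -
  have eq: "pmf (initial_law \<mu> p) k * real k = p * (pmf \<mu> k * real k)" for k
    using p unfolding initial_law_def by (cases "k = 0") (simp_all add: pmf_bind)
  have "integrable (count_space UNIV) (\<lambda>k. pmf \<mu> k * real k)"
    using int unfolding measure_pmf_eq_density by (subst (asm) integrable_density) auto
  hence int': "integrable (count_space UNIV) (\<lambda>k. p * (pmf \<mu> k * real k))" by (rule integrable_mult_right)
  show "integrable (measure_pmf (initial_law \<mu> p)) real"
    using int' unfolding measure_pmf_eq_density by (subst integrable_density) (auto simp: eq)
  have "dr_mean m \<mu> 0 p = (\<integral>k. pmf (initial_law \<mu> p) k * real k \<partial>count_space UNIV)"
    unfolding dr_mean_def measure_pmf_eq_density by (subst integral_density) auto
  also have "\<dots> = p * (\<integral>k. pmf \<mu> k * real k \<partial>count_space UNIV)"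
    unfolding eq by simp
  also have "(\<integral>k. pmf \<mu> k * real k \<partial>count_space UNIV) = measure_pmf.expectation \<mu> real"
    unfolding measure_pmf_eq_density by (subst integral_density) auto
  finally show "dr_mean m \<mu> 0 p = p * measure_pmf.expectation \<mu> real" .
qed

text \<open>Markov's inequality at a radius \<open>t\<close> strictly between \<open>s\<close> and
  \<open>m\<close> gives tails of order \<open>1 / t ^ k\<close>.\<close>

lemma summable_tail_seq:
  fixes \<mu> :: "nat pmf"
  assumes "m \<ge> 2" "0 \<le> s" "s < real m" and int: "\<And>s::real. \<bar>s\<bar> < real m \<Longrightarrow> integrable (measure_pmf \<mu>) (\<lambda>k. s ^ k)"
  shows "summable (\<lambda>k. tail_seq \<mu> k * s ^ k)"
proof -
  define t where "t = (s + m) / 2"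
  have t: "1 \<le> t" "s < t" "t < m" using assms by (auto simp: t_def)
  define C where "C = measure_pmf.expectation \<mu> (\<lambda>k. t ^ k)"
  have int_t: "integrable (measure_pmf \<mu>) (\<lambda>k. t ^ k)" using t by (intro int) auto
  have C: "tail_seq \<mu> k * t ^ k \<le> C" for k
  proof -
    have "tail_seq \<mu> k * t ^ k = measure_pmf.expectation \<mu> (\<lambda>x. indicator {k<..} x * t ^ k)"
      by (simp add: tail_seq_def)
    also have "\<dots> \<le> C"
      unfolding C_def
    proof (rule integral_mono [OF _ int_t])
      have "integrable (measure_pmf \<mu>) (indicator {k<..} :: nat \<Rightarrow> real)"
        by (intro integrable_real_indicator) (auto simp: measure_pmf.emeasure_finite less_top [symmetric])
      thus "integrable (measure_pmf \<mu>) (\<lambda>x. indicator {k<..} x * t ^ k)" by (rule integrable_mult_left)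
      show "indicator {k<..} x * t ^ k \<le> t ^ x" for x
        using t by (auto simp: indicator_def intro!: power_increasing)
    qed
    finally show ?thesis .
  qed
  have "summable (\<lambda>k. C * (s / t) ^ k)"
    using t assms by (intro summable_mult summable_geometric) auto
  thus ?thesis
  proof (rule summable_comparison_test' [where N = 0])
    fix k
    have "tail_seq \<mu> k * s ^ k = (tail_seq \<mu> k * t ^ k) * (s / t) ^ k"
      using t by (simp add: power_divide)
    also have "\<dots> \<le> C * (s / t) ^ k" using C t assms by (intro mult_right_mono) auto
    finally show "norm (tail_seq \<mu> k * s ^ k) \<le> C * (s / t) ^ k"
      using assms by (simp add: tail_seq_def)
  qed
qed

lemma dr_tail_seq:
  assumes "m \<ge> 2" and "set_pmf \<mu> \<subseteq> {1..}" and "measure_pmf.prob \<mu> {2..} > 0"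
    and "\<And>s::real. \<bar>s\<bar> < real m \<Longrightarrow> integrable (measure_pmf \<mu>) (\<lambda>k. s ^ k)"
  shows "dr m (tail_seq \<mu>)"
proof
  have "{1<..} = {2::nat..}" by auto
  thus "tail_seq \<mu> 1 > 0" using assms(3) by (simp add: tail_seq_def)
  show "tail_seq \<mu> (Suc k) \<le> tail_seq \<mu> k" for k using tail_seq_Suc [of \<mu> k] by simp
  show "tail_seq \<mu> 0 = 1" by (rule tail_seq_0) (rule assms)
  show "summable (\<lambda>k. tail_seq \<mu> k * s ^ k)" if "0 \<le> s" "s < real m" for s
    using assms(1) that assms(4) by (rule summable_tail_seq)
qed (use assms in \<open>auto simp: tail_seq_def\<close>)

text \<open>Divided by \<open>m ^ (n + 1)\<close>, the recursion for the means telescopes; the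
  constants \<open>- 1\<close> add up to \<open>- 1 / (m - 1)\<close>.\<close>

lemma free_energy_eq:
  assumes m: "m \<ge> 2" and \<mu>: "set_pmf \<mu> \<subseteq> {1..}" and p: "0 \<le> p" "p \<le> 1"
    and int: "\<And>s::real. \<bar>s\<bar> < real m \<Longrightarrow> integrable (measure_pmf \<mu>) (\<lambda>k. s ^ k)"
  shows "free_energy m \<mu> p = dr_mean m \<mu> 0 p - 1 / (real m - 1) + (\<Sum>n. 1 / real m ^ (n + 1) * pmf (dr_law m \<mu> p n) 0 ^ m)"
proof -
  define g where "g = (\<lambda>n. 1 / real m ^ (n + 1) * pmf (dr_law m \<mu> p n) 0 ^ m)"
  have int0: "integrable (measure_pmf \<mu>) real"
    using m by (intro integrable_real_pmf [of \<mu> "3/2"] int) auto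
  have int_n: "integrable (measure_pmf (dr_law m \<mu> p n)) real" for n
  proof (induction n)
    case 0
    show ?case using initial_law_expectation(1) [OF p int0] by simp
  next
    case (Suc n)
    thus ?case by (rule dr_law_mean)
  qed
  have eq: "dr_mean m \<mu> n p / real m ^ n = dr_mean m \<mu> 0 p - (\<Sum>i<n. (1 / m) * (1 / m) ^ i) + (\<Sum>i<n. g i)" for n
  proof (induction n)
    case (Suc n)
    have "dr_mean m \<mu> (Suc n) p / real m ^ Suc n = dr_mean m \<mu> n p / real m ^ n - 1 / real m ^ Suc n + g n"
      using m unfolding dr_law_mean(2) [OF int_n] by (simp add: g_def field_simps)
    thus ?case using Suc by (simp add: power_divide)
  qed auto
  have s1: "(\<lambda>i. (1 / m) * (1 / m) ^ i) sums ((1 / m) * (1 / (1 - 1 / m)))"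
    using m by (intro sums_mult geometric_sums) auto
  have "summable (\<lambda>i. (1 / real m) * (1 / m) ^ i)" using s1 by (rule sums_summable)
  hence "summable g"
    by (rule summable_comparison_test' [where N = 0])
       (use m in \<open>auto simp: g_def power_divide field_simps pmf_le_1 power_le_one\<close>)
  hence "g sums (\<Sum>n. g n)" by (rule summable_sums)
  hence "(\<lambda>n. dr_mean m \<mu> n p / real m ^ n) \<longlonglongrightarrow> dr_mean m \<mu> 0 p - (1 / m) * (1 / (1 - 1 / m)) + (\<Sum>n. g n)"
    unfolding eq using s1 by (auto simp: sums_def intro!: tendsto_intros)
  hence "free_energy m \<mu> p = dr_mean m \<mu> 0 p - (1 / m) * (1 / (1 - 1 / m)) + (\<Sum>n. g n)"
    unfolding free_energy_def by (rule limI)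
  also have "(1 / m) * (1 / (1 - 1 / m)) = 1 / (real m - 1)" using m by (simp add: field_simps)
  finally show ?thesis by (simp add: g_def)
qed

section \<open>Smoothness of the free energy\<close>

text \<open>Derivatives within a nondegenerate interval are unique, so any explicit chain
  \<open>D\<close> must be the iterated derivative.\<close>

lemma higher_deriv_within_eq:
  fixes D :: "nat \<Rightarrow> real \<Rightarrow> real"
  assumes ab: "a < b" and f: "\<And>x. x \<in> {a..b} \<Longrightarrow> f x = D 0 x"
    and D: "\<And>k x. x \<in> {a..b} \<Longrightarrow> (D k has_vector_derivative D (Suc k) x) (at x within {a..b})"
    and x: "x \<in> {a..b}"
  shows "higher_deriv_within {a..b} k f x = D k x"
  using x
proof (induction k arbitrary: x)
  case (Suc k)
  have "(higher_deriv_within {a..b} k f has_vector_derivative D (Suc k) x) (at x within {a..b})"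
    using D [OF Suc.prems] Suc by (intro has_vector_derivative_transform [OF _ _ D]) auto
  thus ?case
    using vector_derivative_within_cbox [of a b x "higher_deriv_within {a..b} k f" "D (Suc k) x"] ab Suc.prems by simp
qed (use f in auto)

lemma C_infinity_on_interval:
  fixes D :: "nat \<Rightarrow> real \<Rightarrow> real"
  assumes ab: "a < b" and f: "\<And>x. x \<in> {a..b} \<Longrightarrow> f x = D 0 x"
    and D: "\<And>k x. x \<in> {a..b} \<Longrightarrow> (D k has_vector_derivative D (Suc k) x) (at x within {a..b})"
  shows "C_infinity_on {a..b} f"
proof -
  have "higher_deriv_within {a..b} k f differentiable_on {a..b}" for k
    unfolding differentiable_on_def
  proof
    fix x assume x: "x \<in> {a..b}"
    have "(higher_deriv_within {a..b} k f has_vector_derivative D (Suc k) x) (at x within {a..b})"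
      using higher_deriv_within_eq [OF ab f D] by (intro has_vector_derivative_transform [OF x _ D [OF x]]) auto
    thus "higher_deriv_within {a..b} k f differentiable at x within {a..b}"
      by (rule differentiableI_vector)
  qed
  thus ?thesis unfolding C_infinity_on_def by (blast intro: differentiable_imp_continuous_on)
qed

lemma holomorphic_real_part_deriv:
  assumes "f holomorphic_on UNIV"
  shows "((\<lambda>x. Re ((deriv ^^ k) f (of_real x))) has_vector_derivative Re ((deriv ^^ Suc k) f (of_real x))) (at x within S)"
proof -
  have "(deriv ^^ k) f holomorphic_on UNIV" using assms by (intro holomorphic_higher_deriv) auto
  hence "((deriv ^^ k) f has_field_derivative (deriv ^^ Suc k) f (of_real x)) (at (of_real x))"
    using holomorphic_derivI [of "(deriv ^^ k) f" UNIV "of_real x"] by simp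
  hence "((\<lambda>x. (deriv ^^ k) f (of_real x)) has_vector_derivative (deriv ^^ Suc k) f (of_real x)) (at x within S)"
    by (rule has_vector_derivative_real_field)
  thus ?thesis by (rule bounded_linear.has_vector_derivative [OF bounded_linear_Re])
qed

theorem theorem1p1:
  fixes m :: nat and \<mu> :: "nat pmf"
  assumes "m \<ge> 2"
    and "set_pmf \<mu> \<subseteq> {1..}"
    and "measure_pmf.prob \<mu> {2..} > 0"
    and "\<forall>s::real. \<bar>s\<bar> < real m \<longrightarrow> integrable (measure_pmf \<mu>) (\<lambda>k. s ^ k)"
  shows "C_infinity_on {0..1} (free_energy m \<mu>) \<and>
    (\<forall>k.
      uniformly_convergent_on {0..1}
        (\<lambda>N p. \<Sum>n<N. 1 / real m ^ (n + 1) *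
           higher_deriv_within {0..1} k (\<lambda>q. pmf (dr_law m \<mu> q n) 0 ^ m) p) \<and>
      (\<forall>p\<in>{0..1}.
        higher_deriv_within {0..1} k (free_energy m \<mu>) p =
          higher_deriv_within {0..1} k (\<lambda>q. dr_mean m \<mu> 0 q - 1 / (real m - 1)) p +
          (\<Sum>n. 1 / real m ^ (n + 1) *
             higher_deriv_within {0..1} k (\<lambda>q. pmf (dr_law m \<mu> q n) 0 ^ m) p)))"
proof -
  define \<tau> where "\<tau> = tail_seq \<mu>"
  interpret dr m \<tau> unfolding \<tau>_def using assms by (intro dr_tail_seq) auto
  \<comment> \<open>The complex derivatives provide all real derivatives of the zero probability to
    the power \<open>m\<close> at once, endpoints included.\<close>
  define T where "T = (\<lambda>n k x. Re ((deriv ^^ k) (zero_prob m \<tau> n) (of_real x)))"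
  define h where "h = (\<lambda>n k x. 1 / real m ^ (n + 1) * T n k x)"
  have int0: "integrable (measure_pmf \<mu>) real"
    using assms by (intro integrable_real_pmf [of \<mu> "3/2"]) auto
  have T_deriv: "(T n k has_vector_derivative T n (Suc k) x) (at x within S)" for n k x S
    unfolding T_def by (intro holomorphic_real_part_deriv holomorphic_zero_prob)
  have T0: "pmf (dr_law m \<mu> x n) 0 ^ m = T n 0 x" if "x \<in> {0..1}" for n x
  proof -
    have "zero_prob m \<tau> n (of_real x) = of_real ((1 - u x n $ 0) ^ m)"
      by (simp add: zero_prob_def tails_of_real)
    thus ?thesis
      using that assms pmf_dr_law [of x \<mu> m n 0] by (simp add: T_def pgf_fps_nth \<tau>_def)
  qed
  have T_eq: "higher_deriv_within {0..1} k (\<lambda>q. pmf (dr_law m \<mu> q n) 0 ^ m) x = T n k x" if "x \<in> {0..1}" for n k x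
    using that T0 T_deriv by (intro higher_deriv_within_eq) auto
  define G where "G = (\<lambda>k x. \<Sum>n. h n k x)"
  have unif: "uniform_limit {0..1} (\<lambda>N x. \<Sum>n<N. h n k x) (G k) sequentially \<and> (\<forall>x\<in>{0..1}. (\<lambda>n. h n k x) sums G k x)" for k
  proof -
    \<comment> \<open>Gives \<open>exp (\<epsilon> * k * n) \<le> m ^ (n / 2)\<close>, leaving
      \<open>m ^ (- n / 2)\<close> of the weight for the Weierstrass test; \<open>k + 1\<close>
      keeps the quotient meaningful at \<open>k = 0\<close>.\<close>
    define \<epsilon> where "\<epsilon> = (ln m / 2) / (real k + 1)"
    have lnm: "ln m > 0" using assms by simp
    have \<epsilon>: "\<epsilon> > 0" using lnm by (simp add: \<epsilon>_def)
    have \<epsilon>k: "\<epsilon> * k \<le> ln m / 2"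
    proof -
      have "\<epsilon> * k \<le> \<epsilon> * (real k + 1)" using \<epsilon> by simp
      also have "\<dots> = ln m / 2" unfolding \<epsilon>_def by (rule nonzero_eq_divide_eq [THEN iffD1]) auto
      finally show ?thesis .
    qed
    obtain C N where CN: "\<And>n p. n \<ge> N \<Longrightarrow> 0 \<le> p \<Longrightarrow> p \<le> 1 \<Longrightarrow>
      cmod ((deriv ^^ k) (zero_prob m \<tau> n) (of_real p)) \<le> C * exp (\<epsilon> * k * n)"
      using zero_prob_deriv_bound [OF \<epsilon>] by metis
    have bound: "norm (h n k x) \<le> \<bar>C\<bar> * exp (- (ln m / 2)) ^ n" if "n \<ge> N" "x \<in> {0..1}" for n x
    proof -
      have "\<bar>T n k x\<bar> \<le> \<bar>C\<bar> * exp (ln m / 2 * n)"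
      proof -
        have "\<bar>T n k x\<bar> \<le> cmod ((deriv ^^ k) (zero_prob m \<tau> n) (of_real x))" unfolding T_def by (rule abs_Re_le_cmod)
        also have "\<dots> \<le> C * exp (\<epsilon> * k * n)" using that by (intro CN) auto
        also have "\<dots> \<le> \<bar>C\<bar> * exp (ln m / 2 * n)"
        proof -
          have "\<epsilon> * k * n \<le> ln m / 2 * n" using \<epsilon>k by (intro mult_right_mono) auto
          thus ?thesis by (intro mult_mono) auto
        qed
        finally show ?thesis .
      qed
      hence "norm (h n k x) \<le> 1 / real m ^ n * (\<bar>C\<bar> * exp (ln m / 2 * n))"
        unfolding h_def norm_mult using assms(1)
        by (intro mult_mono) (auto simp: field_simps)
      also have "1 / real m ^ n = exp (- ln m) ^ n" using assms(1) by (simp add: exp_minus inverse_eq_divide power_divide)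
      also have "exp (- ln m) ^ n * (\<bar>C\<bar> * exp (ln m / 2 * n)) = \<bar>C\<bar> * exp (- (ln m / 2)) ^ n"
      proof -
        have "exp (- ln m) ^ n * exp (ln m / 2 * n) = exp (- (ln m / 2)) ^ n"
          unfolding exp_of_nat_mult [symmetric] exp_add [symmetric] by (simp add: algebra_simps)
        thus ?thesis by (simp add: mult_ac)
      qed
      finally show ?thesis .
    qed
    have summ: "summable (\<lambda>n. \<bar>C\<bar> * exp (- (ln m / 2)) ^ n)"
      using lnm by (intro summable_mult summable_geometric) auto
    have "uniform_limit {0..1} (\<lambda>N x. \<Sum>n<N. h n k x) (\<lambda>x. \<Sum>n. h n k x) sequentially"
    proof (rule Weierstrass_m_test_ev [OF _ summ])
      show "\<forall>\<^sub>F n in sequentially. \<forall>x\<in>{0..1}. norm (h n k x) \<le> \<bar>C\<bar> * exp (- (ln m / 2)) ^ n"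
        using bound by (intro eventually_sequentiallyI [of N]) blast
    qed
    moreover have "(\<lambda>n. h n k x) sums (\<Sum>n. h n k x)" if "x \<in> {0..1}" for x
      by (rule summable_sums, rule summable_comparison_test' [OF summ]) (rule bound [OF _ that])
    ultimately show ?thesis by (simp add: G_def)
  qed
  have G: "uniform_limit {0..1} (\<lambda>N x. \<Sum>n<N. h n k x) (G k) sequentially"
      "x \<in> {0..1} \<Longrightarrow> (\<lambda>n. h n k x) sums G k x" for k x
    using unif [of k] by blast+
  have G_deriv: "(G k has_vector_derivative G (Suc k) x) (at x within {0..1})" if x: "x \<in> {0..1}" for k x
  proof -
    \<comment> \<open>Termwise differentiation only yields some pointwise sum \<open>g\<close>;
      uniqueness of sums identifies it with \<open>G k\<close>.\<close>
    have "\<exists>g. \<forall>x\<in>{0..1}. (\<lambda>n. h n k x) sums g x \<and> (g has_field_derivative G (Suc k) x) (at x within {0..1})"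
    proof (rule has_field_derivative_series)
      show "(h n k has_field_derivative h n (Suc k) x) (at x within {0..1})" for n x
        unfolding h_def using T_deriv by (intro DERIV_cmult) (simp add: has_real_derivative_iff_has_vector_derivative)
      show "uniform_limit {0..1} (\<lambda>N x. \<Sum>i<N. h i (Suc k) x) (G (Suc k)) sequentially" by (rule G)
      show "summable (\<lambda>n. h n k 0)" using G(2) [of 0 k] by (simp add: sums_iff)
    qed auto
    then obtain g where g: "\<And>x. x \<in> {0..1} \<Longrightarrow> (\<lambda>n. h n k x) sums g x"
      "\<And>x. x \<in> {0..1} \<Longrightarrow> (g has_field_derivative G (Suc k) x) (at x within {0..1})" by blast
    have "(G k has_field_derivative G (Suc k) x) (at x within {0..1})"
    proof (rule has_field_derivative_transform_within [OF g(2) [OF x], of 1])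
      show "g y = G k y" if "y \<in> {0..1}" for y using g(1) [OF that] G(2) [OF that] by (rule sums_unique2)
    qed (use x in auto)
    thus ?thesis by (simp add: has_real_derivative_iff_has_vector_derivative)
  qed
  define A where "A = (\<lambda>(k::nat) (x::real). if k = 0 then x * measure_pmf.expectation \<mu> real - 1 / (real m - 1)
    else if k = 1 then measure_pmf.expectation \<mu> real else (0::real))"
  have A_deriv: "(A k has_vector_derivative A (Suc k) x) (at x within S)" for k x S
    unfolding A_def has_real_derivative_iff_has_vector_derivative [symmetric]
    by (cases "k = 0") (auto intro!: derivative_eq_intros)
  have A0: "dr_mean m \<mu> 0 x - 1 / (real m - 1) = A 0 x" if "x \<in> {0..1}" for x
    using that initial_law_expectation(2) [OF _ _ int0, of x m] by (simp add: A_def)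
  have A_eq: "higher_deriv_within {0..1} k (\<lambda>q. dr_mean m \<mu> 0 q - 1 / (real m - 1)) x = A k x" if "x \<in> {0..1}" for k x
    using that A0 A_deriv by (intro higher_deriv_within_eq) auto
  have F0: "free_energy m \<mu> x = A 0 x + G 0 x" if "x \<in> {0..1}" for x
    using that free_energy_eq [of m \<mu> x] assms A0 [OF that] T0 [OF that] by (simp add: G_def h_def)
  have F_deriv: "((\<lambda>x. A k x + G k x) has_vector_derivative A (Suc k) x + G (Suc k) x) (at x within {0..1})"
    if "x \<in> {0..1}" for k x
    using A_deriv G_deriv [OF that] by (intro has_vector_derivative_add) auto
  have F_eq: "higher_deriv_within {0..1} k (free_energy m \<mu>) x = A k x + G k x" if "x \<in> {0..1}" for k x
    using that F0 F_deriv by (intro higher_deriv_within_eq [where D = "\<lambda>k x. A k x + G k x"]) auto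
  show ?thesis
  proof (intro conjI allI ballI)
    show "C_infinity_on {0..1} (free_energy m \<mu>)"
      using F0 F_deriv by (intro C_infinity_on_interval [where D = "\<lambda>k x. A k x + G k x"]) auto
  next
    fix k
    have "uniform_limit {0..1} (\<lambda>N p. \<Sum>n<N. 1 / real m ^ (n + 1) *
           higher_deriv_within {0..1} k (\<lambda>q. pmf (dr_law m \<mu> q n) 0 ^ m) p) (G k) sequentially"
      using G(1) [of k] T_eq by (subst uniform_limit_cong' [where g = "\<lambda>N x. \<Sum>n<N. h n k x"]) (auto simp: h_def)
    thus "uniformly_convergent_on {0..1} (\<lambda>N p. \<Sum>n<N. 1 / real m ^ (n + 1) *
           higher_deriv_within {0..1} k (\<lambda>q. pmf (dr_law m \<mu> q n) 0 ^ m) p)"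
      by (auto simp: uniformly_convergent_on_def)
  next
    fix k and p :: real assume p: "p \<in> {0..1}"
    show "higher_deriv_within {0..1} k (free_energy m \<mu>) p =
          higher_deriv_within {0..1} k (\<lambda>q. dr_mean m \<mu> 0 q - 1 / (real m - 1)) p +
          (\<Sum>n. 1 / real m ^ (n + 1) *
             higher_deriv_within {0..1} k (\<lambda>q. pmf (dr_law m \<mu> q n) 0 ^ m) p)"
      unfolding F_eq [OF p] A_eq [OF p] T_eq [OF p] by (simp add: G_def h_def)
  qed
qed

end
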